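(* Let $\mathbf{g}$ be a Riemannian metric on $M$ whose Gauss curvature $K$ is negative, so that the isometric embedding system $\mathcal{I}$ of $(M,\mathbf{g})$ into Euclidean $\mathbb{R}^3$ is hyperbolic. Let $k=\sqrt{-K}$ and $q=k^{-3/2}=(-K)^{-3/4}$. Then $\mathcal{I}$ is Darboux integrable if and only if the function $q$ on $M$ satisfies the differential equations $$q_{11}=q_{22}=-3q^{-1/3},\qquad q_{12}=q_{21}=0,$$ where the functions $q_i$, $q_{ij}$ on the oriented orthonormal frame bundle $\mathcal{F}_M$ are defined by $dq=q_i\eta^i$ and $dq_i=q_j\eta^j_i+q_{ij}\eta^j$ ($1\le i,j\le 2$, summation convention).
   Context: $M$ is a connected, oriented smooth surface with Riemannian metric $\mathbf{g}$. $\mathcal{F}_M$ is its oriented orthonormal frame bundle, with canonical (dual) 1-forms $\eta^1,\eta^2$ and connection form $\eta^1_2=-\eta^2_1$ satisfying $d\eta^1=-\eta^1_2\wedge\eta^2$, $d\eta^2=-\eta^2_1\wedge\eta^1$, $d\eta^1_2=K\,\eta^1\wedge\eta^2$, where $K$ is the Gauss curvature; $\eta^1_1=\eta^2_2=0$. Functions on $M$ are pulled back to $\mathcal{F}_M$. $\mathcal{F}_{\mathbb{R}^3}$ is the orthonormal frame bundle of Euclidean $\mathbb{R}^3$, with basepoint map $\rho$ and frame vectors $e_1,e_2,e_3$ (as vector-valued functions), and canonical and connection forms $\omega^i$, $\omega^i_j=-\omega^j_i$ defined by $d\rho=e_i\omega^i$, $de_i=e_j\omega^j_i$. Isometric embedding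 system: $\mathcal{I}$ is the Pfaffian exterior differential system on $\mathcal{F}_M\times\mathcal{F}_{\mathbb{R}^3}$ generated by the 1-forms (pullbacks suppressed) $$\theta_0=\omega^3,\quad \theta_1=\omega^1-\eta^1,\quad \theta_2=\omega^2-\eta^2,\quad \theta_3=\omega^1_2-\eta^1_2 .$$ It is called hyperbolic if $K<0$ and elliptic if $K>0$. When $K<0$, put $k=\sqrt{-K}$. The singular Pfaffian systems of $\mathcal{I}$ are $$V_\pm=\operatorname{span}\{\theta_0,\theta_1,\theta_2,\theta_3,\ \omega^3_1\mp k\eta^2,\ \omega^3_2\pm k\eta^1\}.$$ $\mathcal{I}$ is Darboux integrable if, locally, each of $V_+$ and $V_-$ contains a Frobenius (completely integrable) subbundle of rank at least $2$ that intersects $\operatorname{span}\{\theta_0,\theta_1,\theta_2,\theta_3\}$ only in $0$ (equivalently, $V_+$ and $V_-$ each have at least two independent first integrals, transverse to the 1-forms of $\mathcal{I}$). *)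

theory Defs
  imports "HOL-Analysis.Analysis"
begin

section \<open>Smooth functions and differential forms in Euclidean space\<close>

text \<open>\<open>Ck_on n S f\<close>: all iterated directional derivatives of \<open>f\<close> up to order \<open>n\<close> exist
  (as total derivatives) and are continuous on the open set \<open>S\<close>.\<close>

primrec Ck_on :: "nat \<Rightarrow> 'a::real_normed_vector set \<Rightarrow> ('a \<Rightarrow> 'b::real_normed_vector) \<Rightarrow> bool" where
  "Ck_on 0 S f \<longleftrightarrow> continuous_on S f"
| "Ck_on (Suc n) S f \<longleftrightarrow>
     (\<forall>x\<in>S. f differentiable (at x)) \<and> (\<forall>v. Ck_on n S (\<lambda>x. frechet_derivative f (at x) v))"

definition smooth_on :: "'a::real_normed_vector set \<Rightarrow> ('a \<Rightarrow> 'b::real_normed_vector) \<Rightarrow> bool" where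
  "smooth_on S f \<longleftrightarrow> (\<forall>n. Ck_on n S f)"

text \<open>Embedded submanifolds of a Euclidean space are given by a set \<open>S\<close> together with its
  tangent spaces \<open>T z\<close>. A 1-form on \<open>S\<close> is represented by a 1-form \<open>\<alpha>\<close> on an ambient
  neighbourhood, of which only the restriction to the tangent spaces \<open>T z\<close> matters;
  locally every smooth 1-form on \<open>S\<close> arises in this way, and exterior
  differentiation commutes with the restriction. The same applies to functions on \<open>S\<close>.\<close>

type_synonym 'a form = "'a \<Rightarrow> 'a \<Rightarrow> real"

definition smooth_form_on :: "'a::euclidean_space set \<Rightarrow> 'a form \<Rightarrow> bool" where
  "smooth_form_on N \<alpha> \<longleftrightarrow> (\<forall>z\<in>N. linear (\<alpha> z)) \<and> (\<forall>w. smooth_on N (\<lambda>z. \<alpha> z w))"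

definition ext_deriv :: "'a::euclidean_space form \<Rightarrow> 'a \<Rightarrow> 'a \<Rightarrow> 'a \<Rightarrow> real" where
  "ext_deriv \<alpha> z v w =
     frechet_derivative (\<lambda>y. \<alpha> y w) (at z) v - frechet_derivative (\<lambda>y. \<alpha> y v) (at z) w"

definition wedge :: "'a form \<Rightarrow> 'a form \<Rightarrow> 'a \<Rightarrow> 'a \<Rightarrow> 'a \<Rightarrow> real" where
  "wedge \<alpha> \<beta> z v w = \<alpha> z v * \<beta> z w - \<alpha> z w * \<beta> z v"

section \<open>Pfaffian systems\<close>

text \<open>The fibre at \<open>z\<close> of the Pfaffian system generated by a list of 1-forms. Covectors on the
  tangent space \<open>T z\<close> are represented by arbitrary functions, identified when they agree
  on \<open>T z\<close>.\<close>

definition pfaff_span :: "('a \<Rightarrow> 'a set) \<Rightarrow> 'a form list \<Rightarrow> 'a \<Rightarrow> ('a \<Rightarrow> real) set" where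
  "pfaff_span T fs z =
     {\<beta>. \<exists>a. \<forall>w\<in>T z. \<beta> w = (\<Sum>i<length fs. a i * (fs ! i) z w)}"

definition pfaff_independent :: "('a \<Rightarrow> 'a set) \<Rightarrow> 'a form list \<Rightarrow> 'a \<Rightarrow> bool" where
  "pfaff_independent T fs z \<longleftrightarrow>
     (\<forall>a. (\<forall>w\<in>T z. (\<Sum>i<length fs. a i * (fs ! i) z w) = 0) \<longrightarrow> (\<forall>i<length fs. a i = 0))"

text \<open>The Frobenius condition \<open>d\<alpha> \<equiv> 0 mod fs\<close> for every \<open>\<alpha>\<close> in the list \<open>fs\<close>.\<close>

definition pfaff_frobenius :: "('a::euclidean_space \<Rightarrow> 'a set) \<Rightarrow> 'a form list \<Rightarrow> 'a \<Rightarrow> bool" where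
  "pfaff_frobenius T fs z \<longleftrightarrow>
     (\<forall>v\<in>T z. \<forall>w\<in>T z. (\<forall>\<beta>\<in>set fs. \<beta> z v = 0 \<and> \<beta> z w = 0)
        \<longrightarrow> (\<forall>\<alpha>\<in>set fs. ext_deriv \<alpha> z v w = 0))"

text \<open>Near every point of \<open>S\<close>, the system \<open>V\<close> contains a Frobenius subbundle of rank at least 2
  (spanned by the frame \<open>fs\<close>) that meets the span of \<open>\<Theta>\<close> only in 0.\<close>

definition has_transverse_frobenius_subbundle ::
  "'a::euclidean_space set \<Rightarrow> ('a \<Rightarrow> 'a set) \<Rightarrow> 'a form list \<Rightarrow> 'a form list \<Rightarrow> bool" where
  "has_transverse_frobenius_subbundle S T V \<Theta> \<longleftrightarrow>
     (\<forall>z\<in>S. \<exists>N fs. open N \<and> z \<in> N \<and> 2 \<le> length fs \<and> (\<forall>\<alpha>\<in>set fs. smooth_form_on N \<alpha>) \<and>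
        (\<forall>y\<in>S \<inter> N. pfaff_independent T fs y \<and> pfaff_frobenius T fs y \<and>
           pfaff_span T fs y \<subseteq> pfaff_span T V y \<and>
           (\<forall>\<beta>\<in>pfaff_span T fs y \<inter> pfaff_span T \<Theta> y. \<forall>w\<in>T y. \<beta> w = 0)))"

section \<open>Oriented Riemannian surfaces\<close>

text \<open>A chart \<open>c = (U, \<phi>)\<close> of the surface, whose points are the elements of the type \<open>'p\<close>.\<close>

type_synonym 'p chart = "'p set \<times> ('p \<Rightarrow> real^2)"

definition chart_im :: "'p chart \<Rightarrow> (real^2) set" where
  "chart_im c = snd c ` fst c"

definition chart_inv :: "'p chart \<Rightarrow> real^2 \<Rightarrow> 'p" where
  "chart_inv c = inv_into (fst c) (snd c)"

definition overlap :: "'p chart \<Rightarrow> 'p chart \<Rightarrow> (real^2) set" where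
  "overlap c c' = snd c ` (fst c \<inter> fst c')"

definition transition :: "'p chart \<Rightarrow> 'p chart \<Rightarrow> real^2 \<Rightarrow> real^2" where
  "transition c c' = snd c' \<circ> chart_inv c"

definition jacobian :: "'p chart \<Rightarrow> 'p chart \<Rightarrow> real^2 \<Rightarrow> real^2^2" where
  "jacobian c c' x = matrix (frechet_derivative (transition c c') (at x))"

definition oriented_surface :: "'p::{t2_space, second_countable_topology} chart set \<Rightarrow> bool" where
  "oriented_surface A \<longleftrightarrow>
     (\<Union>c\<in>A. fst c) = UNIV \<and>
     (\<forall>c\<in>A. open (fst c) \<and> open (chart_im c) \<and>
        homeomorphism (fst c) (chart_im c) (snd c) (chart_inv c)) \<and>
     (\<forall>c\<in>A. \<forall>c'\<in>A. smooth_on (overlap c c') (transition c c') \<and>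
        (\<forall>x\<in>overlap c c'. det (jacobian c c' x) > 0))"

text \<open>A Riemannian metric is given by its coefficient matrices \<open>G c x\<close> in the charts.\<close>

definition riemannian_metric ::
  "'p::{t2_space, second_countable_topology} chart set \<Rightarrow> ('p chart \<Rightarrow> real^2 \<Rightarrow> real^2^2) \<Rightarrow> bool" where
  "riemannian_metric A G \<longleftrightarrow>
     (\<forall>c\<in>A. smooth_on (chart_im c) (G c) \<and>
        (\<forall>x\<in>chart_im c. transpose (G c x) = G c x \<and> (\<forall>v. v \<noteq> 0 \<longrightarrow> v \<bullet> (G c x *v v) > 0))) \<and>
     (\<forall>c\<in>A. \<forall>c'\<in>A. \<forall>x\<in>overlap c c'.
        G c x = transpose (jacobian c c' x) ** G c' (transition c c' x) ** jacobian c c' x)"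

definition smooth_function_on_surface ::
  "'p::{t2_space, second_countable_topology} chart set \<Rightarrow> ('p \<Rightarrow> real) \<Rightarrow> bool" where
  "smooth_function_on_surface A f \<longleftrightarrow> (\<forall>c\<in>A. smooth_on (chart_im c) (f \<circ> chart_inv c))"

section \<open>Frame bundles\<close>

text \<open>A frame over a coordinate domain is a pair \<open>(x, u)\<close>: \<open>x\<close> is the base point, and the rows
  \<open>u $ i\<close> of the matrix \<open>u\<close> are the components of the frame vectors. The entry \<open>i j\<close> of
  \<open>gram G (x, u)\<close> is the inner product of the frame vectors \<open>i\<close> and \<open>j\<close>. It has maximal rank as
  a function of \<open>(x, u)\<close> into symmetric matrices, so the orthonormal frames form an embedded
  submanifold whose tangent spaces are the kernels of its derivative.\<close>

type_synonym 'n frame = "(real^'n) \<times> (real^'n^'n)"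

definition gram :: "(real^'n \<Rightarrow> real^'n^'n) \<Rightarrow> 'n::finite frame \<Rightarrow> real^'n^'n" where
  "gram G z = snd z ** G (fst z) ** transpose (snd z)"

definition frame_tangent :: "(real^'n \<Rightarrow> real^'n^'n) \<Rightarrow> 'n::finite frame \<Rightarrow> 'n frame set" where
  "frame_tangent G z = {w. frechet_derivative (gram G) (at z) w = 0}"

subsection \<open>The oriented orthonormal frame bundle of the surface\<close>

text \<open>\<open>FM G c\<close> is the part of the oriented orthonormal frame bundle over the domain of the chart
  \<open>c\<close>, in the coordinates induced by \<open>c\<close>; \<open>frame_dom c\<close> is the ambient open set of all positively
  oriented frames. The patches \<open>FM G c\<close> are glued by \<open>frame_transition\<close>.\<close>

definition frame_dom :: "'p chart \<Rightarrow> 2 frame set" where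
  "frame_dom c = {z. fst z \<in> chart_im c \<and> det (snd z) > 0}"

definition FM :: "('p chart \<Rightarrow> real^2 \<Rightarrow> real^2^2) \<Rightarrow> 'p chart \<Rightarrow> 2 frame set" where
  "FM G c = {z \<in> frame_dom c. gram (G c) z = mat 1}"

definition frame_transition :: "'p chart \<Rightarrow> 'p chart \<Rightarrow> 2 frame \<Rightarrow> 2 frame" where
  "frame_transition c c' z =
     (transition c c' (fst z), \<chi> i. jacobian c c' (fst z) *v (snd z $ i))"

text \<open>A function, respectively 1-form, on the frame bundle is a family of local expressions
  on the patches that agree on overlaps.\<close>

definition smooth_frame_function ::
  "'p chart set \<Rightarrow> ('p chart \<Rightarrow> real^2 \<Rightarrow> real^2^2) \<Rightarrow> ('p chart \<Rightarrow> 2 frame \<Rightarrow> real) \<Rightarrow> bool" where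
  "smooth_frame_function A G f \<longleftrightarrow>
     (\<forall>c\<in>A. smooth_on (frame_dom c) (f c)) \<and>
     (\<forall>c\<in>A. \<forall>c'\<in>A. \<forall>z\<in>FM G c. fst z \<in> overlap c c' \<longrightarrow> f c z = f c' (frame_transition c c' z))"

definition smooth_frame_form ::
  "'p chart set \<Rightarrow> ('p chart \<Rightarrow> real^2 \<Rightarrow> real^2^2) \<Rightarrow> ('p chart \<Rightarrow> 2 frame form) \<Rightarrow> bool" where
  "smooth_frame_form A G \<alpha> \<longleftrightarrow>
     (\<forall>c\<in>A. smooth_form_on (frame_dom c) (\<alpha> c)) \<and>
     (\<forall>c\<in>A. \<forall>c'\<in>A. \<forall>z\<in>FM G c. fst z \<in> overlap c c' \<longrightarrow>
        (\<forall>w\<in>frame_tangent (G c) z. \<alpha> c z w =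
           \<alpha> c' (frame_transition c c' z) (frechet_derivative (frame_transition c c') (at z) w)))"

text \<open>Local expression of the pullback of a function on the surface.\<close>

definition frame_pullback :: "('p \<Rightarrow> real) \<Rightarrow> 'p chart \<Rightarrow> 2 frame \<Rightarrow> real" where
  "frame_pullback f c z = f (chart_inv c (fst z))"

text \<open>The canonical forms: \<open>w\<close> projects to the vector \<open>\<Sum>i. \<eta> i (w) u $ i\<close> on the surface, so
  \<open>\<eta> i (w)\<close> is the inner product of that vector with the unit vector \<open>u $ i\<close>.\<close>

definition eta :: "('p chart \<Rightarrow> real^2 \<Rightarrow> real^2^2) \<Rightarrow> 'p chart \<Rightarrow> 2 \<Rightarrow> 2 frame form" where
  "eta G c i z w = (snd z $ i) \<bullet> (G c (fst z) *v fst w)"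

text \<open>The skew matrix of connection forms: \<open>conn \<eta>12 i j\<close> is \<open>\<eta>\<close> with upper index \<open>i\<close> and lower
  index \<open>j\<close>.\<close>

definition conn :: "2 frame form \<Rightarrow> 2 \<Rightarrow> 2 \<Rightarrow> 2 frame form" where
  "conn \<eta>12 i j z w =
     (if i = 1 \<and> j = 2 then \<eta>12 z w else if i = 2 \<and> j = 1 then - \<eta>12 z w else 0)"

text \<open>The first structure equations determine the connection form on the frame bundle uniquely,
  and the second one then determines the Gauss curvature.\<close>

definition connection_form ::
  "'p chart set \<Rightarrow> ('p chart \<Rightarrow> real^2 \<Rightarrow> real^2^2) \<Rightarrow> ('p chart \<Rightarrow> 2 frame form) \<Rightarrow> bool" where
  "connection_form A G \<eta>12 \<longleftrightarrow>
     smooth_frame_form A G \<eta>12 \<and>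
     (\<forall>c\<in>A. \<forall>z\<in>FM G c. \<forall>v\<in>frame_tangent (G c) z. \<forall>w\<in>frame_tangent (G c) z. \<forall>i.
        ext_deriv (eta G c i) z v w =
          - (\<Sum>j\<in>UNIV. wedge (conn (\<eta>12 c) i j) (eta G c j) z v w))"

definition gauss_curvature ::
  "'p::{t2_space, second_countable_topology} chart set \<Rightarrow> ('p chart \<Rightarrow> real^2 \<Rightarrow> real^2^2)
    \<Rightarrow> ('p chart \<Rightarrow> 2 frame form) \<Rightarrow> ('p \<Rightarrow> real) \<Rightarrow> bool" where
  "gauss_curvature A G \<eta>12 K \<longleftrightarrow>
     smooth_function_on_surface A K \<and>
     (\<forall>c\<in>A. \<forall>z\<in>FM G c. \<forall>v\<in>frame_tangent (G c) z. \<forall>w\<in>frame_tangent (G c) z.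
        ext_deriv (\<eta>12 c) z v w =
          frame_pullback K c z * wedge (eta G c 1) (eta G c 2) z v w)"

text \<open>\<open>q\<^sub>i\<close> and \<open>q\<^sub>i\<^sub>j\<close> are characterised by \<open>dq = \<Sum>i. q\<^sub>i \<eta>\<^sup>i\<close> and
  \<open>dq\<^sub>i = \<Sum>j. q\<^sub>j \<eta>\<^sup>j\<^sub>i + q\<^sub>i\<^sub>j \<eta>\<^sup>j\<close> on the frame bundle.\<close>

definition first_frame_derivs ::
  "'p chart set \<Rightarrow> ('p chart \<Rightarrow> real^2 \<Rightarrow> real^2^2) \<Rightarrow> ('p \<Rightarrow> real)
    \<Rightarrow> (2 \<Rightarrow> 'p chart \<Rightarrow> 2 frame \<Rightarrow> real) \<Rightarrow> bool" where
  "first_frame_derivs A G q Q1 \<longleftrightarrow>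
     (\<forall>i. smooth_frame_function A G (Q1 i)) \<and>
     (\<forall>c\<in>A. \<forall>z\<in>FM G c. \<forall>w\<in>frame_tangent (G c) z.
        frechet_derivative (frame_pullback q c) (at z) w = (\<Sum>i\<in>UNIV. Q1 i c z * eta G c i z w))"

definition second_frame_derivs ::
  "'p chart set \<Rightarrow> ('p chart \<Rightarrow> real^2 \<Rightarrow> real^2^2) \<Rightarrow> ('p chart \<Rightarrow> 2 frame form)
    \<Rightarrow> (2 \<Rightarrow> 'p chart \<Rightarrow> 2 frame \<Rightarrow> real) \<Rightarrow> (2 \<Rightarrow> 2 \<Rightarrow> 'p chart \<Rightarrow> 2 frame \<Rightarrow> real) \<Rightarrow> bool" where
  "second_frame_derivs A G \<eta>12 Q1 Q2 \<longleftrightarrow>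
     (\<forall>i j. smooth_frame_function A G (Q2 i j)) \<and>
     (\<forall>c\<in>A. \<forall>z\<in>FM G c. \<forall>w\<in>frame_tangent (G c) z. \<forall>i.
        frechet_derivative (Q1 i c) (at z) w =
          (\<Sum>j\<in>UNIV. Q1 j c z * conn (\<eta>12 c) j i z w) + (\<Sum>j\<in>UNIV. Q2 i j c z * eta G c j z w))"

subsection \<open>The orthonormal frame bundle of Euclidean 3-space\<close>

text \<open>Here \<open>z = (\<rho>, e)\<close> with frame vectors \<open>e $ i\<close>, and a tangent vector \<open>w = (d\<rho>, de)\<close>.\<close>

definition FE :: "3 frame set" where
  "FE = {z. gram (\<lambda>_. mat 1) z = mat 1}"

definition om :: "3 \<Rightarrow> 3 frame form" where
  "om i z w = (snd z $ i) \<bullet> fst w"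

text \<open>\<open>om_conn i j\<close> is \<open>\<omega>\<close> with upper index \<open>i\<close> and lower index \<open>j\<close>.\<close>

definition om_conn :: "3 \<Rightarrow> 3 \<Rightarrow> 3 frame form" where
  "om_conn i j z w = (snd z $ i) \<bullet> (snd w $ j)"

section \<open>The isometric embedding system\<close>

type_synonym pt = "2 frame \<times> 3 frame"

definition total_space :: "('p chart \<Rightarrow> real^2 \<Rightarrow> real^2^2) \<Rightarrow> 'p chart \<Rightarrow> pt set" where
  "total_space G c = FM G c \<times> FE"

definition total_tangent :: "('p chart \<Rightarrow> real^2 \<Rightarrow> real^2^2) \<Rightarrow> 'p chart \<Rightarrow> pt \<Rightarrow> pt set" where
  "total_tangent G c z = frame_tangent (G c) (fst z) \<times> frame_tangent (\<lambda>_. mat 1) (snd z)"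

definition pull_M :: "2 frame form \<Rightarrow> pt form" where
  "pull_M \<alpha> z w = \<alpha> (fst z) (fst w)"

definition pull_E :: "3 frame form \<Rightarrow> pt form" where
  "pull_E \<alpha> z w = \<alpha> (snd z) (snd w)"

definition theta ::
  "('p chart \<Rightarrow> real^2 \<Rightarrow> real^2^2) \<Rightarrow> ('p chart \<Rightarrow> 2 frame form) \<Rightarrow> 'p chart \<Rightarrow> pt form list" where
  "theta G \<eta>12 c =
    [ pull_E (om 3),
      (\<lambda>z w. pull_E (om 1) z w - pull_M (eta G c 1) z w),
      (\<lambda>z w. pull_E (om 2) z w - pull_M (eta G c 2) z w),
      (\<lambda>z w. pull_E (om_conn 1 2) z w - pull_M (\<eta>12 c) z w) ]"

text \<open>The singular systems \<open>V\<^sub>+\<close> (for \<open>\<epsilon> = 1\<close>) and \<open>V\<^sub>-\<close> (for \<open>\<epsilon> = -1\<close>).\<close>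

definition singular_system ::
  "('p chart \<Rightarrow> real^2 \<Rightarrow> real^2^2) \<Rightarrow> ('p chart \<Rightarrow> 2 frame form) \<Rightarrow> ('p \<Rightarrow> real) \<Rightarrow> real
    \<Rightarrow> 'p chart \<Rightarrow> pt form list" where
  "singular_system G \<eta>12 K \<epsilon> c = theta G \<eta>12 c @
    (let k = (\<lambda>z. sqrt (- frame_pullback K c (fst z))) in
      [ (\<lambda>z w. pull_E (om_conn 3 1) z w - \<epsilon> * k z * pull_M (eta G c 2) z w),
        (\<lambda>z w. pull_E (om_conn 3 2) z w + \<epsilon> * k z * pull_M (eta G c 1) z w) ])"

text \<open>Darboux integrability is a local condition on the total space, so it is imposed on each
  of the patches \<open>total_space G c\<close> covering it.\<close>

definition darboux_integrable ::
  "'p::{t2_space, second_countable_topology} chart set \<Rightarrow> ('p chart \<Rightarrow> real^2 \<Rightarrow> real^2^2)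
    \<Rightarrow> ('p chart \<Rightarrow> 2 frame form) \<Rightarrow> ('p \<Rightarrow> real) \<Rightarrow> bool" where
  "darboux_integrable A G \<eta>12 K \<longleftrightarrow>
     (\<forall>c\<in>A. \<forall>\<epsilon>\<in>{1, -1}.
        has_transverse_frobenius_subbundle (total_space G c) (total_tangent G c)
          (singular_system G \<eta>12 K \<epsilon> c) (theta G \<eta>12 c))"

end

theory Submission
  imports Defs
begin

text \<open>Put \<open>k = sqrt (-K)\<close>, \<open>n\<^sub>i = q\<^sub>i / (3 q)\<close>, \<open>\<pi>\<^sub>1 = \<omega>\<^sup>3\<^sub>1 - \<epsilon> k \<eta>\<^sup>2\<close> and \<open>\<pi>\<^sub>2 = \<omega>\<^sup>3\<^sub>2 + \<epsilon> k \<eta>\<^sup>1\<close>. If the differential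
  equations for \<open>q\<close> hold, the structure equations show that the two forms \<open>\<pi>\<^sub>i - (\<epsilon> n\<^sub>i / k) \<theta>\<^sub>3\<close> span a
  Frobenius system.

  Conversely, let \<open>D\<close> be the distribution annihilated by a transverse Frobenius subbundle of \<open>V\<^sub>\<epsilon>\<close>. Since
  \<open>D\<close> is involutive and contains the annihilator of \<open>V\<^sub>\<epsilon>\<close>, it contains all iterated brackets of vector
  fields in that annihilator. Two rounds of brackets give a distribution of rank 6, whereas \<open>D\<close> has
  rank 7; that the third round stays inside \<open>D\<close> is an overdetermined system, for the two slopes of \<open>D\<close> modulo
  the rank 6 part. Those of its equations which are free of third derivatives of \<open>q\<close> determine the Hessian of \<open>q\<close> pointwise.\<close>

section \<open>Calculus of smooth functions\<close>

text \<open>The total space has dimension 9, and the annihilator of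
  \<open>V\<^sub>\<epsilon>\<close> has rank 3: lifts of the two standard horizontal fields, and the
  rotation of both frames together. The first bracket adds a field with
  \<open>\<omega>\<^sup>3 = 1\<close>, \<open>\<omega>\<^sup>1\<^sub>2 = \<epsilon> k\<close>,
  \<open>\<omega>\<^sup>3\<^sub>i = n\<^sub>i\<close>. This is the origin of the coefficient
  \<open>\<epsilon> n\<^sub>i / k\<close>: it is the only multiple of
  \<open>\<theta>\<^sub>3\<close> whose subtraction makes \<open>\<pi>\<^sub>i\<close> vanish on
  that field. The fields used have Euclidean components that are left-invariant, with coefficients
  living on the surface bundle, so brackets reduce to derivatives on that bundle and commutators of
  infinitesimal motions. The obstacle is that third-round brackets with horizontal fields
  differentiate the Hessian of \<open>q\<close>. For each horizontal direction the derivative of the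
  mixed entry occurs in two slope equations with opposite signs, and their sum is again algebraic.
  Since the bundles are embedded in vector spaces, fields and forms are ambient and only their
  restrictions count; brackets are therefore always tested by forms along the submanifold.\<close>

lemma frechet_derivative_eqI:
  "(f has_derivative f') (at x) \<Longrightarrow> frechet_derivative f (at x) v = f' v"
  using frechet_derivative_at by metis

lemma frechet_derivative_worksI:
  "(f has_derivative f') (at x) \<Longrightarrow> (f has_derivative frechet_derivative f (at x)) (at x)"
  using frechet_derivative_works differentiableI by blast

text \<open>\<open>frechet_derivative\<close> picks one element of the set of derivatives. Functions
  agreeing near the point have the same set, so the picked maps coincide.\<close>

lemma frechet_derivative_cong_open:
  assumes "open S" "x \<in> S" "\<And>y. y \<in> S \<Longrightarrow> f y = g y"
  shows "frechet_derivative f (at x) = frechet_derivative g (at x)"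
proof -
  have "\<And>f'. (f has_derivative f') (at x) \<longleftrightarrow> (g has_derivative f') (at x)"
    using has_derivative_transform_within_open[OF _ assms(1,2)] assms(3) by metis
  then show ?thesis unfolding frechet_derivative_def by simp
qed

section \<open>Closure properties of functions of finite and infinite order\<close>

lemma Ck_on_cong:
  assumes "open S" "\<And>y. y \<in> S \<Longrightarrow> f y = g y"
  shows "Ck_on n S f \<longleftrightarrow> Ck_on n S g"
  using assms(2)
proof (induction n arbitrary: f g)
  case 0
  then show ?case by (simp cong: continuous_on_cong)
next
  case (Suc n)
  have d: "f differentiable (at x) \<longleftrightarrow> g differentiable (at x)" if "x \<in> S" for x
    using has_derivative_transform_within_open[OF _ assms(1) that] Suc.prems
    unfolding differentiable_def by metis
  have "Ck_on n S (\<lambda>x. frechet_derivative f (at x) v) \<longleftrightarrow>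
      Ck_on n S (\<lambda>x. frechet_derivative g (at x) v)" for v
    by (rule Suc.IH) (simp add: frechet_derivative_cong_open[OF assms(1) _ Suc.prems])
  with d show ?case by auto
qed

text \<open>The recursion in \<open>Ck_on\<close> refers to the chosen
  \<open>frechet_derivative\<close>; this rule lets an explicit derivative stand in for it in the
  closure rules below.\<close>

lemma Ck_on_SucI:
  assumes "open S" "\<And>x. x \<in> S \<Longrightarrow> (f has_derivative f' x) (at x)"
    and "\<And>v. Ck_on n S (\<lambda>x. f' x v)"
  shows "Ck_on (Suc n) S f"
proof -
  have "Ck_on n S (\<lambda>x. frechet_derivative f (at x) v)" for v
    using assms(3)[of v] frechet_derivative_eqI[OF assms(2)]
    by (subst Ck_on_cong[OF assms(1), of _ "\<lambda>x. f' x v"]) auto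
  then show ?thesis using assms(2) unfolding Ck_on.simps differentiable_def by blast
qed

lemma Ck_on_SucD:
  assumes "Ck_on (Suc n) S f"
  shows "\<And>x. x \<in> S \<Longrightarrow> (f has_derivative frechet_derivative f (at x)) (at x)"
    and "Ck_on n S (\<lambda>x. frechet_derivative f (at x) v)"
  using assms frechet_derivative_works by auto

lemma Ck_on_Suc_imp: "Ck_on (Suc n) S f \<Longrightarrow> Ck_on n S f"
proof (induction n arbitrary: f)
  case 0
  then show ?case
    by (auto intro!: continuous_at_imp_continuous_on differentiable_imp_continuous_within)
next
  case (Suc n)
  then show ?case by (metis Ck_on.simps(2))
qed

lemma Ck_on_const: "open S \<Longrightarrow> Ck_on n S (\<lambda>x. c)"
proof (induction n arbitrary: c)
  case (Suc n)
  show ?case by (rule Ck_on_SucI[where f' = "\<lambda>_ _. 0"]) (use Suc in auto)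
qed auto

lemma Ck_on_bounded_linear: "open S \<Longrightarrow> bounded_linear f \<Longrightarrow> Ck_on n S f"
proof (cases n)
  case 0
  then show "bounded_linear f \<Longrightarrow> ?thesis" by (simp add: linear_continuous_on)
next
  case (Suc m)
  assume "open S" "bounded_linear f"
  then show ?thesis unfolding Suc
    by (intro Ck_on_SucI[where f' = "\<lambda>_. f"] bounded_linear_imp_has_derivative Ck_on_const)
qed

lemma Ck_on_add:
  assumes "open S" shows "Ck_on n S f \<Longrightarrow> Ck_on n S g \<Longrightarrow> Ck_on n S (\<lambda>x. f x + g x)"
proof (induction n arbitrary: f g)
  case 0
  then show ?case by (simp add: continuous_on_add)
next
  case (Suc n)
  show ?case
    by (rule Ck_on_SucI[OF assms, where
          f' = "\<lambda>x v. frechet_derivative f (at x) v + frechet_derivative g (at x) v"])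
      (use Suc in \<open>auto intro!: has_derivative_add Ck_on_SucD(1)\<close>)
qed

text \<open>By the Leibniz rule a directional derivative is a sum of two terms of the same bilinear
  shape, so the induction closes once the undifferentiated factor is lowered by one order.\<close>

lemma Ck_on_bilinear:
  assumes "open S" "bounded_bilinear h"
  shows "Ck_on n S f \<Longrightarrow> Ck_on n S g \<Longrightarrow> Ck_on n S (\<lambda>x. h (f x) (g x))"
proof (induction n arbitrary: f g)
  case 0
  then show ?case using bounded_bilinear.continuous_on[OF assms(2)] by simp
next
  case (Suc n)
  show ?case
    by (rule Ck_on_SucI[OF assms(1), where
          f' = "\<lambda>x v. h (f x) (frechet_derivative g (at x) v) + h (frechet_derivative f (at x) v) (g x)"])
      (use Suc in \<open>auto intro!: bounded_bilinear.FDERIV[OF assms(2)] Ck_on_SucD(1) Ck_on_add assms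
         Suc.IH Ck_on_Suc_imp[of n S f] Ck_on_Suc_imp[of n S g]\<close>)
qed

lemma Ck_on_linear_comp:
  assumes "open S" "bounded_linear L"
  shows "Ck_on n S f \<Longrightarrow> Ck_on n S (\<lambda>x. L (f x))"
proof (induction n arbitrary: f)
  case 0
  then show ?case using linear_continuous_on_compose assms(2) bounded_linear.linear 
    by (auto intro: bounded_linear.continuous_on)
next
  case (Suc n)
  show ?case
    by (rule Ck_on_SucI[OF assms(1), where f' = "\<lambda>x v. L (frechet_derivative f (at x) v)"])
      (use Suc in \<open>auto intro!: bounded_linear.has_derivative[OF assms(2)] Ck_on_SucD(1)\<close>)
qed

text \<open>The inner maps that occur later are the projections of products, for which the linear
  chain rule is enough.\<close>

lemma Ck_on_comp_linear:
  assumes "open S'" "bounded_linear L" "L ` S' \<subseteq> S"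
  shows "Ck_on n S f \<Longrightarrow> Ck_on n S' (\<lambda>x. f (L x))"
proof (induction n arbitrary: f)
  case 0
  then have "continuous_on (L ` S') f" using assms(3) continuous_on_subset by auto
  then show ?case using continuous_on_compose2[OF _ linear_continuous_on[OF assms(2)]] by auto
next
  case (Suc n)
  have "((\<lambda>x. f (L x)) has_derivative (\<lambda>v. frechet_derivative f (at (L x)) (L v))) (at x)"
    if "x \<in> S'" for x
    using has_derivative_compose[OF bounded_linear_imp_has_derivative[OF assms(2)] Ck_on_SucD(1)[OF Suc.prems]]
      that assms(3) by blast
  then show ?case
    by (intro Ck_on_SucI[OF assms(1), where f' = "\<lambda>x v. frechet_derivative f (at (L x)) (L v)"])
      (use Suc in \<open>auto\<close>)
qed

text \<open>The exponent is generalised in the induction because differentiation lowers it by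
  one.\<close>

lemma Ck_on_powr:
  fixes f :: "'a::real_normed_vector \<Rightarrow> real"
  assumes "open S" "\<And>x. x \<in> S \<Longrightarrow> f x > 0"
  shows "Ck_on n S f \<Longrightarrow> Ck_on n S (\<lambda>x. f x powr a)"
proof (induction n arbitrary: a)
  case 0
  have "\<forall>x\<in>S. f x \<noteq> 0" using assms(2) by force
  then show ?case using 0 by (auto intro!: continuous_on_powr continuous_intros)
next
  case (Suc n)
  have d: "((\<lambda>x. f x powr a) has_derivative (\<lambda>v. (a * f x powr (a - 1)) * frechet_derivative f (at x) v)) (at x)"
    if "x \<in> S" for x
  proof -
    have "((\<lambda>x. x powr a) has_derivative (*) (a * f x powr (a - 1))) (at (f x))"
      using has_real_derivative_powr[OF assms(2)[OF that], of a] by (simp add: has_field_derivative_def)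
    from has_derivative_compose[OF Ck_on_SucD(1)[OF Suc.prems that] this] show ?thesis .
  qed
  have "Ck_on n S (\<lambda>x. f x powr (a - 1))"
    using Suc by (blast intro: Ck_on_Suc_imp)
  then show ?case
    by (intro Ck_on_SucI[OF assms(1) d])
     (use Suc in \<open>auto intro!: Ck_on_bilinear[OF assms(1) bounded_bilinear_mult] Ck_on_const assms(1)\<close>)
qed

lemma smooth_on_cong:
  "open S \<Longrightarrow> (\<And>y. y \<in> S \<Longrightarrow> f y = g y) \<Longrightarrow> smooth_on S f \<longleftrightarrow> smooth_on S g"
  unfolding smooth_on_def using Ck_on_cong by blast

lemma smooth_on_const: "open S \<Longrightarrow> smooth_on S (\<lambda>x. c)"
  unfolding smooth_on_def using Ck_on_const by blast

lemma smooth_on_bounded_linear: "open S \<Longrightarrow> bounded_linear f \<Longrightarrow> smooth_on S f"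
  unfolding smooth_on_def using Ck_on_bounded_linear by blast

lemma smooth_on_add:
  "open S \<Longrightarrow> smooth_on S f \<Longrightarrow> smooth_on S g \<Longrightarrow> smooth_on S (\<lambda>x. f x + g x)"
  unfolding smooth_on_def using Ck_on_add by blast

lemma smooth_on_bilinear:
  "open S \<Longrightarrow> bounded_bilinear h \<Longrightarrow> smooth_on S f \<Longrightarrow> smooth_on S g \<Longrightarrow> smooth_on S (\<lambda>x. h (f x) (g x))"
  unfolding smooth_on_def using Ck_on_bilinear by blast

lemma smooth_on_mult:
  fixes f g :: "'a::real_normed_vector \<Rightarrow> real"
  shows "open S \<Longrightarrow> smooth_on S f \<Longrightarrow> smooth_on S g \<Longrightarrow> smooth_on S (\<lambda>x. f x * g x)"
  by (rule smooth_on_bilinear[OF _ bounded_bilinear_mult])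

lemma smooth_on_linear_comp:
  "open S \<Longrightarrow> bounded_linear L \<Longrightarrow> smooth_on S f \<Longrightarrow> smooth_on S (\<lambda>x. L (f x))"
  unfolding smooth_on_def using Ck_on_linear_comp by blast

lemma smooth_on_minus:
  "open S \<Longrightarrow> smooth_on S f \<Longrightarrow> smooth_on S (\<lambda>x. - f x)"
  by (rule smooth_on_linear_comp) (auto intro: bounded_linear_minus bounded_linear_ident)

lemma smooth_on_diff:
  "open S \<Longrightarrow> smooth_on S f \<Longrightarrow> smooth_on S g \<Longrightarrow> smooth_on S (\<lambda>x. f x - g x)"
  using smooth_on_add[of S f "\<lambda>x. - g x"] smooth_on_minus by auto

lemma smooth_on_comp_linear:
  "open S' \<Longrightarrow> bounded_linear L \<Longrightarrow> L ` S' \<subseteq> S \<Longrightarrow> smooth_on S f \<Longrightarrow> smooth_on S' (\<lambda>x. f (L x))"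
  unfolding smooth_on_def using Ck_on_comp_linear by blast

lemma smooth_on_powr:
  fixes f :: "'a::real_normed_vector \<Rightarrow> real"
  shows "open S \<Longrightarrow> (\<And>x. x \<in> S \<Longrightarrow> f x > 0) \<Longrightarrow> smooth_on S f \<Longrightarrow> smooth_on S (\<lambda>x. f x powr a)"
  unfolding smooth_on_def using Ck_on_powr by blast

lemma smooth_on_has_derivative:
  "smooth_on S f \<Longrightarrow> x \<in> S \<Longrightarrow> (f has_derivative frechet_derivative f (at x)) (at x)"
  unfolding smooth_on_def using Ck_on_SucD(1) by blast

lemma smooth_on_frechet_derivative:
  "smooth_on S f \<Longrightarrow> smooth_on S (\<lambda>x. frechet_derivative f (at x) v)"
  unfolding smooth_on_def using Ck_on_SucD(2) by blast

section \<open>Symmetry of mixed second derivatives\<close>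

text \<open>Both mixed derivatives are limits of the second difference quotient, by the mean value
  theorem applied twice.\<close>

lemma second_difference_mean_value:
  fixes f :: "'a::real_normed_vector \<Rightarrow> real"
  assumes S: "\<And>s t. 0 \<le> s \<Longrightarrow> s \<le> h \<Longrightarrow> 0 \<le> t \<Longrightarrow> t \<le> h \<Longrightarrow> x + s *\<^sub>R v + t *\<^sub>R w \<in> S"
    and f: "smooth_on S f" and h: "h > 0"
  shows "\<exists>s t. 0 \<le> s \<and> s \<le> h \<and> 0 \<le> t \<and> t \<le> h \<and>
    f (x + h *\<^sub>R v + h *\<^sub>R w) - f (x + h *\<^sub>R v) - f (x + h *\<^sub>R w) + f x =
      h * h * frechet_derivative (\<lambda>y. frechet_derivative f (at y) v) (at (x + s *\<^sub>R v + t *\<^sub>R w)) w"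
proof -
  let ?D = "\<lambda>y. frechet_derivative f (at y) v"
  have dline: "((\<lambda>t. g (y + t *\<^sub>R u)) has_real_derivative frechet_derivative g (at (y + t *\<^sub>R u)) u) (at t within T)"
    if "smooth_on S g" "y + t *\<^sub>R u \<in> S" for g :: "'a \<Rightarrow> real" and y u t T
  proof -
    have g: "(g has_derivative frechet_derivative g (at (y + t *\<^sub>R u))) (at (y + t *\<^sub>R u))"
      by (rule smooth_on_has_derivative[OF that])
    have "((\<lambda>t. g (y + t *\<^sub>R u)) has_derivative
        (\<lambda>r. frechet_derivative g (at (y + t *\<^sub>R u)) (r *\<^sub>R u))) (at t within T)"
      by (rule has_derivative_compose[where g = g and f = "\<lambda>t. y + t *\<^sub>R u", OF _ g]) (auto intro!: derivative_eq_intros)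
    then show ?thesis
      using linear_cmul[OF has_derivative_linear[OF g]]
      by (simp add: has_field_derivative_def mult.commute[of _ "frechet_derivative g (at (y + t *\<^sub>R u)) u"])
  qed
  define \<phi> where "\<phi> s = f (x + h *\<^sub>R w + s *\<^sub>R v) - f (x + s *\<^sub>R v)" for s
  have d: "(\<phi> has_real_derivative ?D (x + h *\<^sub>R w + s *\<^sub>R v) - ?D (x + s *\<^sub>R v)) (at s)"
    if "0 \<le> s" "s \<le> h" for s
    unfolding \<phi>_def using S[OF that, of h] S[OF that, of 0] h
    by (intro derivative_intros dline[OF f]) (simp_all add: add_ac)
  have "\<exists>s. 0 < s \<and> s < h \<and> \<phi> h - \<phi> 0 = (h - 0) * (?D (x + h *\<^sub>R w + s *\<^sub>R v) - ?D (x + s *\<^sub>R v))"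
    by (rule MVT2[OF h]) (use d in auto)
  then obtain s where s: "0 < s" "s < h"
    and 1: "\<phi> h - \<phi> 0 = h * (?D (x + h *\<^sub>R w + s *\<^sub>R v) - ?D (x + s *\<^sub>R v))"
    by auto
  have d2: "((\<lambda>t. ?D (x + s *\<^sub>R v + t *\<^sub>R w)) has_real_derivative
      frechet_derivative ?D (at (x + s *\<^sub>R v + t *\<^sub>R w)) w) (at t)" if "0 \<le> t" "t \<le> h" for t
    by (rule dline[OF smooth_on_frechet_derivative[OF f]]) (use S s that in auto)
  have "\<exists>t. 0 < t \<and> t < h \<and> ?D (x + s *\<^sub>R v + h *\<^sub>R w) - ?D (x + s *\<^sub>R v + 0 *\<^sub>R w)
      = (h - 0) * frechet_derivative ?D (at (x + s *\<^sub>R v + t *\<^sub>R w)) w"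
    by (rule MVT2[OF h]) (use d2 in auto)
  then obtain t where t: "0 < t" "t < h" and 2: "?D (x + s *\<^sub>R v + h *\<^sub>R w) - ?D (x + s *\<^sub>R v)
      = h * frechet_derivative ?D (at (x + s *\<^sub>R v + t *\<^sub>R w)) w"
    by auto
  have "\<phi> h - \<phi> 0 = h * (h * frechet_derivative ?D (at (x + s *\<^sub>R v + t *\<^sub>R w)) w)"
    unfolding 1 using 2 by (simp add: add_ac)
  moreover have "\<phi> h - \<phi> 0 = f (x + h *\<^sub>R v + h *\<^sub>R w) - f (x + h *\<^sub>R v) - f (x + h *\<^sub>R w) + f x"
    unfolding \<phi>_def by (simp add: add_ac)
  ultimately show ?thesis using s t by (intro exI[of _ s] exI[of _ t]) (simp add: mult.assoc)
qed

lemma frechet_derivative_commute: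
  fixes f :: "'a::real_normed_vector \<Rightarrow> real"
  assumes S: "open S" "x \<in> S" and f: "smooth_on S f"
  shows "frechet_derivative (\<lambda>y. frechet_derivative f (at y) v) (at x) w =
    frechet_derivative (\<lambda>y. frechet_derivative f (at y) w) (at x) v"
proof -
  define P where "P v w y = frechet_derivative (\<lambda>y. frechet_derivative f (at y) v) (at y) w" for v w y
  have P: "continuous_on S (P v w)" for v w
    unfolding P_def using smooth_on_frechet_derivative[OF smooth_on_frechet_derivative[OF f, of v], of w]
    unfolding smooth_on_def by (metis Ck_on.simps(1))
  have bound: "\<bar>P v w x - P w v x\<bar> < e" if e: "e > 0" for e
  proof -
    have ct: "continuous (at x) (P v w)" for v w
      using P S continuous_on_eq_continuous_at by blast
    have "\<forall>\<^sub>F y in nhds x. y \<in> S \<and> dist (P v w y) (P v w x) < e/2 \<and> dist (P w v y) (P w v x) < e/2"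
      using e by (intro eventually_conj eventually_nhds_in_open S
          tendstoD[OF ct[unfolded continuous_at tendsto_at_iff_tendsto_nhds]]) auto
    then obtain d where d: "d > 0" and D: "\<And>y. dist y x < d \<Longrightarrow>
        y \<in> S \<and> dist (P v w y) (P v w x) < e/2 \<and> dist (P w v y) (P w v x) < e/2"
      unfolding eventually_nhds_metric by blast
    \<comment> \<open>The parallelogram with sides \<open>h *\<^sub>R v\<close> and
      \<open>h *\<^sub>R w\<close> then lies within distance \<open>d / 2\<close> of
      \<open>x\<close>; the summand 1 keeps the denominator positive when \<open>v\<close> and
      \<open>w\<close> are zero.\<close>
    define h where "h = d / (2 * (norm v + norm w + 1))"
    have nn: "norm v + norm w + 1 > 0" by (simp add: add_nonneg_pos)
    have h: "h > 0" unfolding h_def using d nn by auto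
    have near: "dist (x + s *\<^sub>R v + t *\<^sub>R w) x < d" if "0 \<le> s" "s \<le> h" "0 \<le> t" "t \<le> h" for s t
    proof -
      have "dist (x + s *\<^sub>R v + t *\<^sub>R w) x = norm (s *\<^sub>R v + t *\<^sub>R w)"
        by (simp add: dist_norm add.assoc)
      also have "\<dots> \<le> s * norm v + t * norm w"
        using norm_triangle_ineq[of "s *\<^sub>R v" "t *\<^sub>R w"] that by simp
      also have "\<dots> \<le> h * norm v + h * norm w"
        using that by (intro add_mono mult_right_mono) auto
      also have "\<dots> \<le> h * (norm v + norm w + 1)" using h by (simp add: algebra_simps)
      also have "\<dots> = d / 2" unfolding h_def using nn by (simp add: field_simps)
      finally show ?thesis using d by simp
    qed
    obtain s t where st: "0 \<le> s" "s \<le> h" "0 \<le> t" "t \<le> h" and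
      1: "f (x + h *\<^sub>R v + h *\<^sub>R w) - f (x + h *\<^sub>R v) - f (x + h *\<^sub>R w) + f x = h * h * P v w (x + s *\<^sub>R v + t *\<^sub>R w)"
      using second_difference_mean_value[of h x v w S f] near D f h unfolding P_def by blast
    obtain s' t' where st': "0 \<le> s'" "s' \<le> h" "0 \<le> t'" "t' \<le> h" and
      2: "f (x + h *\<^sub>R w + h *\<^sub>R v) - f (x + h *\<^sub>R w) - f (x + h *\<^sub>R v) + f x = h * h * P w v (x + s' *\<^sub>R w + t' *\<^sub>R v)"
      using second_difference_mean_value[of h x w v S f] near D f h unfolding P_def
      by (smt (verit, ccfv_SIG) add.assoc add.commute)
    have "P v w (x + s *\<^sub>R v + t *\<^sub>R w) = P w v (x + t' *\<^sub>R v + s' *\<^sub>R w)"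
    proof -
      have "h * h * P v w (x + s *\<^sub>R v + t *\<^sub>R w) = h * h * P w v (x + t' *\<^sub>R v + s' *\<^sub>R w)"
        using 1 2 by (simp add: algebra_simps)
      then show ?thesis using h by simp
    qed
    moreover have "dist (P v w (x + s *\<^sub>R v + t *\<^sub>R w)) (P v w x) < e/2"
      using D near[OF st] by blast
    moreover have "dist (P w v (x + t' *\<^sub>R v + s' *\<^sub>R w)) (P w v x) < e/2"
      using D near[OF st'(3,4,1,2)] by blast
    ultimately show ?thesis unfolding dist_real_def by linarith
  qed
  \<comment> \<open>With \<open>e\<close> taken to be the difference itself, a positive difference
    would be smaller than itself.\<close>
  from this[of "\<bar>P v w x - P w v x\<bar>"] have "P v w x = P w v x" by auto
  then show ?thesis unfolding P_def .
qed

lemma smooth_form_eventually_linear: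
  "smooth_form_on N \<alpha> \<Longrightarrow> open N \<Longrightarrow> z \<in> N \<Longrightarrow> \<forall>\<^sub>F y in nhds z. linear (\<alpha> y)"
  using eventually_nhds_in_open[of N z] unfolding smooth_form_on_def by (auto elim: eventually_mono)

lemma smooth_form_differentiable:
  "smooth_form_on N \<alpha> \<Longrightarrow> z \<in> N \<Longrightarrow> (\<lambda>y. \<alpha> y w) differentiable (at z)"
  unfolding smooth_form_on_def using smooth_on_has_derivative differentiableI by blast

section \<open>Tangential vectors and brackets of vector fields\<close>

text \<open>Tangency by duality with functions. This is what the bracket formula consumes: there the
  values of a form on a field are constant along \<open>S\<close> but not on the ambient space, so
  they may be differentiated only in directions tangent to \<open>S\<close>.\<close>

definition tangential :: "'a::real_normed_vector set \<Rightarrow> 'a \<Rightarrow> 'a \<Rightarrow> bool" where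
  "tangential S z w \<longleftrightarrow> (\<forall>f f'. (f has_derivative f') (at z) \<longrightarrow>
     (\<forall>\<^sub>F y in nhds z. y \<in> S \<longrightarrow> f y = (0::real)) \<longrightarrow> f' w = 0)"

lemma tangentialD:
  assumes "tangential S z w" "(f has_derivative f') (at z)"
    "\<forall>\<^sub>F y in nhds z. y \<in> S \<longrightarrow> f y = (c::real)"
  shows "f' w = 0"
proof -
  have "((\<lambda>y. f y - c) has_derivative f') (at z)"
    using has_derivative_diff[OF assms(2) has_derivative_const[of c]] by simp
  moreover have "\<forall>\<^sub>F y in nhds z. y \<in> S \<longrightarrow> f y - c = 0" using assms(3) by simp
  ultimately show ?thesis using assms(1) unfolding tangential_def by blast
qed

lemma tangential_add: "tangential S z v \<Longrightarrow> tangential S z w \<Longrightarrow> tangential S z (v + w)"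
  unfolding tangential_def by (metis add.right_neutral has_derivative_linear linear_add)

lemma tangential_scaleR: "tangential S z v \<Longrightarrow> tangential S z (a *\<^sub>R v)"
  unfolding tangential_def by (metis has_derivative_linear linear_cmul scaleR_zero_right)

text \<open>Along the curve the test function is zero near time 0, so the chain rule makes its
  derivative vanish on the velocity.\<close>

lemma tangential_curve:
  assumes c: "(c has_vector_derivative w) (at 0)" "c 0 = z"
    and S: "\<forall>\<^sub>F t in nhds 0. c t \<in> S"
  shows "tangential S z w"
  unfolding tangential_def
proof (intro allI impI)
  fix f :: "'a \<Rightarrow> real" and f'
  assume f: "(f has_derivative f') (at z)" and z: "\<forall>\<^sub>F y in nhds z. y \<in> S \<longrightarrow> f y = 0"
  have "continuous (at 0) c"
    using c(1) has_vector_derivative_continuous by blast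
  then have "(c \<longlongrightarrow> z) (nhds 0)"
    using c(2) by (metis continuous_at tendsto_at_iff_tendsto_nhds)
  from eventually_compose_filterlim[OF z this]
  have "\<forall>\<^sub>F t in nhds 0. c t \<in> S \<longrightarrow> f (c t) = 0" .
  then have ev: "\<forall>\<^sub>F t in nhds 0. f (c t) = 0" using S by eventually_elim auto
  have "((\<lambda>t. f (c t)) has_derivative (\<lambda>t. f' (t *\<^sub>R w))) (at 0)"
    using has_derivative_compose[of c _ 0 UNIV f f'] c f unfolding has_vector_derivative_def by auto
  moreover have "((\<lambda>t. f (c t)) has_derivative (\<lambda>t. 0)) (at 0)"
    using ev by (intro has_derivative_transform_eventually[OF has_derivative_const])
       (auto simp: eventually_nhds_conv_at elim: eventually_mono)
  ultimately have "(\<lambda>t. f' (t *\<^sub>R w)) = (\<lambda>t. 0)" by (rule has_derivative_unique)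
  from fun_cong[OF this, of 1] show "f' w = 0" by simp
qed

text \<open>The vector splits as \<open>(w1, 0) + (0, w2)\<close>, and each summand is tested on a
  slice through the base point; the slices stay in the product because \<open>z1\<close> and
  \<open>z2\<close> lie in the factors.\<close>

lemma tangential_Pair:
  assumes "tangential S1 z1 w1" "tangential S2 z2 w2" "z1 \<in> S1" "z2 \<in> S2"
  shows "tangential (S1 \<times> S2) (z1, z2) (w1, w2)"
proof -
  have "tangential (S1 \<times> S2) (z1, z2) (w1, 0)"
    unfolding tangential_def
  proof (intro allI impI)
    fix f :: "'a \<times> 'b \<Rightarrow> real" and f'
    assume f: "(f has_derivative f') (at (z1, z2))"
      and z: "\<forall>\<^sub>F y in nhds (z1, z2). y \<in> S1 \<times> S2 \<longrightarrow> f y = 0"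
    have "((\<lambda>y. f (y, z2)) has_derivative (\<lambda>w. f' (w, 0))) (at z1)"
      by (rule has_derivative_compose[where f = "\<lambda>y. (y, z2)", OF _ f]) (auto intro!: derivative_eq_intros)
    moreover have "((\<lambda>y. (y, z2)) \<longlongrightarrow> (z1, z2)) (nhds z1)"
      by (intro tendsto_intros filterlim_ident)
    then have "\<forall>\<^sub>F y in nhds z1. y \<in> S1 \<longrightarrow> f (y, z2) = 0"
      using eventually_compose_filterlim[OF z, of "\<lambda>y. (y, z2)" "nhds z1"] assms(4) by auto
    ultimately show "f' (w1, 0) = 0" using assms(1) unfolding tangential_def by blast
  qed
  moreover have "tangential (S1 \<times> S2) (z1, z2) (0, w2)"
    unfolding tangential_def
  proof (intro allI impI)
    fix f :: "'a \<times> 'b \<Rightarrow> real" and f'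
    assume f: "(f has_derivative f') (at (z1, z2))"
      and z: "\<forall>\<^sub>F y in nhds (z1, z2). y \<in> S1 \<times> S2 \<longrightarrow> f y = 0"
    have "((\<lambda>y. f (z1, y)) has_derivative (\<lambda>w. f' (0, w))) (at z2)"
      by (rule has_derivative_compose[where f = "\<lambda>y. (z1, y)", OF _ f]) (auto intro!: derivative_eq_intros)
    moreover have "((\<lambda>y. (z1, y)) \<longlongrightarrow> (z1, z2)) (nhds z2)"
      by (intro tendsto_intros filterlim_ident)
    then have "\<forall>\<^sub>F y in nhds z2. y \<in> S2 \<longrightarrow> f (z1, y) = 0"
      using eventually_compose_filterlim[OF z, of "\<lambda>y. (z1, y)" "nhds z2"] assms(3) by auto
    ultimately show "f' (0, w2) = 0" using assms(2) unfolding tangential_def by blast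
  qed
  ultimately show ?thesis using tangential_add by fastforce
qed

text \<open>Differentiability of a form is known only for fixed arguments, so the moving argument
  \<open>X y\<close> is expanded in the Euclidean basis. Linearity of \<open>\<omega> y\<close> for
  all \<open>y\<close> near \<open>z\<close> justifies the expansion before differentiating.\<close>

lemma form_apply_has_derivative:
  fixes \<omega> :: "'a::euclidean_space form"
  assumes lin: "\<forall>\<^sub>F y in nhds z. linear (\<omega> y)"
    and dif: "\<And>w. (\<lambda>y. \<omega> y w) differentiable (at z)"
    and X: "(X has_derivative X') (at z)"
  shows "((\<lambda>y. \<omega> y (X y)) has_derivative
    (\<lambda>v. frechet_derivative (\<lambda>y. \<omega> y (X z)) (at z) v + \<omega> z (X' v))) (at z)"
proof -
  have linz: "linear (\<omega> z)" using lin eventually_nhds_x_imp_x by blast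
  have D: "((\<lambda>y. \<omega> y w) has_derivative frechet_derivative (\<lambda>y. \<omega> y w) (at z)) (at z)" for w
    using dif frechet_derivative_works by blast
  have expand: "\<omega> y w = (\<Sum>b\<in>Basis. (w \<bullet> b) * \<omega> y b)" if "linear (\<omega> y)" for y w
    using linear_sum[OF that, of "\<lambda>b. (w \<bullet> b) *\<^sub>R b" Basis] linear_cmul[OF that]
    by (simp add: euclidean_representation)
  let ?d = "\<lambda>b. frechet_derivative (\<lambda>y. \<omega> y b) (at z)"
  have 1: "((\<lambda>y. \<Sum>b\<in>Basis. (X y \<bullet> b) * \<omega> y b) has_derivative
      (\<lambda>v. \<Sum>b\<in>Basis. (X z \<bullet> b) * ?d b v + (X' v \<bullet> b) * \<omega> z b)) (at z)"
    by (intro has_derivative_sum has_derivative_mult D has_derivative_inner_left X)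
  have 2: "((\<lambda>y. \<Sum>b\<in>Basis. (X z \<bullet> b) * \<omega> y b) has_derivative
      (\<lambda>v. \<Sum>b\<in>Basis. (X z \<bullet> b) * ?d b v)) (at z)"
    by (intro has_derivative_sum has_derivative_mult_right D)
  have ev: "\<forall>\<^sub>F y in at z. (\<Sum>b\<in>Basis. (X z \<bullet> b) * \<omega> y b) = \<omega> y (X z)"
    "\<forall>\<^sub>F y in at z. (\<Sum>b\<in>Basis. (X y \<bullet> b) * \<omega> y b) = \<omega> y (X y)"
    using lin expand by (auto simp: eventually_nhds_conv_at elim: eventually_mono)
  have "((\<lambda>y. \<omega> y (X z)) has_derivative (\<lambda>v. \<Sum>b\<in>Basis. (X z \<bullet> b) * ?d b v)) (at z)"
    by (rule has_derivative_transform_eventually[OF 2 ev(1)]) (simp_all add: expand[OF linz, symmetric])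
  then have e: "frechet_derivative (\<lambda>y. \<omega> y (X z)) (at z) v = (\<Sum>b\<in>Basis. (X z \<bullet> b) * ?d b v)" for v
    by (rule frechet_derivative_eqI)
  have "((\<lambda>y. \<omega> y (X y)) has_derivative
      (\<lambda>v. \<Sum>b\<in>Basis. (X z \<bullet> b) * ?d b v + (X' v \<bullet> b) * \<omega> z b)) (at z)"
    by (rule has_derivative_transform_eventually[OF 1 ev(2)]) (simp_all add: expand[OF linz, symmetric])
  then show ?thesis unfolding e expand[OF linz, of "X' _"] by (simp add: sum.distrib)
qed

text \<open>For constant \<open>\<omega>(V)\<close> and \<open>\<omega>(W)\<close>, this is the formula
  \<open>d\<omega>(V, W) = V \<omega>(W) - W \<omega>(V) - \<omega>([V, W])\<close>.\<close>

lemma form_bracket: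
  fixes \<omega> :: "'a::euclidean_space form"
  assumes lin: "\<forall>\<^sub>F y in nhds z. linear (\<omega> y)"
    and dif: "\<And>w. (\<lambda>y. \<omega> y w) differentiable (at z)"
    and V: "(V has_derivative V') (at z)" "tangential S z (V z)"
    and W: "(W has_derivative W') (at z)" "tangential S z (W z)"
    and cV: "\<forall>\<^sub>F y in nhds z. y \<in> S \<longrightarrow> \<omega> y (V y) = a"
    and cW: "\<forall>\<^sub>F y in nhds z. y \<in> S \<longrightarrow> \<omega> y (W y) = b"
  shows "\<omega> z (W' (V z) - V' (W z)) = - ext_deriv \<omega> z (V z) (W z)"
proof -
  have linz: "linear (\<omega> z)" using lin eventually_nhds_x_imp_x by blast
  note prod = form_apply_has_derivative[OF lin dif]
  have "frechet_derivative (\<lambda>y. \<omega> y (W z)) (at z) (V z) + \<omega> z (W' (V z)) = 0"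
    by (rule tangentialD[OF V(2) prod[OF W(1)] cW])
  moreover have "frechet_derivative (\<lambda>y. \<omega> y (V z)) (at z) (W z) + \<omega> z (V' (W z)) = 0"
    by (rule tangentialD[OF W(2) prod[OF V(1)] cV])
  ultimately show ?thesis unfolding ext_deriv_def using linear_diff[OF linz] by simp
qed

section \<open>Frames and Gram matrices\<close>

lemma has_derivative_vec_lambda:
  fixes f :: "'n::finite \<Rightarrow> 'a::real_normed_vector \<Rightarrow> 'b::euclidean_space"
  assumes "\<And>i. (f i has_derivative f' i) F"
  shows "((\<lambda>x. \<chi> i. f i x) has_derivative (\<lambda>h. \<chi> i. f' i h)) F"
proof -
  have lin: "bounded_linear (\<lambda>v::'b. axis i v :: 'b^'n)" for i
    unfolding linear_conv_bounded_linear[symmetric]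
    by (rule linearI) (auto simp: axis_def vec_eq_iff)
  have eq: "(\<chi> i. g i) = (\<Sum>i\<in>UNIV. axis i (g i))" for g :: "'n \<Rightarrow> 'b"
    by (simp add: vec_eq_iff axis_def if_distrib cong: if_cong)
  show ?thesis unfolding eq
    by (intro has_derivative_sum bounded_linear.has_derivative[OF lin] assms)
qed

lemma bounded_bilinear_matrix_vector_mult:
  "bounded_bilinear ((*v) :: real^'n^'m \<Rightarrow> real^'n \<Rightarrow> real^'m)"
  unfolding bilinear_conv_bounded_bilinear[symmetric] bilinear_def
  by (auto intro!: linearI simp: matrix_vector_mult_def vec_eq_iff sum.distrib ring_distribs
      sum_distrib_left mult_ac)

lemma bounded_linear_snd_nth: "bounded_linear (\<lambda>z::'n::finite frame. snd z $ i)"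
  by (rule bounded_linear_compose[OF bounded_linear_vec_nth bounded_linear_snd])

lemma gram_nth: "gram G z $ i $ j = (snd z $ i) \<bullet> (G (fst z) *v (snd z $ j))"
proof -
  have "(A ** M ** transpose B) $ i $ j = A $ i \<bullet> (M *v B $ j)"
    for A M B :: "real^'n::finite^'n" and i j
    unfolding matrix_mul_assoc[symmetric]
    by (simp add: matrix_matrix_mult_def matrix_vector_mult_def transpose_def inner_vec_def)
  then show ?thesis by (simp add: gram_def)
qed

lemma gram_nth_has_derivative:
  assumes "(G has_derivative G') (at (fst z))"
  shows "((\<lambda>z. gram G z $ i $ j) has_derivative (\<lambda>w.
      (snd w $ i) \<bullet> (G (fst z) *v (snd z $ j)) + (snd z $ i) \<bullet> (G' (fst w) *v (snd z $ j))
      + (snd z $ i) \<bullet> (G (fst z) *v (snd w $ j)))) (at z)"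
proof -
  have G: "((\<lambda>z. G (fst z)) has_derivative (\<lambda>w. G' (fst w))) (at z)"
    using has_derivative_compose[OF bounded_linear_imp_has_derivative[OF bounded_linear_fst] assms] .
  have u: "((\<lambda>z::'a frame. snd z $ i) has_derivative (\<lambda>w. snd w $ i)) (at z)" for i
    by (rule bounded_linear_imp_has_derivative[OF bounded_linear_snd_nth])
  show ?thesis unfolding gram_nth
    by (rule has_derivative_eq_rhs[OF has_derivative_inner[OF u
          bounded_bilinear.FDERIV[OF bounded_bilinear_matrix_vector_mult G u]]])
      (auto simp: inner_add_right algebra_simps)
qed

lemma gram_has_derivative:
  assumes "(G has_derivative G') (at (fst z))"
  shows "(gram G has_derivative (\<lambda>w. \<chi> i j.
      (snd w $ i) \<bullet> (G (fst z) *v (snd z $ j)) + (snd z $ i) \<bullet> (G' (fst w) *v (snd z $ j))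
      + (snd z $ i) \<bullet> (G (fst z) *v (snd w $ j)))) (at z)"
proof -
  have "gram G = (\<lambda>z. \<chi> i j. gram G z $ i $ j)" by (simp add: vec_eq_iff fun_eq_iff)
  then show ?thesis
    using has_derivative_vec_lambda[OF has_derivative_vec_lambda[OF gram_nth_has_derivative[OF assms]],
        of "\<lambda>i j. i" "\<lambda>i j. j"] by simp
qed

lemma frame_tangent_iff:
  assumes "(G has_derivative G') (at (fst z))"
  shows "w \<in> frame_tangent G z \<longleftrightarrow> (\<forall>i j.
      (snd w $ i) \<bullet> (G (fst z) *v (snd z $ j)) + (snd z $ i) \<bullet> (G' (fst w) *v (snd z $ j))
      + (snd z $ i) \<bullet> (G (fst z) *v (snd w $ j)) = 0)"
  unfolding frame_tangent_def
  by (simp add: frechet_derivative_eqI[OF gram_has_derivative[OF assms]] vec_eq_iff)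

subsection \<open>Frames of Euclidean space\<close>

lemma FE_iff: "z \<in> FE \<longleftrightarrow> (\<forall>i j. (snd z $ i) \<bullet> (snd z $ j) = (if i = j then 1 else 0))"
    unfolding FE_def mem_Collect_eq vec_eq_iff[of "gram _ _"] vec_eq_iff[of "gram _ _ $ _"] gram_nth
    matrix_vector_mul_lid
  by (simp add: mat_def)

lemma frame_tangent_E_iff:
  "w \<in> frame_tangent (\<lambda>_. mat 1) z \<longleftrightarrow> (\<forall>i j. (snd w $ i) \<bullet> (snd z $ j) + (snd z $ i) \<bullet> (snd w $ j) = 0)"
  by (subst frame_tangent_iff[OF has_derivative_const]) simp

type_synonym motion = "real \<times> real \<times> real \<times> real \<times> real \<times> real"

text \<open>The left-invariant vector field with \<open>\<omega>\<^sup>i = t\<^sub>i\<close>, \<open>\<omega>\<^sup>1\<^sub>2 = p\<close>, \<open>\<omega>\<^sup>3\<^sub>1 = r\<close> and \<open>\<omega>\<^sup>3\<^sub>2 = s\<close>.\<close>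

definition rigid :: "motion \<Rightarrow> 3 frame \<Rightarrow> 3 frame" where
  "rigid c z = (case c of (t1, t2, t3, p, r, s) \<Rightarrow>
     (t1 *\<^sub>R snd z $ 1 + t2 *\<^sub>R snd z $ 2 + t3 *\<^sub>R snd z $ 3,
      vector [r *\<^sub>R snd z $ 3 - p *\<^sub>R snd z $ 2, p *\<^sub>R snd z $ 1 + s *\<^sub>R snd z $ 3,
        - r *\<^sub>R snd z $ 1 - s *\<^sub>R snd z $ 2]))"

text \<open>The bracket in the Lie algebra of the Euclidean motion group. As \<open>rigid c\<close>
  is linear in the frame, the derivative of \<open>rigid d\<close> along \<open>rigid c\<close> is
  \<open>rigid d (rigid c z)\<close>, so \<open>rigid_commutator\<close> has the same sign
  convention as \<open>W' (V z) - V' (W z)\<close> in \<open>form_bracket\<close>.\<close>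

definition comm :: "motion \<Rightarrow> motion \<Rightarrow> motion" where
  "comm c d = (case (c, d) of ((c1, c2, c3, p, r, s), (d1, d2, d3, p', r', s')) \<Rightarrow>
     (d2 * p - d3 * r - c2 * p' + c3 * r', c1 * p' + c3 * s' - d1 * p - d3 * s,
      d1 * r + d2 * s - c1 * r' - c2 * s', s * r' - r * s', p * s' - s * p', r * p' - p * r'))"

lemma rigid_bilinear: "bounded_bilinear rigid"
  unfolding bilinear_conv_bounded_bilinear[symmetric] bilinear_def
  by (intro conjI allI linearI)
    (auto simp: rigid_def vec_eq_iff forall_3 vector_3 algebra_simps split: prod.splits)

lemma rigid_commutator: "rigid d (rigid c z) - rigid c (rigid d z) = rigid (comm c d) z"
  by (cases c; cases d)
    (auto simp: rigid_def comm_def vec_eq_iff forall_3 vector_3 algebra_simps split: prod.splits)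

lemma
  assumes "z \<in> FE"
  shows om_rigid: "om 1 z (rigid (t1, t2, t3, p, r, s) z) = t1" "om 2 z (rigid (t1, t2, t3, p, r, s) z) = t2"
      "om 3 z (rigid (t1, t2, t3, p, r, s) z) = t3"
    and om_conn_rigid: "om_conn 1 2 z (rigid (t1, t2, t3, p, r, s) z) = p"
      "om_conn 3 1 z (rigid (t1, t2, t3, p, r, s) z) = r"
      "om_conn 3 2 z (rigid (t1, t2, t3, p, r, s) z) = s"
  using assms unfolding FE_iff
  by (simp_all add: om_def om_conn_def rigid_def vector_3 inner_add_right inner_diff_right)

lemma rigid_tangent: "z \<in> FE \<Longrightarrow> rigid c z \<in> frame_tangent (\<lambda>_. mat 1) z"
  unfolding frame_tangent_E_iff FE_iff forall_3
  by (auto simp: rigid_def vector_3 inner_add_right inner_diff_right inner_add_left inner_diff_left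
      split: prod.splits)

lemma tangential_translation:
  assumes "z \<in> FE" shows "tangential FE z (a, 0)"
proof (rule tangential_curve[where c = "\<lambda>t. (fst z + t *\<^sub>R a, snd z)"])
  show "((\<lambda>t. (fst z + t *\<^sub>R a, snd z)) has_vector_derivative (a, 0)) (at 0)"
    by (auto intro!: derivative_eq_intros)
  show "\<forall>\<^sub>F t in nhds 0. (fst z + t *\<^sub>R a, snd z) \<in> FE"
    using assms by (simp add: FE_iff)
qed simp

lemma tangential_rotation:
  assumes z: "z \<in> FE" and ij: "i \<noteq> j"
  shows "tangential FE z (0, \<chi> l. if l = i then - snd z $ j else if l = j then snd z $ i else 0)"
proof (rule tangential_curve)
  let ?u = "snd z"
  let ?c = "\<lambda>t. (fst z, \<chi> l. if l = i then cos t *\<^sub>R ?u $ i - sin t *\<^sub>R ?u $ j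
    else if l = j then sin t *\<^sub>R ?u $ i + cos t *\<^sub>R ?u $ j else ?u $ l)"
  have "((\<lambda>t. if l = i then cos t *\<^sub>R ?u $ i - sin t *\<^sub>R ?u $ j
      else if l = j then sin t *\<^sub>R ?u $ i + cos t *\<^sub>R ?u $ j else ?u $ l) has_derivative
    (\<lambda>t. if l = i then - t *\<^sub>R ?u $ j else if l = j then t *\<^sub>R ?u $ i else 0)) (at 0)" for l
    by (cases "l = i"; cases "l = j") (auto intro!: derivative_eq_intros)
  from has_derivative_Pair[OF has_derivative_const has_derivative_vec_lambda[OF this]]
  show "(?c has_vector_derivative
      (0, \<chi> l. if l = i then - ?u $ j else if l = j then ?u $ i else 0)) (at 0)"
    unfolding has_vector_derivative_def
    by (rule has_derivative_eq_rhs) (auto simp: vec_eq_iff)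
  show "?c 0 = z" by (auto simp: prod_eq_iff vec_eq_iff)
  have sc: "cos t * cos t + sin t * sin t = 1" "sin t * sin t + cos t * cos t = 1" for t :: real
    using sin_cos_squared_add[of t] by (simp_all add: power2_eq_square add.commute)
  have "?c t \<in> FE" for t
    unfolding FE_iff
  proof (intro allI)
    fix l m
    have u: "?u $ a \<bullet> ?u $ b = (if a = b then 1 else 0)" for a b using z FE_iff by blast
    show "snd (?c t) $ l \<bullet> snd (?c t) $ m = (if l = m then 1 else 0)"
      using ij by (auto simp: u inner_add_left inner_add_right inner_diff_left inner_diff_right sc algebra_simps)
  qed
  then show "\<forall>\<^sub>F t in nhds 0. ?c t \<in> FE" by simp
qed

text \<open>Translations and the rotations of two rows in their plane are velocities of explicit
  curves in \<open>FE\<close>, and they span all left-invariant fields; \<open>p\<close>,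
  \<open>r\<close>, \<open>s\<close> are the speeds of the three rotations.\<close>

lemma rigid_tangential:
  assumes "z \<in> FE" shows "tangential FE z (rigid c z)"
proof -
  obtain t1 t2 t3 p r s where c: "c = (t1, t2, t3, p, r, s)" by (cases c) auto
  have neq: "(1::3) \<noteq> 2" "(3::3) \<noteq> 1" "(3::3) \<noteq> 2" by auto
  let ?R = "\<lambda>i j. (0, \<chi> l. if l = i then - snd z $ j else if l = j then snd z $ i else 0) :: 3 frame"
  have "tangential FE z ((t1 *\<^sub>R snd z $ 1 + t2 *\<^sub>R snd z $ 2 + t3 *\<^sub>R snd z $ 3, 0) +
      p *\<^sub>R ?R 1 2 + r *\<^sub>R ?R 3 1 + s *\<^sub>R ?R 3 2)"
    by (intro tangential_add tangential_scaleR tangential_translation tangential_rotation assms neq)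
  also have "(t1 *\<^sub>R snd z $ 1 + t2 *\<^sub>R snd z $ 2 + t3 *\<^sub>R snd z $ 3, 0) +
      p *\<^sub>R ?R 1 2 + r *\<^sub>R ?R 3 1 + s *\<^sub>R ?R 3 2 = rigid c z"
    using neq by (simp add: c rigid_def vec_eq_iff forall_3 vector_3)
  finally show ?thesis .
qed

text \<open>Parseval for the rows of the frame: for a square matrix,
  \<open>u ** transpose u = mat 1\<close> implies \<open>transpose u ** u = mat 1\<close>.\<close>

lemma inner_orthonormal:
  assumes "z \<in> FE" shows "a \<bullet> b = (\<Sum>k\<in>UNIV. (snd z $ k \<bullet> a) * (snd z $ k \<bullet> b))"
proof -
  let ?u = "snd z"
  have "?u ** transpose ?u = mat 1"
    using assms by (simp add: FE_def gram_def)
  then have "transpose ?u ** ?u = mat 1" by (rule matrix_left_right_inverse[THEN iffD1])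
  then have "b = (transpose ?u ** ?u) *v b" by simp
  then have "b = transpose ?u *v (?u *v b)" by (metis matrix_vector_mul_assoc)
  then have "a \<bullet> b = (?u *v a) \<bullet> (?u *v b)" by (metis dot_lmul_matrix inner_commute transpose_matrix_vector)
  then show ?thesis by (simp add: inner_vec_def matrix_mult_dot row_def) 
qed

lemma ext_deriv_om_conn:
  "ext_deriv (om_conn i j) z v w = (snd v $ i) \<bullet> (snd w $ j) - (snd w $ i) \<bullet> (snd v $ j)"
proof -
  have 1: "((\<lambda>y. om_conn i j y w) has_derivative (\<lambda>v. (snd v $ i) \<bullet> (snd w $ j))) (at z)" for w
    unfolding om_conn_def
    by (intro has_derivative_inner_left bounded_linear_imp_has_derivative bounded_linear_snd_nth)
  then show ?thesis unfolding ext_deriv_def by (simp add: frechet_derivative_eqI[OF 1])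
qed

text \<open>\<open>d\<omega>\<^sup>i\<^sub>j\<close> is an antisymmetrised product of row
  velocities; expanding these in the frame gives the sum over \<open>k\<close> of the wedge products
  of \<open>\<omega>\<^sup>k\<^sub>i\<close> and \<open>\<omega>\<^sup>k\<^sub>j\<close>. Tangency
  makes the connection matrix skew, which leaves a single term.\<close>

lemma om_structure:
  assumes z: "z \<in> FE" and v: "v \<in> frame_tangent (\<lambda>_. mat 1) z" and w: "w \<in> frame_tangent (\<lambda>_. mat 1) z"
  shows "ext_deriv (om_conn 1 2) z v w = wedge (om_conn 3 1) (om_conn 3 2) z v w"
    and "ext_deriv (om_conn 3 1) z v w = wedge (om_conn 3 2) (om_conn 1 2) z v w"
    and "ext_deriv (om_conn 3 2) z v w = - wedge (om_conn 3 1) (om_conn 1 2) z v w"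
proof -
  have e: "ext_deriv (om_conn i j) z v w = (\<Sum>k\<in>UNIV. om_conn k i z v * om_conn k j z w - om_conn k i z w * om_conn k j z v)" for i j
    using inner_orthonormal[OF z, of "snd v $ i" "snd w $ j"] inner_orthonormal[OF z, of "snd w $ i" "snd v $ j"]
    by (simp add: ext_deriv_om_conn om_conn_def sum_subtractf)
  have skew: "om_conn i j z x = - om_conn j i z x" if "x \<in> frame_tangent (\<lambda>_. mat 1) z" for i j x
    using that unfolding frame_tangent_E_iff om_conn_def by (metis add_eq_0_iff inner_commute)
  have d: "om_conn i i z x = 0" if "x \<in> frame_tangent (\<lambda>_. mat 1) z" for i x
    using skew[OF that, of i i] by simp
  note s = skew[OF v, of 2 1] skew[OF w, of 2 1] skew[OF v, of 1 3] skew[OF w, of 1 3]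
    skew[OF v, of 2 3] skew[OF w, of 2 3]
  show "ext_deriv (om_conn 1 2) z v w = wedge (om_conn 3 1) (om_conn 3 2) z v w"
    "ext_deriv (om_conn 3 1) z v w = wedge (om_conn 3 2) (om_conn 1 2) z v w"
    "ext_deriv (om_conn 3 2) z v w = - wedge (om_conn 3 1) (om_conn 1 2) z v w"
    unfolding e sum_3 wedge_def by (simp_all add: d[OF v] d[OF w] s)
qed

lemma smooth_form_om_conn: "smooth_form_on UNIV (om_conn i j)"
  unfolding smooth_form_on_def om_conn_def
  by (auto intro!: linearI smooth_on_bounded_linear bounded_linear_inner_left_comp bounded_linear_snd_nth
      simp: inner_add_right)

section \<open>Geometry of a coordinate patch\<close>

text \<open>Darboux integrability, the structure equations and the equations for \<open>q\<close>
  are all imposed chart by chart, so both implications are proved over one chart from what the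
  global hypotheses give there.\<close>

locale surface_patch =
  fixes G :: "'p::{t2_space, second_countable_topology} chart \<Rightarrow> real^2 \<Rightarrow> real^2^2"
    and \<eta>12 :: "'p chart \<Rightarrow> 2 frame form"
    and K q :: "'p \<Rightarrow> real"
    and Q1 :: "2 \<Rightarrow> 'p chart \<Rightarrow> 2 frame \<Rightarrow> real"
    and Q2 :: "2 \<Rightarrow> 2 \<Rightarrow> 'p chart \<Rightarrow> 2 frame \<Rightarrow> real"
    and c :: "'p chart"
  assumes open_im: "open (chart_im c)"
    and smooth_G: "smooth_on (chart_im c) (G c)"
    and G_sym: "\<And>x. x \<in> chart_im c \<Longrightarrow> transpose (G c x) = G c x"
    and smooth_\<eta>12: "smooth_form_on (frame_dom c) (\<eta>12 c)"
    and first_structure: "\<And>z v w i. z \<in> FM G c \<Longrightarrow> v \<in> frame_tangent (G c) z \<Longrightarrow> w \<in> frame_tangent (G c) z \<Longrightarrow>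
        ext_deriv (eta G c i) z v w = - (\<Sum>j\<in>UNIV. wedge (conn (\<eta>12 c) i j) (eta G c j) z v w)"
    and second_structure: "\<And>z v w. z \<in> FM G c \<Longrightarrow> v \<in> frame_tangent (G c) z \<Longrightarrow> w \<in> frame_tangent (G c) z \<Longrightarrow>
        ext_deriv (\<eta>12 c) z v w = frame_pullback K c z * wedge (eta G c 1) (eta G c 2) z v w"
    and smooth_K: "smooth_on (chart_im c) (K \<circ> chart_inv c)"
    and K_neg: "\<And>p. K p < 0"
    and q_eq: "\<And>p. q p = sqrt (- K p) powr (- 3 / 2)"
    and smooth_Q1: "\<And>i. smooth_on (frame_dom c) (Q1 i c)"
    and smooth_Q2: "\<And>i j. smooth_on (frame_dom c) (Q2 i j c)"
    and dq: "\<And>z w. z \<in> FM G c \<Longrightarrow> w \<in> frame_tangent (G c) z \<Longrightarrow>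
        frechet_derivative (frame_pullback q c) (at z) w = (\<Sum>i\<in>UNIV. Q1 i c z * eta G c i z w)"
    and dQ1: "\<And>z w i. z \<in> FM G c \<Longrightarrow> w \<in> frame_tangent (G c) z \<Longrightarrow>
        frechet_derivative (Q1 i c) (at z) w =
          (\<Sum>j\<in>UNIV. Q1 j c z * conn (\<eta>12 c) j i z w) + (\<Sum>j\<in>UNIV. Q2 i j c z * eta G c j z w)"
begin

lemma G_has_derivative:
  "x \<in> chart_im c \<Longrightarrow> (G c has_derivative frechet_derivative (G c) (at x)) (at x)"
  by (rule smooth_on_has_derivative[OF smooth_G])

lemma FM_frame_dom: "z \<in> FM G c \<Longrightarrow> z \<in> frame_dom c"
  and frame_dom_im: "z \<in> frame_dom c \<Longrightarrow> fst z \<in> chart_im c"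
  by (simp_all add: FM_def frame_dom_def)

lemma FM_iff: "z \<in> FM G c \<longleftrightarrow> z \<in> frame_dom c \<and>
    (\<forall>i j. (snd z $ i) \<bullet> (G c (fst z) *v (snd z $ j)) = (if i = j then 1 else 0))"
  by (auto simp: FM_def gram_nth[symmetric] vec_eq_iff mat_def)

lemma FM_orthonormal:
  "z \<in> FM G c \<Longrightarrow> (snd z $ i) \<bullet> (G c (fst z) *v (snd z $ j)) = (if i = j then 1 else 0)"
  by (simp add: FM_iff)

lemma open_frame_dom: "open (frame_dom c)"
proof -
  have "frame_dom c = (fst -` chart_im c) \<inter> {z. 0 < det (snd z)}"
    by (auto simp: frame_dom_def)
  moreover have "open {z::2 frame. 0 < det (snd z)}"
    unfolding det_2 by (intro open_Collect_less continuous_intros)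
  ultimately show ?thesis using open_im open_vimage_fst by auto
qed

lemma ip_commute:
  assumes "transpose M = M" shows "a \<bullet> (M *v b) = b \<bullet> (M *v (a::real^2))"
  by (metis assms dot_lmul_matrix inner_commute transpose_matrix_vector)

lemma matrix_vector_mult_minus: "M *v (- x) = - (M *v (x::real^2))"
  using matrix_vector_mult_scaleR[of M "-1" x] by simp

lemma dG_sym:
  assumes "x \<in> chart_im c"
  shows "transpose (frechet_derivative (G c) (at x) v) = frechet_derivative (G c) (at x) v"
proof -
  have "bounded_linear (transpose :: real^2^2 \<Rightarrow> real^2^2)"
    unfolding linear_conv_bounded_linear[symmetric]
    by (rule linearI) (auto simp: transpose_def vec_eq_iff)
  from bounded_linear.has_derivative[OF this G_has_derivative[OF assms]]
  have "((\<lambda>y. transpose (G c y)) has_derivative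
      (\<lambda>v. transpose (frechet_derivative (G c) (at x) v))) (at x)" .
  then have "(G c has_derivative (\<lambda>v. transpose (frechet_derivative (G c) (at x) v))) (at x)"
    by (rule has_derivative_transform_within_open[OF _ open_im assms]) (rule G_sym)
  from frechet_derivative_eqI[OF this] show ?thesis by simp
qed

lemma tangent_iff:
  assumes "z \<in> frame_dom c"
  shows "w \<in> frame_tangent (G c) z \<longleftrightarrow> (\<forall>i j.
      (snd w $ i) \<bullet> (G c (fst z) *v (snd z $ j))
      + (snd z $ i) \<bullet> (frechet_derivative (G c) (at (fst z)) (fst w) *v (snd z $ j))
      + (snd z $ i) \<bullet> (G c (fst z) *v (snd w $ j)) = 0)"
  by (rule frame_tangent_iff[OF G_has_derivative[OF frame_dom_im[OF assms]]])

text \<open>The scalar version lets tangency of a bracket be tested by the differentials of the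
  single Gram entries.\<close>

lemma tangent_iff_gram:
  assumes "z \<in> frame_dom c"
  shows "w \<in> frame_tangent (G c) z \<longleftrightarrow> (\<forall>i j. frechet_derivative (\<lambda>z. gram (G c) z $ i $ j) (at z) w = 0)"
  unfolding tangent_iff[OF assms]
  by (simp add: frechet_derivative_eqI[OF gram_nth_has_derivative[OF G_has_derivative[OF frame_dom_im[OF assms]]]])

lemma tangent_lincomb:
  assumes "z \<in> frame_dom c" "v \<in> frame_tangent (G c) z" "w \<in> frame_tangent (G c) z"
  shows "a *\<^sub>R v + b *\<^sub>R w \<in> frame_tangent (G c) z"
proof -
  have "linear (frechet_derivative (gram (G c)) (at z))"
    using gram_has_derivative[OF G_has_derivative[OF frame_dom_im[OF assms(1)]]]
    by (intro has_derivative_linear[OF frechet_derivative_worksI])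
  then show ?thesis using assms(2,3)
    unfolding frame_tangent_def by (simp add: linear_add linear_cmul)
qed

text \<open>The curve is obtained by applying the Gram--Schmidt process along a straight line.\<close>

lemma FM_tangential:
  assumes z: "z \<in> FM G c" and w: "w \<in> frame_tangent (G c) z"
  shows "tangential (FM G c) z w"
proof -
  define y where "y t = z + t *\<^sub>R w" for t :: real
  define g where "g i j t = gram (G c) (y t) $ i $ j" for i j t
  have zD: "z \<in> frame_dom c" by (rule FM_frame_dom[OF z])
  have y': "(y has_derivative (\<lambda>t. t *\<^sub>R w)) (at 0)"
    unfolding y_def by (auto intro!: derivative_eq_intros)
  have y0: "y 0 = z" by (simp add: y_def)
  have dg: "(g i j has_real_derivative 0) (at 0)" for i j
  proof -
    define L where "L = frechet_derivative (\<lambda>z. gram (G c) z $ i $ j) (at z)"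
    have L: "((\<lambda>z. gram (G c) z $ i $ j) has_derivative L) (at (y 0))"
      unfolding L_def y0
      by (rule frechet_derivative_worksI[OF gram_nth_has_derivative[OF G_has_derivative[OF frame_dom_im[OF zD]]]])
    have "L w = 0" unfolding L_def using tangent_iff_gram[OF zD] w by blast
    then have "L (t *\<^sub>R w) = 0" for t using linear_cmul[OF has_derivative_linear[OF L]] by simp
    with has_derivative_compose[OF y' L] show ?thesis
      unfolding g_def has_field_derivative_def by (simp add: lambda_zero[symmetric])
  qed
  have g0: "g i j 0 = (if i = j then 1 else 0)" for i j
    using z unfolding g_def y0 FM_def by (simp add: mat_def)
  \<comment> \<open>Gram-Schmidt data: \<open>m\<close> is the projection coefficient of the second
    row on the first, \<open>s\<close> the squared length of the remainder, \<open>a\<close> and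
    \<open>b\<close> the normalising factors. They inherit derivative 0 from \<open>g\<close>, so
    orthonormalising the line does not change its velocity \<open>w\<close> at time 0.\<close>
  define m where "m t = g 1 2 t / g 1 1 t" for t
  define s where "s t = g 2 2 t - (g 1 2 t)\<^sup>2 / g 1 1 t" for t
  define a where "a t = inverse (sqrt (g 1 1 t))" for t
  define b where "b t = inverse (sqrt (s t))" for t
  have dm: "(m has_real_derivative 0) (at 0)" unfolding m_def
    using g0[of 1 1] by (auto intro!: derivative_eq_intros dg simp: g0)
  have ds: "(s has_real_derivative 0) (at 0)" unfolding s_def
    using g0[of 1 1] by (auto intro!: derivative_eq_intros dg simp: g0)
  have s0: "s 0 = 1" by (simp add: s_def g0)
  have da: "(a has_real_derivative 0) (at 0)" unfolding a_def
    by (auto intro!: derivative_eq_intros dg simp: g0)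
  have db: "(b has_real_derivative 0) (at 0)" unfolding b_def
    by (auto intro!: derivative_eq_intros ds simp: s0)
  have 0: "a 0 = 1" "b 0 = 1" "m 0 = 0" by (simp_all add: a_def b_def m_def g0 s0)
  note d = da[unfolded has_field_derivative_def] db[unfolded has_field_derivative_def]
    dm[unfolded has_field_derivative_def]
  define e :: "real \<Rightarrow> 2 frame" where "e t = (fst (y t), \<chi> i. if i = 1 then a t *\<^sub>R snd (y t) $ 1
    else b t *\<^sub>R (snd (y t) $ 2 - m t *\<^sub>R snd (y t) $ 1))" for t
  have row: "((\<lambda>t. snd (y t) $ i) has_derivative (\<lambda>t. t *\<^sub>R snd w $ i)) (at 0)" for i
    using bounded_linear.has_derivative[OF bounded_linear_snd_nth y'] by simp
  have rows: "((\<lambda>t. if i = 1 then a t *\<^sub>R snd (y t) $ 1 else b t *\<^sub>R (snd (y t) $ 2 - m t *\<^sub>R snd (y t) $ 1))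
      has_derivative (\<lambda>t. if i = 1 then t *\<^sub>R snd w $ 1 else t *\<^sub>R snd w $ 2)) (at 0)" for i :: 2
  proof -
    have "((\<lambda>t. a t *\<^sub>R snd (y t) $ 1) has_derivative (\<lambda>t. t *\<^sub>R snd w $ 1)) (at 0)"
      by (auto intro!: derivative_eq_intros d row simp: 0)
    moreover have "((\<lambda>t. b t *\<^sub>R (snd (y t) $ 2 - m t *\<^sub>R snd (y t) $ 1)) has_derivative (\<lambda>t. t *\<^sub>R snd w $ 2)) (at 0)"
      by (auto intro!: derivative_eq_intros d row simp: 0)
    ultimately show ?thesis by (cases "i = 1") simp_all
  qed
  have e': "(e has_derivative (\<lambda>t. (fst (t *\<^sub>R w), \<chi> i. if i = 1 then t *\<^sub>R snd w $ 1 else t *\<^sub>R snd w $ 2))) (at 0)"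
    unfolding e_def by (rule has_derivative_Pair[OF has_derivative_fst[OF y'] has_derivative_vec_lambda[OF rows]])
  show ?thesis
  proof (rule tangential_curve[of e])
    show "(e has_vector_derivative w) (at 0)"
      unfolding has_vector_derivative_def
      by (rule has_derivative_eq_rhs[OF e']) (auto simp: prod_eq_iff vec_eq_iff[of "vec_lambda _"] forall_2 fun_eq_iff)
    show "e 0 = z" unfolding e_def y0 0 by (auto simp: prod_eq_iff vec_eq_iff[of "vec_lambda _"] forall_2)
    have tend: "((\<lambda>t. f t) \<longlongrightarrow> f 0) (nhds 0)" if "(f has_real_derivative 0) (at 0)" for f :: "real \<Rightarrow> real"
      using DERIV_isCont[OF that] by (simp add: continuous_at tendsto_at_iff_tendsto_nhds)
    have "\<forall>\<^sub>F t in nhds 0. g 1 1 t > 0" "\<forall>\<^sub>F t in nhds 0. s t > 0"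
      using order_tendstoD(1)[OF tend[OF dg[of 1 1]], of 0] order_tendstoD(1)[OF tend[OF ds], of 0]
      by (auto simp: g0 s0)
    moreover have "(y \<longlongrightarrow> z) (nhds 0)"
      using has_derivative_continuous[OF y'] tendsto_at_iff_tendsto_nhds[of y 0] y0
      by (simp add: continuous_at)
    then have "\<forall>\<^sub>F t in nhds 0. y t \<in> frame_dom c"
      using topological_tendstoD open_frame_dom zD by blast
    ultimately show "\<forall>\<^sub>F t in nhds 0. e t \<in> FM G c"
    proof eventually_elim
      fix t assume pos: "g 1 1 t > 0" "s t > 0" and yD: "y t \<in> frame_dom c"
      let ?u = "snd (y t)" let ?M = "G c (fst (y t))"
      have M: "?u $ i \<bullet> (?M *v ?u $ j) = g i j t" for i j by (simp add: g_def gram_nth)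
      have g21: "g 2 1 t = g 1 2 t"
        unfolding M[symmetric] by (rule ip_commute[OF G_sym[OF frame_dom_im[OF yD]]])
      have ab: "a t * a t * g 1 1 t = 1" "b t * b t * s t = 1" "a t > 0" "b t > 0"
        unfolding a_def b_def using pos by (simp_all add: field_simps)
      have ms: "g 1 2 t = m t * g 1 1 t" "g 2 2 t = s t + m t * m t * g 1 1 t"
        unfolding m_def s_def using pos by (simp_all add: field_simps power2_eq_square)
      \<comment> \<open>Subtracting a multiple of one row from the other and rescaling by positive
        factors preserves the orientation.\<close>
      have "det (snd (e t)) = a t * b t * det ?u"
        unfolding e_def by (simp add: det_2 algebra_simps)
      then have "e t \<in> frame_dom c"
        using yD ab(3,4) unfolding frame_dom_def e_def by simp
      moreover have "snd (e t) $ i \<bullet> (G c (fst (e t)) *v snd (e t) $ j) = (if i = j then 1 else 0)" for i j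
      proof -
        have "a t * (b t * (g 1 2 t - m t * g 1 1 t)) = 0"
          "b t * (b t * (g 2 2 t - m t * g 2 1 t - m t * (g 1 2 t - m t * g 1 1 t))) = 1"
          unfolding g21 ms using ab(2) by (simp_all add: algebra_simps)
        then have "\<forall>i j. snd (e t) $ i \<bullet> (G c (fst (e t)) *v snd (e t) $ j) = (if i = j then 1 else 0)"
          unfolding e_def forall_2 using ab(1) g21
          by (simp add: M matrix_vector_mult_diff_distrib matrix_vector_mult_scaleR
              inner_diff_left inner_diff_right mult.assoc) (auto simp: algebra_simps)
        then show ?thesis by blast
      qed
      ultimately show "e t \<in> FM G c" unfolding FM_iff by blast
    qed
  qed
qed

subsection \<open>The dual frame of the canonical and connection forms\<close>

lemma smooth_rows: "smooth_on (frame_dom c) (\<lambda>z. snd z $ i)"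
  by (intro smooth_on_bounded_linear open_frame_dom bounded_linear_snd_nth)

lemma smooth_form_eta: "smooth_form_on (frame_dom c) (eta G c i)"
  unfolding smooth_form_on_def
proof (intro conjI ballI allI)
  show "linear (eta G c i z)" for z
    unfolding eta_def by (rule linearI) (simp_all add: matrix_vector_right_distrib inner_add_right matrix_vector_mult_scaleR)
  show "smooth_on (frame_dom c) (\<lambda>z. eta G c i z w)" for w
    unfolding eta_def
    by (intro smooth_on_bilinear[OF open_frame_dom bounded_bilinear_inner] smooth_rows
        smooth_on_bilinear[OF open_frame_dom bounded_bilinear_matrix_vector_mult] smooth_on_const
        open_frame_dom smooth_on_comp_linear[OF open_frame_dom bounded_linear_fst _ smooth_G])
      (auto simp: frame_dom_def)
qed

lemma eta_has_derivative:
  assumes "z \<in> frame_dom c"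
  shows "((\<lambda>y. eta G c i y w) has_derivative (\<lambda>v. (snd v $ i) \<bullet> (G c (fst z) *v fst w)
    + (snd z $ i) \<bullet> (frechet_derivative (G c) (at (fst z)) (fst v) *v fst w))) (at z)"
proof -
  have G: "((\<lambda>z. G c (fst z)) has_derivative (\<lambda>w. frechet_derivative (G c) (at (fst z)) (fst w))) (at z)"
    by (rule has_derivative_compose[OF bounded_linear_imp_has_derivative[OF bounded_linear_fst]
          G_has_derivative[OF frame_dom_im[OF assms]]])
  show ?thesis unfolding eta_def
    by (rule has_derivative_eq_rhs[OF has_derivative_inner[OF
          bounded_linear_imp_has_derivative[OF bounded_linear_snd_nth]
          bounded_bilinear.FDERIV[OF bounded_bilinear_matrix_vector_mult G has_derivative_const]]])
      (auto simp: algebra_simps)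
qed

lemma linear_eta: "linear (eta G c i z)"
  unfolding eta_def by (rule linearI) (simp_all add: matrix_vector_right_distrib inner_add_right matrix_vector_mult_scaleR)

lemma linear_\<eta>12: "z \<in> frame_dom c \<Longrightarrow> linear (\<eta>12 c z)"
  using smooth_\<eta>12 unfolding smooth_form_on_def by blast

text \<open>Generator of the rotation of the fibre, with the sign for which \<open>\<eta>12\<close>
  takes the value 1 on it.\<close>

definition vert :: "2 frame \<Rightarrow> 2 frame" where
  "vert z = (0, \<chi> i. if i = 1 then - snd z $ 2 else snd z $ 1)"

text \<open>The rows must compensate the change of the metric in the direction
  \<open>snd z $ i\<close>. In the frame that change is a symmetric matrix, and the factor 1/2
  shares it equally between the two slots of the Gram matrix.\<close>

definition lift :: "2 \<Rightarrow> 2 frame \<Rightarrow> 2 frame" where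
  "lift i z = (snd z $ i, \<chi> a. - (1/2) *\<^sub>R (\<Sum>b\<in>UNIV.
     ((snd z $ a) \<bullet> (frechet_derivative (G c) (at (fst z)) (snd z $ i) *v (snd z $ b))) *\<^sub>R snd z $ b))"

text \<open>The standard horizontal field: the vertical correction removes the connection component
  of \<open>lift\<close> and keeps its base component. Together with \<open>vert\<close>, these
  fields are dual to \<open>\<eta>\<^sup>1\<close>, \<open>\<eta>\<^sup>2\<close>,
  \<open>\<eta>\<^sup>1\<^sub>2\<close>.\<close>

definition horiz :: "2 \<Rightarrow> 2 frame \<Rightarrow> 2 frame" where
  "horiz i z = lift i z - \<eta>12 c z (lift i z) *\<^sub>R vert z"

lemma vert_tangent: "z \<in> FM G c \<Longrightarrow> vert z \<in> frame_tangent (G c) z"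
proof -
  assume z: "z \<in> FM G c"
  have l: "linear (frechet_derivative (G c) (at (fst z)))"
    using z by (intro has_derivative_linear[OF G_has_derivative] frame_dom_im FM_frame_dom)
  show ?thesis
    unfolding tangent_iff[OF FM_frame_dom[OF z]] forall_2 vert_def
    using FM_orthonormal[OF z] linear_0[OF l] by (simp add: matrix_vector_mult_minus)
qed

lemma lift_tangent: "z \<in> FM G c \<Longrightarrow> lift i z \<in> frame_tangent (G c) z"
proof -
  assume z: "z \<in> FM G c"
  let ?S = "\<lambda>a b. (snd z $ a) \<bullet> (frechet_derivative (G c) (at (fst z)) (snd z $ i) *v (snd z $ b))"
  have S: "?S a b = ?S b a" for a b
    by (rule ip_commute[OF dG_sym[OF frame_dom_im[OF FM_frame_dom[OF z]]]])
  note o = FM_orthonormal[OF z]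
  show ?thesis
    unfolding tangent_iff[OF FM_frame_dom[OF z]] lift_def
    using S[of 1 2] by (simp add: forall_2 matrix_vector_mult_minus sum_2 o inner_add_left inner_add_right
        matrix_vector_right_distrib matrix_vector_mult_scaleR matrix_vector_mult_diff_distrib
        inner_diff_left inner_diff_right)
qed

lemma eta_vert: "eta G c i z (vert z) = 0"
  by (simp add: eta_def vert_def)

lemma eta_lift: "z \<in> FM G c \<Longrightarrow> eta G c i z (lift j z) = (if i = j then 1 else 0)"
  by (simp add: eta_def lift_def FM_orthonormal)

text \<open>The connection form is known only through the structure equations. The first of them on
  \<open>vert\<close> and \<open>lift 2\<close> gives minus the value sought, while differentiating
  the explicit formula for \<open>eta\<close> gives -1.\<close>

lemma \<eta>12_vert: assumes z: "z \<in> FM G c" shows "\<eta>12 c z (vert z) = 1"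
proof -
  have "ext_deriv (eta G c 1) z (vert z) (lift 2 z) = - \<eta>12 c z (vert z)"
    using first_structure[OF z vert_tangent[OF z] lift_tangent[OF z], of 1 2]
    by (simp add: sum_2 wedge_def conn_def eta_lift[OF z] eta_vert)
  moreover have "ext_deriv (eta G c 1) z (vert z) (lift 2 z) = - 1"
  proof -
    have l: "linear (frechet_derivative (G c) (at (fst z)))"
      using z by (intro has_derivative_linear[OF G_has_derivative] frame_dom_im FM_frame_dom)
    show ?thesis
      unfolding ext_deriv_def frechet_derivative_eqI[OF eta_has_derivative[OF FM_frame_dom[OF z]]]
      by (simp add: vert_def lift_def linear_0[OF l] FM_orthonormal[OF z])
  qed
  ultimately show ?thesis by simp
qed

lemma horiz_tangent: "z \<in> FM G c \<Longrightarrow> horiz i z \<in> frame_tangent (G c) z"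
  using tangent_lincomb[OF FM_frame_dom lift_tangent vert_tangent,
      where z = z and a = 1 and b = "- \<eta>12 c z (lift i z)"]
  by (simp add: horiz_def)

lemma eta_horiz: "z \<in> FM G c \<Longrightarrow> eta G c i z (horiz j z) = (if i = j then 1 else 0)"
  unfolding horiz_def using linear_diff[OF linear_eta] linear_cmul[OF linear_eta]
  by (simp add: eta_lift eta_vert)

lemma \<eta>12_horiz: "z \<in> FM G c \<Longrightarrow> \<eta>12 c z (horiz i z) = 0"
  unfolding horiz_def using linear_diff[OF linear_\<eta>12] linear_cmul[OF linear_\<eta>12]
  by (simp add: FM_frame_dom \<eta>12_vert)

lemma horiz_differentiable:
  assumes z: "z \<in> frame_dom c" shows "horiz i differentiable (at z)"
proof -
  \<comment> \<open>Here \<open>G c\<close> is differentiated in a moving direction. Expansion in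
    coordinate directions reduces this to derivatives in fixed directions, whose smoothness is
    known.\<close>
  have dG: "smooth_on (frame_dom c) (\<lambda>z. frechet_derivative (G c) (at (fst z)) (snd z $ i))"
  proof -
    have 1: "smooth_on (frame_dom c) (\<lambda>z. (snd z $ i $ b) *\<^sub>R frechet_derivative (G c) (at (fst z)) (axis b 1))" for b
      by (intro smooth_on_bilinear[OF open_frame_dom bounded_bilinear_scaleR]
          smooth_on_linear_comp[OF open_frame_dom bounded_linear_vec_nth smooth_rows]
          smooth_on_comp_linear[OF open_frame_dom bounded_linear_fst _ smooth_on_frechet_derivative[OF smooth_G]])
        (auto simp: frame_dom_def)
    have "(snd z $ i $ 1) *\<^sub>R frechet_derivative (G c) (at (fst z)) (axis 1 1) +
        (snd z $ i $ 2) *\<^sub>R frechet_derivative (G c) (at (fst z)) (axis 2 1)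
        = frechet_derivative (G c) (at (fst z)) (snd z $ i)" if "z \<in> frame_dom c" for z
    proof -
      have l: "linear (frechet_derivative (G c) (at (fst z)))"
        using that by (intro has_derivative_linear[OF G_has_derivative] frame_dom_im)
      have "snd z $ i = (snd z $ i $ 1) *\<^sub>R axis 1 1 + (snd z $ i $ 2) *\<^sub>R axis 2 1"
        by (simp add: vec_eq_iff forall_2 axis_def)
      then show ?thesis using linear_add[OF l] linear_cmul[OF l] by metis
    qed
    from smooth_on_cong[OF open_frame_dom this] smooth_on_add[OF open_frame_dom 1[of 1] 1[of 2]]
    show ?thesis by simp
  qed
  have "smooth_on (frame_dom c) (\<lambda>z. - (1/2) *\<^sub>R (\<Sum>b\<in>UNIV.
      ((snd z $ a) \<bullet> (frechet_derivative (G c) (at (fst z)) (snd z $ i) *v (snd z $ b))) *\<^sub>R snd z $ b))" for a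
    unfolding sum_2
    by (intro smooth_on_bilinear[OF open_frame_dom bounded_bilinear_scaleR] smooth_on_const open_frame_dom
        smooth_on_add smooth_on_bilinear[OF open_frame_dom bounded_bilinear_inner] smooth_rows
        smooth_on_bilinear[OF open_frame_dom bounded_bilinear_matrix_vector_mult] dG)
  from has_derivative_Pair[OF smooth_on_has_derivative[OF smooth_rows[of i] z] has_derivative_vec_lambda[OF smooth_on_has_derivative[OF this z], of "\<lambda>a. a"]]
  obtain l' where l': "(lift i has_derivative l') (at z)" unfolding lift_def[abs_def] by blast
  have "((\<lambda>z::2 frame. if a = 1 then - snd z $ 2 else snd z $ 1) has_derivative
      (\<lambda>w. if a = 1 then - snd w $ 2 else snd w $ 1)) (at z)" for a :: 2
    by (cases "a = 1") (simp_all add: has_derivative_minus bounded_linear_imp_has_derivative bounded_linear_snd_nth)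
  from has_derivative_Pair[OF has_derivative_const[of 0] has_derivative_vec_lambda[OF this, of "\<lambda>a. a"]]
  obtain v' where v': "(vert has_derivative v') (at z)" unfolding vert_def[abs_def] by blast
  show ?thesis
    unfolding horiz_def[abs_def]
    by (rule differentiableI[OF has_derivative_diff[OF l' has_derivative_scaleR[OF
        form_apply_has_derivative[OF smooth_form_eventually_linear[OF smooth_\<eta>12 open_frame_dom z]
          smooth_form_differentiable[OF smooth_\<eta>12 z] l'] v']]])
qed

section \<open>The bracket of the two horizontal fields\<close>

lemma gram_smooth: "smooth_on (frame_dom c) (\<lambda>z. gram (G c) z $ i $ j)"
  unfolding gram_nth
  by (intro smooth_on_bilinear[OF open_frame_dom bounded_bilinear_inner] smooth_rows
      smooth_on_bilinear[OF open_frame_dom bounded_bilinear_matrix_vector_mult]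
      smooth_on_comp_linear[OF open_frame_dom bounded_linear_fst _ smooth_G])
    (auto simp: frame_dom_def)

lemma exact_form:
  fixes f :: "2 frame \<Rightarrow> real"
  assumes f: "smooth_on (frame_dom c) f"
  shows "smooth_form_on (frame_dom c) (\<lambda>z w. frechet_derivative f (at z) w)"
    and "z \<in> frame_dom c \<Longrightarrow> ext_deriv (\<lambda>z w. frechet_derivative f (at z) w) z v w = 0"
  using frechet_derivative_commute[OF open_frame_dom _ f]
    smooth_on_frechet_derivative[OF f] has_derivative_linear[OF smooth_on_has_derivative[OF f]]
  by (auto simp: smooth_form_on_def ext_deriv_def)

lemma horiz_form_bracket:
  assumes z: "z \<in> FM G c" and \<omega>: "smooth_form_on (frame_dom c) \<omega>"
    and 1: "\<And>y. y \<in> FM G c \<Longrightarrow> \<omega> y (horiz 1 y) = a" and 2: "\<And>y. y \<in> FM G c \<Longrightarrow> \<omega> y (horiz 2 y) = b"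
    and V: "(horiz 1 has_derivative V') (at z)" and W: "(horiz 2 has_derivative W') (at z)"
  shows "\<omega> z (W' (horiz 1 z) - V' (horiz 2 z)) = - ext_deriv \<omega> z (horiz 1 z) (horiz 2 z)"
  by (rule form_bracket[OF smooth_form_eventually_linear[OF \<omega> open_frame_dom FM_frame_dom[OF z]]
        smooth_form_differentiable[OF \<omega> FM_frame_dom[OF z]] V FM_tangential[OF z horiz_tangent[OF z]]
        W FM_tangential[OF z horiz_tangent[OF z]], of a b]) (simp_all add: 1 2)

text \<open>For tangency the bracket is tested with the differentials of the Gram entries, which
  vanish on the horizontal fields along the bundle and are closed. The other values are minus the
  structure equations on the horizontal pair; so the bracket is \<open>- K\<close> times the
  generator \<open>vert\<close>.\<close>

lemma horiz_bracket:
  assumes z: "z \<in> FM G c"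
    and V: "(horiz 1 has_derivative V') (at z)" and W: "(horiz 2 has_derivative W') (at z)"
  defines "B \<equiv> W' (horiz 1 z) - V' (horiz 2 z)"
  shows "B \<in> frame_tangent (G c) z" and "eta G c i z B = 0" and "\<eta>12 c z B = - frame_pullback K c z"
proof -
  note br = horiz_form_bracket[OF z _ _ _ V W, folded B_def]
  note t = horiz_tangent[OF z]
  show "B \<in> frame_tangent (G c) z"
    unfolding tangent_iff_gram[OF FM_frame_dom[OF z]]
  proof (intro allI)
    fix i j
    have "frechet_derivative (\<lambda>z. gram (G c) z $ i $ j) (at y) (horiz l y) = 0" if "y \<in> FM G c" for y l
      using horiz_tangent[OF that, of l] tangent_iff_gram[OF FM_frame_dom[OF that]] by blast
    then show "frechet_derivative (\<lambda>z. gram (G c) z $ i $ j) (at z) B = 0"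
      using br[OF exact_form(1)[OF gram_smooth]] exact_form(2)[OF gram_smooth FM_frame_dom[OF z]] by simp
  qed
  show "eta G c i z B = 0"
    using br[OF smooth_form_eta, of i] first_structure[OF z t[of 1] t[of 2]]
    by (simp add: eta_horiz z \<eta>12_horiz wedge_def conn_def sum_2)
  show "\<eta>12 c z B = - frame_pullback K c z"
    using br[OF smooth_\<eta>12] second_structure[OF z t[of 1] t[of 2]]
    by (simp add: eta_horiz z \<eta>12_horiz wedge_def)
qed

end

section \<open>Differential forms on products\<close>

lemma ext_deriv_add:
  assumes "\<And>w. (\<lambda>y. \<alpha> y w) differentiable (at z)" "\<And>w. (\<lambda>y. \<beta> y w) differentiable (at z)"
  shows "ext_deriv (\<lambda>z w. \<alpha> z w + \<beta> z w) z v w = ext_deriv \<alpha> z v w + ext_deriv \<beta> z v w"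
  unfolding ext_deriv_def
  using frechet_derivative_eqI[OF has_derivative_add[OF assms[unfolded frechet_derivative_works]]]
  by simp

lemma ext_deriv_diff:
  assumes "\<And>w. (\<lambda>y. \<alpha> y w) differentiable (at z)" "\<And>w. (\<lambda>y. \<beta> y w) differentiable (at z)"
  shows "ext_deriv (\<lambda>z w. \<alpha> z w - \<beta> z w) z v w = ext_deriv \<alpha> z v w - ext_deriv \<beta> z v w"
  unfolding ext_deriv_def
  using frechet_derivative_eqI[OF has_derivative_diff[OF assms[unfolded frechet_derivative_works]]]
  by simp

lemma ext_deriv_mult:
  assumes "f differentiable (at z)" "\<And>w. (\<lambda>y. \<alpha> y w) differentiable (at z)"
  shows "ext_deriv (\<lambda>z w. f z * \<alpha> z w) z v w =
    frechet_derivative f (at z) v * \<alpha> z w - frechet_derivative f (at z) w * \<alpha> z v + f z * ext_deriv \<alpha> z v w"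
  unfolding ext_deriv_def
  using frechet_derivative_eqI[OF has_derivative_mult[OF assms[unfolded frechet_derivative_works]]]
  by (simp add: algebra_simps)

lemma frechet_derivative_fst:
  assumes "f differentiable (at (fst z))"
  shows "frechet_derivative (\<lambda>z. f (fst z)) (at z) v = frechet_derivative f (at (fst z)) (fst v)"
  by (rule frechet_derivative_eqI[OF has_derivative_compose[OF
      bounded_linear_imp_has_derivative[OF bounded_linear_fst] assms[unfolded frechet_derivative_works]]])

lemma frechet_derivative_snd:
  assumes "f differentiable (at (snd z))"
  shows "frechet_derivative (\<lambda>z. f (snd z)) (at z) v = frechet_derivative f (at (snd z)) (snd v)"
  by (rule frechet_derivative_eqI[OF has_derivative_compose[OF
      bounded_linear_imp_has_derivative[OF bounded_linear_snd] assms[unfolded frechet_derivative_works]]])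

lemma ext_deriv_pull_M:
  assumes "\<And>w. (\<lambda>y. \<alpha> y w) differentiable (at (fst z))"
  shows "ext_deriv (pull_M \<alpha>) z v w = ext_deriv \<alpha> (fst z) (fst v) (fst w)"
  unfolding ext_deriv_def pull_M_def using frechet_derivative_fst[OF assms] by simp

lemma ext_deriv_pull_E:
  assumes "\<And>w. (\<lambda>y. \<alpha> y w) differentiable (at (snd z))"
  shows "ext_deriv (pull_E \<alpha>) z v w = ext_deriv \<alpha> (snd z) (snd v) (snd w)"
  unfolding ext_deriv_def pull_E_def using frechet_derivative_snd[OF assms] by simp

lemma smooth_differentiable: "smooth_on N f \<Longrightarrow> z \<in> N \<Longrightarrow> f differentiable (at z)"
  using smooth_on_has_derivative differentiableI by blast

lemma smooth_form_diff:
  "open N \<Longrightarrow> smooth_form_on N \<alpha> \<Longrightarrow> smooth_form_on N \<beta> \<Longrightarrow> smooth_form_on N (\<lambda>z w. \<alpha> z w - \<beta> z w)"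
  unfolding smooth_form_on_def by (simp add: smooth_on_diff linear_compose_sub)

lemma smooth_form_add:
  "open N \<Longrightarrow> smooth_form_on N \<alpha> \<Longrightarrow> smooth_form_on N \<beta> \<Longrightarrow> smooth_form_on N (\<lambda>z w. \<alpha> z w + \<beta> z w)"
  unfolding smooth_form_on_def by (simp add: smooth_on_add linear_compose_add)

lemma smooth_form_mult:
  assumes "open N" "smooth_on N f" "smooth_form_on N \<alpha>"
  shows "smooth_form_on N (\<lambda>z w. f z * \<alpha> z w)"
  using assms linear_compose_scale_right[of "\<alpha> _" "f _"]
  unfolding smooth_form_on_def by (simp add: smooth_on_mult)

lemma smooth_form_pull_M:
  assumes "open N" "smooth_form_on N \<alpha>" shows "smooth_form_on (N \<times> UNIV) (pull_M \<alpha>)"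
proof -
  have "smooth_on (N \<times> UNIV) (\<lambda>z. \<alpha> (fst z) w)" for w and z :: "2 frame \<times> 3 frame"
    using assms by (intro smooth_on_comp_linear[OF _ bounded_linear_fst, of _ N])
      (auto simp: open_Times smooth_form_on_def simp del: split_paired_All)
  moreover have "linear (\<lambda>w::pt. \<alpha> z (fst w))" if "z \<in> N" for z
    using linear_compose[OF linear_fst] assms(2) that unfolding smooth_form_on_def o_def by blast
  ultimately show ?thesis unfolding smooth_form_on_def pull_M_def by auto
qed

lemma smooth_form_pull_E:
  assumes "open N" "smooth_form_on UNIV \<alpha>" shows "smooth_form_on (N \<times> UNIV) (pull_E \<alpha>)"
proof -
  have "smooth_on (N \<times> UNIV) (\<lambda>z. \<alpha> (snd z) w)" for w and z :: "2 frame \<times> 3 frame"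
    using assms by (intro smooth_on_comp_linear[OF _ bounded_linear_snd, of _ UNIV])
      (auto simp: open_Times smooth_form_on_def simp del: split_paired_All)
  moreover have "linear (\<lambda>w::pt. \<alpha> z (snd w))" for z
    using linear_compose[OF linear_snd] assms(2) unfolding smooth_form_on_def o_def by blast
  ultimately show ?thesis unfolding smooth_form_on_def pull_E_def by auto
qed

lemma sum_list_forms:
  "(\<Sum>i<length (f # fs). a i * ((f # fs) ! i) z w) = a 0 * f z w + (\<Sum>i<length fs. a (Suc i) * (fs ! i) z w)"
  by (simp del: sum.lessThan_Suc add: sum.lessThan_Suc_shift)

section \<open>Logarithmic derivatives of the curvature\<close>

context surface_patch
begin

definition k :: "2 frame \<Rightarrow> real" where "k z = sqrt (- frame_pullback K c z)"

text \<open>As \<open>q = k powr (- 3 / 2)\<close>, this is minus half the logarithmic derivative of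
  \<open>k\<close>. With this factor the \<open>n i\<close> are exactly the
  \<open>\<omega>\<^sup>3\<^sub>i\<close> components of \<open>mU\<close> below.\<close>

definition n :: "2 \<Rightarrow> 2 frame \<Rightarrow> real" where "n i z = Q1 i c z / (3 * frame_pullback q c z)"

text \<open>With \<open>n\<^sub>i\<^sub>;\<^sub>j\<close> denoting covariant derivatives on the surface, \<open>h\<^sub>i\<^sub>j = n\<^sub>i\<^sub>;\<^sub>j + n\<^sub>i n\<^sub>j\<close>.\<close>

definition h :: "2 \<Rightarrow> 2 \<Rightarrow> 2 frame \<Rightarrow> real" where
  "h i j z = Q2 i j c z / (3 * frame_pullback q c z) - 2 * n i z * n j z"

lemma k_pos: "k z > 0" unfolding k_def frame_pullback_def using K_neg by simp

lemma K_eq: "frame_pullback K c z = - (k z)\<^sup>2"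
  unfolding k_def frame_pullback_def using less_imp_le[OF K_neg] by simp

lemma q_k: "frame_pullback q c z = k z powr (- 3 / 2)"
  unfolding k_def frame_pullback_def q_eq ..

lemma q_k_fun: "frame_pullback q c = (\<lambda>z. k z powr (- 3 / 2))"
  by (rule ext) (rule q_k)

lemma q_pos: "frame_pullback q c z > 0" unfolding q_k using k_pos[of z] by simp

lemma smooth_pullback:
  "smooth_on (chart_im c) f \<Longrightarrow> smooth_on (frame_dom c) (\<lambda>z. f (fst z))"
  by (rule smooth_on_comp_linear[OF open_frame_dom bounded_linear_fst]) (auto simp: frame_dom_def)

lemma smooth_k: "smooth_on (frame_dom c) k"
proof -
  have "smooth_on (frame_dom c) (\<lambda>z. (- (K \<circ> chart_inv c) (fst z)) powr (1/2))"
    using K_neg by (intro smooth_on_powr open_frame_dom smooth_on_minus smooth_pullback smooth_K) simp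
  then show ?thesis unfolding k_def[abs_def] frame_pullback_def using less_imp_le[OF K_neg]
    by (simp add: powr_half_sqrt)
qed

lemma smooth_q: "smooth_on (frame_dom c) (frame_pullback q c)"
  unfolding q_k_fun by (rule smooth_on_powr[OF open_frame_dom k_pos smooth_k])

lemma smooth_inverse_q: "smooth_on (frame_dom c) (\<lambda>z. 1 / (3 * frame_pullback q c z))"
proof -
  have "smooth_on (frame_dom c) (\<lambda>z. 1/3 * frame_pullback q c z powr (- 1))"
    by (intro smooth_on_mult smooth_on_const open_frame_dom smooth_on_powr q_pos smooth_q)
  then show ?thesis using q_pos by (simp add: powr_minus_divide less_imp_le)
qed

lemma smooth_n: "smooth_on (frame_dom c) (n i)"
  using smooth_on_mult[OF open_frame_dom smooth_Q1[of i] smooth_inverse_q]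
  unfolding n_def[abs_def] by simp

lemma smooth_h: "smooth_on (frame_dom c) (h i j)"
proof -
  have "smooth_on (frame_dom c) (\<lambda>z. Q2 i j c z * (1 / (3 * frame_pullback q c z)) - 2 * n i z * n j z)"
    by (intro smooth_on_diff smooth_on_mult smooth_on_const open_frame_dom smooth_Q2 smooth_inverse_q smooth_n)
  then show ?thesis unfolding h_def[abs_def] by simp
qed

lemma dq_n:
  assumes "z \<in> FM G c" "w \<in> frame_tangent (G c) z"
  shows "frechet_derivative (frame_pullback q c) (at z) w =
    3 * frame_pullback q c z * (n 1 z * eta G c 1 z w + n 2 z * eta G c 2 z w)"
  using dq[OF assms] q_pos[of z] by (simp add: n_def sum_2 field_simps)

lemma dk:
  assumes z: "z \<in> FM G c" and w: "w \<in> frame_tangent (G c) z"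
  shows "frechet_derivative k (at z) w = - 2 * k z * (n 1 z * eta G c 1 z w + n 2 z * eta G c 2 z w)"
proof -
  have k': "(k has_derivative frechet_derivative k (at z)) (at z)"
    by (rule smooth_on_has_derivative[OF smooth_k FM_frame_dom[OF z]])
  have "((\<lambda>x. x powr (- 3/2)) has_derivative (*) ((- 3/2) * k z powr (- 3/2 - 1))) (at (k z))"
    using has_real_derivative_powr[OF k_pos[of z], of "- 3/2"] by (simp add: has_field_derivative_def)
  from frechet_derivative_eqI[OF has_derivative_compose[OF k' this]]
  have "frechet_derivative (frame_pullback q c) (at z) w =
      (- 3/2) * k z powr (- 3/2 - 1) * frechet_derivative k (at z) w"
    unfolding q_k_fun by simp
  moreover have "k z powr (- 3/2 - 1) = frame_pullback q c z / k z"
    unfolding q_k using k_pos[of z] by (subst powr_diff) simp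
  ultimately have "3 * frame_pullback q c z * (n 1 z * eta G c 1 z w + n 2 z * eta G c 2 z w)
      = (- 3/2) * (frame_pullback q c z / k z) * frechet_derivative k (at z) w"
    unfolding dq_n[OF z w] by simp
  then have "frame_pullback q c z * (frechet_derivative k (at z) w
      + 2 * k z * (n 1 z * eta G c 1 z w + n 2 z * eta G c 2 z w)) = 0"
    using k_pos[of z] by (simp add: field_simps)
  then show ?thesis using q_pos[of z] by simp
qed

text \<open>The quotient rule contributes \<open>- 3 n\<^sub>i n\<^sub>j\<close>; since
  \<open>h\<close> already has \<open>2 n\<^sub>i n\<^sub>j\<close> subtracted,
  \<open>h\<^sub>i\<^sub>j - n\<^sub>i n\<^sub>j\<close> remains.\<close>

lemma dn:
  assumes z: "z \<in> FM G c" and w: "w \<in> frame_tangent (G c) z"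
  shows "frechet_derivative (n i) (at z) w = n 1 z * conn (\<eta>12 c) 1 i z w + n 2 z * conn (\<eta>12 c) 2 i z w
    + (h i 1 z - n i z * n 1 z) * eta G c 1 z w + (h i 2 z - n i z * n 2 z) * eta G c 2 z w"
proof -
  have "(n i has_derivative (\<lambda>w. (frechet_derivative (Q1 i c) (at z) w * (3 * frame_pullback q c z)
      - Q1 i c z * (3 * frechet_derivative (frame_pullback q c) (at z) w)) /
      ((3 * frame_pullback q c z) * (3 * frame_pullback q c z)))) (at z)"
    unfolding n_def[abs_def] using q_pos[of z]
    by (intro has_derivative_divide' has_derivative_mult_right
        smooth_on_has_derivative[OF smooth_Q1] smooth_on_has_derivative[OF smooth_q] FM_frame_dom z) simp
  from frechet_derivative_eqI[OF this, of w]
  have "frechet_derivative (n i) (at z) w = (frechet_derivative (Q1 i c) (at z) w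
      - Q1 i c z * (3 * (n 1 z * eta G c 1 z w + n 2 z * eta G c 2 z w))) / (3 * frame_pullback q c z)"
  proof -
    have "(a * (3 * r) - b * (3 * (3 * r * s))) / ((3 * r) * (3 * r)) = (a - b * (3 * s)) / (3 * r)"
      if "r > 0" for a b r s :: real
    proof -
      have "a * (3 * r) - b * (3 * (3 * r * s)) = (3 * r) * (a - b * (3 * s))" by (simp add: algebra_simps)
      then show ?thesis using that by (metis nonzero_mult_divide_mult_cancel_left mult_eq_0_iff less_irrefl zero_neq_numeral)
    qed
    then show ?thesis using \<open>frechet_derivative (n i) (at z) w = _\<close> q_pos[of z]
      unfolding dq_n[OF z w] by presburger
  qed
  moreover have Q: "Q1 j c z = (3 * frame_pullback q c z) * n j z"
    "Q2 i j c z = (3 * frame_pullback q c z) * (h i j z + 2 * n i z * n j z)" for i j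
    using q_pos[of z] by (simp_all add: n_def h_def)
  let ?X = "n 1 z * conn (\<eta>12 c) 1 i z w + n 2 z * conn (\<eta>12 c) 2 i z w
    + (h i 1 z - n i z * n 1 z) * eta G c 1 z w + (h i 2 z - n i z * n 2 z) * eta G c 2 z w"
  have "frechet_derivative (Q1 i c) (at z) w - Q1 i c z * (3 * (n 1 z * eta G c 1 z w + n 2 z * eta G c 2 z w))
      = (3 * frame_pullback q c z) * ?X"
    unfolding dQ1[OF z w] sum_2 Q by (simp add: algebra_simps)
  ultimately show ?thesis using q_pos[of z] by simp
qed

lemma dk_horiz: "z \<in> FM G c \<Longrightarrow> frechet_derivative k (at z) (horiz j z) = - 2 * k z * n j z"
  using exhaust_2[of j] by (auto simp: dk horiz_tangent eta_horiz)

lemma dn_horiz: "z \<in> FM G c \<Longrightarrow> frechet_derivative (n i) (at z) (horiz j z) = h i j z - n i z * n j z"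
  using exhaust_2[of j] by (auto simp: dn horiz_tangent eta_horiz \<eta>12_horiz conn_def)

lemma ext_deriv_eta:
  assumes "z \<in> FM G c" "v \<in> frame_tangent (G c) z" "w \<in> frame_tangent (G c) z"
  shows "ext_deriv (eta G c 1) z v w = - (\<eta>12 c z v * eta G c 2 z w - \<eta>12 c z w * eta G c 2 z v)"
    and "ext_deriv (eta G c 2) z v w = \<eta>12 c z v * eta G c 1 z w - \<eta>12 c z w * eta G c 1 z v"
    and "ext_deriv (\<eta>12 c) z v w = - (k z)\<^sup>2 * (eta G c 1 z v * eta G c 2 z w - eta G c 1 z w * eta G c 2 z v)"
  using first_structure[OF assms] second_structure[OF assms]
  by (simp_all add: sum_2 wedge_def conn_def K_eq)

text \<open>The form \<open>q\<^sub>1 \<eta>\<^sup>1 + q\<^sub>2 \<eta>\<^sup>2 - dq\<close>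
  vanishes on every vector tangent to the bundle, hence also on the bracket of the horizontal
  fields. The bracket formula then makes its exterior derivative vanish on the horizontal pair, and
  that value is \<open>q\<^sub>2\<^sub>1 - q\<^sub>1\<^sub>2\<close>.\<close>

lemma h_sym: assumes z: "z \<in> FM G c" shows "h 2 1 z = h 1 2 z"
proof -
  let ?\<omega> = "\<lambda>z w. Q1 1 c z * eta G c 1 z w + Q1 2 c z * eta G c 2 z w
    - frechet_derivative (frame_pullback q c) (at z) w"
  note zD = FM_frame_dom[OF z]
  obtain V' W' where V': "(horiz 1 has_derivative V') (at z)" and W': "(horiz 2 has_derivative W') (at z)"
    using horiz_differentiable[OF zD] unfolding differentiable_def by blast
  have zero: "?\<omega> y w = 0" if "y \<in> FM G c" "w \<in> frame_tangent (G c) y" for y w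
    using dq[OF that] by (simp add: sum_2)
  have \<omega>: "smooth_form_on (frame_dom c) ?\<omega>"
    by (intro smooth_form_diff smooth_form_add smooth_form_mult open_frame_dom smooth_Q1 smooth_form_eta
        exact_form smooth_q)
  have "ext_deriv ?\<omega> z (horiz 1 z) (horiz 2 z) = 0"
    using horiz_form_bracket[OF z \<omega> zero[OF _ horiz_tangent] zero[OF _ horiz_tangent] V' W']
      zero[OF z horiz_bracket(1)[OF z V' W']] by simp
  moreover have "ext_deriv ?\<omega> z v w = ext_deriv (\<lambda>z w. Q1 1 c z * eta G c 1 z w) z v w
      + ext_deriv (\<lambda>z w. Q1 2 c z * eta G c 2 z w) z v w" for v w
    using exact_form(2)[OF smooth_q zD]
    by (subst ext_deriv_diff ext_deriv_add, (intro smooth_form_differentiable[OF _ zD] smooth_form_add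
        smooth_form_mult open_frame_dom smooth_Q1 smooth_form_eta exact_form smooth_q)+)+ simp
  ultimately have "Q2 2 1 c z = Q2 1 2 c z"
    using horiz_tangent[OF z, of 1] horiz_tangent[OF z, of 2]
    by (simp add: ext_deriv_mult[OF smooth_differentiable[OF smooth_Q1 zD] smooth_form_differentiable[OF smooth_form_eta zD]]
        dQ1 z ext_deriv_eta eta_horiz \<eta>12_horiz sum_2 conn_def)
  then show ?thesis by (simp add: h_def)
qed

text \<open>Both \<open>q powr (- 1 / 3)\<close> and \<open>k\<^sup>2 q\<close> equal
  \<open>k powr (1 / 2)\<close>, so division by \<open>3 q\<close> turns the right side of the
  equations into \<open>- k\<^sup>2\<close>.\<close>

lemma target_iff:
  "Q2 i j c z = (if i = j then - 3 * frame_pullback q c z powr (- 1 / 3) else 0) \<longleftrightarrow>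
    h i j z = (if i = j then - (k z)\<^sup>2 else 0) - 2 * n i z * n j z"
proof -
  have "frame_pullback q c z powr (- 1 / 3) = k z powr (1 / 2)" unfolding q_k by (simp add: powr_powr)
  also have "\<dots> = k z powr 2 * k z powr (- 3 / 2)" by (simp add: powr_add[symmetric])
  also have "\<dots> = (k z)\<^sup>2 * frame_pullback q c z"
    unfolding q_k using k_pos[of z] by (simp add: powr_numeral)
  finally have e: "frame_pullback q c z powr (- 1 / 3) = (k z)\<^sup>2 * frame_pullback q c z" .
  show ?thesis unfolding e h_def using q_pos[of z] by (auto simp: field_simps)
qed

end

section \<open>Sufficiency\<close>

context surface_patch
begin

section \<open>The generators of the Pfaffian systems and their spans\<close>

definition th0 :: "pt form" where "th0 z w = om 3 (snd z) (snd w)"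
definition th1 :: "pt form" where "th1 z w = om 1 (snd z) (snd w) - eta G c 1 (fst z) (fst w)"
definition th2 :: "pt form" where "th2 z w = om 2 (snd z) (snd w) - eta G c 2 (fst z) (fst w)"
definition th3 :: "pt form" where "th3 z w = om_conn 1 2 (snd z) (snd w) - \<eta>12 c (fst z) (fst w)"
definition pi1 :: "real \<Rightarrow> pt form" where
  "pi1 \<epsilon> z w = om_conn 3 1 (snd z) (snd w) - \<epsilon> * k (fst z) * eta G c 2 (fst z) (fst w)"
definition pi2 :: "real \<Rightarrow> pt form" where
  "pi2 \<epsilon> z w = om_conn 3 2 (snd z) (snd w) + \<epsilon> * k (fst z) * eta G c 1 (fst z) (fst w)"

lemmas form_defs = th0_def th1_def th2_def th3_def pi1_def pi2_def

lemma theta_list: "theta G \<eta>12 c = [th0, th1, th2, th3]"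
  unfolding theta_def pull_M_def pull_E_def th0_def[abs_def] th1_def[abs_def] th2_def[abs_def] th3_def[abs_def] ..

lemma singular_system_list: "singular_system G \<eta>12 K \<epsilon> c = [th0, th1, th2, th3, pi1 \<epsilon>, pi2 \<epsilon>]"
  unfolding singular_system_def theta_list Let_def pull_M_def pull_E_def pi1_def[abs_def] pi2_def[abs_def] k_def
  by simp

lemma pfaff_span_theta: "\<beta> \<in> pfaff_span T (theta G \<eta>12 c) z \<longleftrightarrow> (\<exists>c0 c1 c2 c3. \<forall>w\<in>T z.
    \<beta> w = c0 * th0 z w + c1 * th1 z w + c2 * th2 z w + c3 * th3 z w)"
  unfolding pfaff_span_def theta_list mem_Collect_eq sum_list_forms
proof (safe, goal_cases)
  case (1 a)
  then show ?case
    by (intro exI[of _ "a 0"] exI[of _ "a (Suc 0)"] exI[of _ "a (Suc (Suc 0))"] exI[of _ "a (Suc (Suc (Suc 0)))"])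
      (simp add: add.assoc)
next
  case (2 c0 c1 c2 c3)
  then show ?case by (intro exI[of _ "\<lambda>i. [c0, c1, c2, c3] ! i"]) (simp add: add.assoc)
qed

lemma pfaff_span_singular: "\<beta> \<in> pfaff_span T (singular_system G \<eta>12 K \<epsilon> c) z \<longleftrightarrow>
    (\<exists>c0 c1 c2 c3 m1 m2. \<forall>w\<in>T z. \<beta> w = c0 * th0 z w + c1 * th1 z w + c2 * th2 z w + c3 * th3 z w
      + m1 * pi1 \<epsilon> z w + m2 * pi2 \<epsilon> z w)"
  unfolding pfaff_span_def singular_system_list mem_Collect_eq sum_list_forms
proof (safe, goal_cases)
  case (1 a)
  then show ?case
    by (intro exI[of _ "a 0"] exI[of _ "a (Suc 0)"] exI[of _ "a (Suc (Suc 0))"] exI[of _ "a (Suc (Suc (Suc 0)))"]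
         exI[of _ "a (Suc (Suc (Suc (Suc 0))))"] exI[of _ "a (Suc (Suc (Suc (Suc (Suc 0)))))"])
      (simp add: add.assoc)
next
  case (2 c0 c1 c2 c3 m1 m2)
  then show ?case by (intro exI[of _ "\<lambda>i. [c0, c1, c2, c3, m1, m2] ! i"])
    (simp only: nth_Cons_0 nth_Cons_Suc list.size lessThan_0 sum.empty add.assoc add_0_right)
qed

lemma zero_tangent: "z \<in> FM G c \<Longrightarrow> 0 \<in> frame_tangent (G c) z"
  using tangent_lincomb[OF FM_frame_dom vert_tangent vert_tangent, where a = 0 and b = 0] by simp

text \<open>The transverse part of \<open>V\<^sub>\<epsilon>\<close> is spanned by \<open>\<pi>\<^sub>i - (\<epsilon> n\<^sub>i / k) \<theta>\<^sub>3\<close>.\<close>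

definition alpha :: "real \<Rightarrow> 2 \<Rightarrow> pt form" where
  "alpha \<epsilon> i z w = (if i = 1 then pi1 \<epsilon> z w else pi2 \<epsilon> z w) - \<epsilon> * n i (fst z) / k (fst z) * th3 z w"

lemma smooth_inverse_k: "smooth_on (frame_dom c) (\<lambda>z. 1 / k z)"
proof -
  have "smooth_on (frame_dom c) (\<lambda>z. k z powr (- 1))"
    by (intro smooth_on_powr open_frame_dom k_pos smooth_k)
  then show ?thesis using k_pos by (simp add: powr_minus_divide less_imp_le)
qed

lemma smooth_n_over_k: "smooth_on (frame_dom c) (\<lambda>z. \<epsilon> * n i z / k z)"
  using smooth_on_mult[OF open_frame_dom smooth_on_mult[OF open_frame_dom
        smooth_on_const[OF open_frame_dom] smooth_n] smooth_inverse_k, of \<epsilon> i] by simp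

lemma smooth_lift_fst:
  "smooth_on (frame_dom c) f \<Longrightarrow> smooth_on (frame_dom c \<times> UNIV) (\<lambda>z::pt. f (fst z))"
  by (rule smooth_on_comp_linear[OF _ bounded_linear_fst]) (auto simp: open_Times open_frame_dom)

lemma alpha_1: "alpha \<epsilon> 1 = (\<lambda>z w. (pull_E (om_conn 3 1) z w - \<epsilon> * k (fst z) * pull_M (eta G c 2) z w)
    - \<epsilon> * n 1 (fst z) / k (fst z) * (pull_E (om_conn 1 2) z w - pull_M (\<eta>12 c) z w))"
  and alpha_2: "alpha \<epsilon> 2 = (\<lambda>z w. (pull_E (om_conn 3 2) z w + \<epsilon> * k (fst z) * pull_M (eta G c 1) z w)
    - \<epsilon> * n 2 (fst z) / k (fst z) * (pull_E (om_conn 1 2) z w - pull_M (\<eta>12 c) z w))"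
  by (simp_all add: fun_eq_iff alpha_def form_defs pull_M_def pull_E_def)

lemma smooth_form_alpha: "smooth_form_on (frame_dom c \<times> UNIV) (alpha \<epsilon> i)"
proof -
  note rules = smooth_form_diff smooth_form_add smooth_form_mult smooth_form_pull_M smooth_form_pull_E
    smooth_form_om_conn smooth_form_eta smooth_\<eta>12 open_Times open_frame_dom open_UNIV
    smooth_lift_fst[OF smooth_n_over_k] smooth_lift_fst[OF smooth_on_mult[OF open_frame_dom smooth_on_const[OF open_frame_dom] smooth_k]]
  have "smooth_form_on (frame_dom c \<times> UNIV) (alpha \<epsilon> 1)" unfolding alpha_1 by (intro rules)
  moreover have "smooth_form_on (frame_dom c \<times> UNIV) (alpha \<epsilon> 2)" unfolding alpha_2 by (intro rules)
  ultimately show ?thesis using exhaust_2[of i] by auto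
qed

text \<open>Second derivatives of \<open>q\<close> enter only through the differential of
  \<open>\<epsilon> n\<^sub>i / k\<close>, and the hypothesis on \<open>h\<close> replaces them by
  lower order terms. On the common kernel \<open>\<omega>\<^sup>3\<^sub>1\<close> and
  \<open>\<omega>\<^sup>3\<^sub>2\<close> are combinations of the other forms, and then all terms
  cancel.\<close>

lemma alpha_frobenius:
  assumes \<epsilon>: "\<epsilon> = 1 \<or> \<epsilon> = -1" and z: "z \<in> total_space G c"
    and v: "v \<in> total_tangent G c z" and w: "w \<in> total_tangent G c z"
    and h: "\<And>i j. h i j (fst z) = (if i = j then - (k (fst z))\<^sup>2 else 0) - 2 * n i (fst z) * n j (fst z)"
    and av: "\<And>i. alpha \<epsilon> i z v = 0" and aw: "\<And>i. alpha \<epsilon> i z w = 0"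
  shows "ext_deriv (alpha \<epsilon> i) z v w = 0"
proof -
  have zM: "fst z \<in> FM G c" and zE: "snd z \<in> FE" using z by (auto simp: total_space_def)
  have vM: "fst v \<in> frame_tangent (G c) (fst z)" and vE: "snd v \<in> frame_tangent (\<lambda>_. mat 1) (snd z)"
    and wM: "fst w \<in> frame_tangent (G c) (fst z)" and wE: "snd w \<in> frame_tangent (\<lambda>_. mat 1) (snd z)"
    using v w by (auto simp: total_tangent_def)
  note zD = FM_frame_dom[OF zM]
  have zN: "z \<in> frame_dom c \<times> UNIV" using zD by (cases z) auto
  let ?N = "frame_dom c \<times> (UNIV :: 3 frame set)"
  note diff_forms = smooth_form_differentiable[OF _ zN]
  note rules = smooth_form_diff smooth_form_add smooth_form_mult smooth_form_pull_M smooth_form_pull_E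
    smooth_form_om_conn smooth_form_eta smooth_\<eta>12 open_Times open_frame_dom open_UNIV
    smooth_lift_fst[OF smooth_n_over_k] smooth_lift_fst[OF smooth_on_mult[OF open_frame_dom smooth_on_const[OF open_frame_dom] smooth_k]]
  have dp: "frechet_derivative (\<lambda>z. \<epsilon> * n i (fst z) / k (fst z)) (at z) x =
      \<epsilon> * (frechet_derivative (n i) (at (fst z)) (fst x) / k (fst z)
        - n i (fst z) * frechet_derivative k (at (fst z)) (fst x) / (k (fst z))\<^sup>2)" for i x
  proof -
    have "((\<lambda>z. \<epsilon> * n i z / k z) has_derivative (\<lambda>x. (\<epsilon> * frechet_derivative (n i) (at (fst z)) x * k (fst z)
        - \<epsilon> * n i (fst z) * frechet_derivative k (at (fst z)) x) / (k (fst z) * k (fst z)))) (at (fst z))"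
      using k_pos[of "fst z"] by (intro has_derivative_divide' has_derivative_mult_right
          smooth_on_has_derivative[OF smooth_n] smooth_on_has_derivative[OF smooth_k] zD) simp
    from frechet_derivative_eqI[OF this] frechet_derivative_fst[OF differentiableI[OF this]]
    show ?thesis using k_pos[of "fst z"] by (simp add: field_simps power2_eq_square)
  qed
  have dk': "frechet_derivative (\<lambda>z. \<epsilon> * k (fst z)) (at z) x = \<epsilon> * frechet_derivative k (at (fst z)) (fst x)" for x
    using frechet_derivative_fst[OF differentiableI[OF has_derivative_mult_right[OF smooth_on_has_derivative[OF smooth_k zD]]]]
      frechet_derivative_eqI[OF has_derivative_mult_right[OF smooth_on_has_derivative[OF smooth_k zD]]] by simp
  have pM: "ext_deriv (pull_M (eta G c i)) z v w = ext_deriv (eta G c i) (fst z) (fst v) (fst w)"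
    "ext_deriv (pull_M (\<eta>12 c)) z v w = ext_deriv (\<eta>12 c) (fst z) (fst v) (fst w)" for i
    by (intro ext_deriv_pull_M smooth_form_differentiable[OF smooth_form_eta zD]
        smooth_form_differentiable[OF smooth_\<eta>12 zD])+
  have pE: "ext_deriv (pull_E (om_conn i j)) z v w = ext_deriv (om_conn i j) (snd z) (snd v) (snd w)" for i j
    by (intro ext_deriv_pull_E smooth_form_differentiable[OF smooth_form_om_conn]) simp
  have e1: "ext_deriv (alpha \<epsilon> 1) z v w = ext_deriv (pull_E (om_conn 3 1)) z v w
      - ext_deriv (\<lambda>z w. \<epsilon> * k (fst z) * pull_M (eta G c 2) z w) z v w
      - ext_deriv (\<lambda>z w. \<epsilon> * n 1 (fst z) / k (fst z) * (pull_E (om_conn 1 2) z w - pull_M (\<eta>12 c) z w)) z v w"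
    unfolding alpha_1
    by (subst ext_deriv_diff, (intro diff_forms rules)+)+ (rule refl)
  have e2: "ext_deriv (alpha \<epsilon> 2) z v w = ext_deriv (pull_E (om_conn 3 2)) z v w
      + ext_deriv (\<lambda>z w. \<epsilon> * k (fst z) * pull_M (eta G c 1) z w) z v w
      - ext_deriv (\<lambda>z w. \<epsilon> * n 2 (fst z) / k (fst z) * (pull_E (om_conn 1 2) z w - pull_M (\<eta>12 c) z w)) z v w"
    unfolding alpha_2
    by (subst ext_deriv_diff, (intro diff_forms rules)+, subst ext_deriv_add, (intro diff_forms rules)+) (rule refl)
  have m: "ext_deriv (\<lambda>z w. \<epsilon> * k (fst z) * pull_M (eta G c i) z w) z v w =
      frechet_derivative (\<lambda>z. \<epsilon> * k (fst z)) (at z) v * pull_M (eta G c i) z w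
      - frechet_derivative (\<lambda>z. \<epsilon> * k (fst z)) (at z) w * pull_M (eta G c i) z v
      + \<epsilon> * k (fst z) * ext_deriv (pull_M (eta G c i)) z v w" for i
    by (intro ext_deriv_mult diff_forms smooth_differentiable[OF _ zN] rules)
  have m': "ext_deriv (\<lambda>z w. \<epsilon> * n i (fst z) / k (fst z) * (pull_E (om_conn 1 2) z w - pull_M (\<eta>12 c) z w)) z v w =
      frechet_derivative (\<lambda>z. \<epsilon> * n i (fst z) / k (fst z)) (at z) v * th3 z w
      - frechet_derivative (\<lambda>z. \<epsilon> * n i (fst z) / k (fst z)) (at z) w * th3 z v
      + \<epsilon> * n i (fst z) / k (fst z) *
        (ext_deriv (pull_E (om_conn 1 2)) z v w - ext_deriv (pull_M (\<eta>12 c)) z v w)" for i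
  proof -
    have "ext_deriv (\<lambda>z w. \<epsilon> * n i (fst z) / k (fst z) * (pull_E (om_conn 1 2) z w - pull_M (\<eta>12 c) z w)) z v w =
      frechet_derivative (\<lambda>z. \<epsilon> * n i (fst z) / k (fst z)) (at z) v * (pull_E (om_conn 1 2) z w - pull_M (\<eta>12 c) z w)
      - frechet_derivative (\<lambda>z. \<epsilon> * n i (fst z) / k (fst z)) (at z) w * (pull_E (om_conn 1 2) z v - pull_M (\<eta>12 c) z v)
      + \<epsilon> * n i (fst z) / k (fst z) *
        ext_deriv (\<lambda>z w. pull_E (om_conn 1 2) z w - pull_M (\<eta>12 c) z w) z v w"
      by (intro ext_deriv_mult diff_forms smooth_differentiable[OF _ zN] rules)
    moreover have "ext_deriv (\<lambda>z w. pull_E (om_conn 1 2) z w - pull_M (\<eta>12 c) z w) z v w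
      = ext_deriv (pull_E (om_conn 1 2)) z v w - ext_deriv (pull_M (\<eta>12 c)) z v w"
      by (intro ext_deriv_diff diff_forms rules)
    ultimately show ?thesis by (simp add: pull_E_def pull_M_def th3_def)
  qed
  define \<kappa> where "\<kappa> = k (fst z)"
  have \<kappa>: "\<kappa> > 0" unfolding \<kappa>_def by (rule k_pos)
  \<comment> \<open>These are the coefficients of \<theta>3 in \<open>alpha\<close>. Writing
    \<open>n i\<close> as \<open>\<epsilon> * \<kappa> * p i\<close> clears all quotients, and the
    remaining identities are polynomial.\<close>
  define p where "p i = \<epsilon> * n i (fst z) / \<kappa>" for i
  have n: "n i (fst z) = \<epsilon> * \<kappa> * p i" for i using \<kappa> \<epsilon> by (auto simp: p_def)
  have \<epsilon>2: "\<epsilon> * \<epsilon> = 1" using \<epsilon> by auto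
  let ?e = "\<lambda>i x. eta G c i (fst z) (fst x)" and ?t = "\<lambda>x. \<eta>12 c (fst z) (fst x)"
  let ?P = "\<lambda>x. om_conn 1 2 (snd z) (snd x)" and ?R = "\<lambda>x. om_conn 3 1 (snd z) (snd x)"
    and ?S = "\<lambda>x. om_conn 3 2 (snd z) (snd x)"
  have R: "?R x = \<epsilon> * \<kappa> * ?e 2 x + p 1 * (?P x - ?t x)" "?S x = - \<epsilon> * \<kappa> * ?e 1 x + p 2 * (?P x - ?t x)"
    if "\<And>i. alpha \<epsilon> i z x = 0" for x
    using that[of 1] that[of 2] by (simp_all add: alpha_def form_defs p_def \<kappa>_def)
  have kx: "frechet_derivative (\<lambda>z. \<epsilon> * k (fst z)) (at z) x = - 2 * \<kappa> * \<kappa> * (p 1 * ?e 1 x + p 2 * ?e 2 x)"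
    and p1x: "frechet_derivative (\<lambda>z. \<epsilon> * n 1 (fst z) / k (fst z)) (at z) x =
      - p 2 * ?t x - \<epsilon> * \<kappa> * ?e 1 x - \<epsilon> * \<kappa> * p 1 * (p 1 * ?e 1 x + p 2 * ?e 2 x)"
    and p2x: "frechet_derivative (\<lambda>z. \<epsilon> * n 2 (fst z) / k (fst z)) (at z) x =
      p 1 * ?t x - \<epsilon> * \<kappa> * ?e 2 x - \<epsilon> * \<kappa> * p 2 * (p 1 * ?e 1 x + p 2 * ?e 2 x)"
    if x: "fst x \<in> frame_tangent (G c) (fst z)" for x
    unfolding dp dk' dn[OF zM x] dk[OF zM x] h n conn_def \<kappa>_def[symmetric]
    using \<kappa> \<epsilon> by (auto simp: field_simps power2_eq_square)
  have base: "pull_M \<alpha> z x = \<alpha> (fst z) (fst x)" for \<alpha> x by (simp add: pull_M_def)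
  note vals = m m' pM pE base om_structure[OF zE vE wE] ext_deriv_eta[OF zM vM wM]
    kx[OF vM] kx[OF wM] p1x[OF vM] p1x[OF wM] p2x[OF vM] p2x[OF wM] wedge_def R[OF av] R[OF aw]
  have "ext_deriv (alpha \<epsilon> 1) z v w = 0"
    unfolding e1 vals th3_def \<kappa>_def[symmetric] p_def[symmetric] using \<epsilon>
    by (auto simp: algebra_simps power2_eq_square)
  moreover have "ext_deriv (alpha \<epsilon> 2) z v w = 0"
    unfolding e2 vals th3_def \<kappa>_def[symmetric] p_def[symmetric] using \<epsilon>
    by (auto simp: algebra_simps power2_eq_square)
  ultimately show ?thesis using exhaust_2[of i] by auto
qed

lemma sufficiency:
  assumes \<epsilon>: "\<epsilon> = 1 \<or> \<epsilon> = -1"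
    and target: "\<And>z i j. z \<in> FM G c \<Longrightarrow>
      Q2 i j c z = (if i = j then - 3 * frame_pullback q c z powr (- 1 / 3) else 0)"
  shows "has_transverse_frobenius_subbundle (total_space G c) (total_tangent G c)
    (singular_system G \<eta>12 K \<epsilon> c) (theta G \<eta>12 c)"
  unfolding has_transverse_frobenius_subbundle_def
proof (intro ballI exI[of _ "frame_dom c \<times> UNIV"] exI[of _ "[alpha \<epsilon> 1, alpha \<epsilon> 2]"] conjI)
  show "open (frame_dom c \<times> (UNIV :: 3 frame set))" by (intro open_Times open_frame_dom open_UNIV)
  show "z \<in> frame_dom c \<times> UNIV" if "z \<in> total_space G c" for z
    using that by (auto simp: total_space_def FM_frame_dom)
  show "smooth_form_on (frame_dom c \<times> UNIV) \<alpha>" if "\<alpha> \<in> set [alpha \<epsilon> 1, alpha \<epsilon> 2]" for \<alpha>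
    using that smooth_form_alpha by auto
next
  fix y assume y: "y \<in> total_space G c \<inter> frame_dom c \<times> UNIV"
  then have yM: "fst y \<in> FM G c" and yE: "snd y \<in> FE" by (auto simp: total_space_def)
  have span: "\<beta> \<in> pfaff_span (total_tangent G c) [alpha \<epsilon> 1, alpha \<epsilon> 2] y \<longleftrightarrow>
      (\<exists>a b. \<forall>w\<in>total_tangent G c y. \<beta> w = a * alpha \<epsilon> 1 y w + b * alpha \<epsilon> 2 y w)" for \<beta>
    unfolding pfaff_span_def mem_Collect_eq sum_list_forms
  proof (safe, goal_cases)
    case (1 a)
    then show ?case by (intro exI[of _ "a 0"] exI[of _ "a (Suc 0)"]) simp
  next
    case (2 a b)
    then show ?case by (intro exI[of _ "\<lambda>i. [a, b] ! i"]) simp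
  qed
  \<comment> \<open>Rotations of the Euclidean frame alone, with
    \<open>\<omega>\<^sup>3\<^sub>1 = r\<close> and \<open>\<omega>\<^sup>3\<^sub>2 = s\<close>: the
    forms \<theta> vanish on them while the two \<open>alpha\<close> take the values
    \<open>r\<close> and \<open>s\<close>. This settles independence and transversality
    alike.\<close>
  define R where "R r s = ((0, rigid (0, 0, 0, 0, r, s) (snd y)) :: pt)" for r s
  have R: "R r s \<in> total_tangent G c y" for r s
    unfolding R_def total_tangent_def using zero_tangent[OF yM] rigid_tangent[OF yE] by simp
  have l: "eta G c i (fst y) 0 = 0" "\<eta>12 c (fst y) 0 = 0" for i
    using linear_0[OF linear_eta] linear_0[OF linear_\<eta>12[OF FM_frame_dom[OF yM]]] by auto
  have aR: "alpha \<epsilon> 1 y (R r s) = r" "alpha \<epsilon> 2 y (R r s) = s" for r s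
    unfolding alpha_def form_defs R_def by (simp_all add: om_conn_rigid[OF yE] l)
  have tR: "th0 y (R r s) = 0" "th1 y (R r s) = 0" "th2 y (R r s) = 0" "th3 y (R r s) = 0" for r s
    unfolding form_defs R_def by (simp_all add: om_conn_rigid[OF yE] om_rigid[OF yE] l)
  show "pfaff_independent (total_tangent G c) [alpha \<epsilon> 1, alpha \<epsilon> 2] y"
    unfolding pfaff_independent_def sum_list_forms
  proof (intro allI impI)
    fix a :: "nat \<Rightarrow> real" and i
    assume "\<forall>w\<in>total_tangent G c y. a 0 * alpha \<epsilon> 1 y w + (a (Suc 0) * alpha \<epsilon> 2 y w
      + (\<Sum>i<length []. a (Suc (Suc i)) * ([] ! i) y w)) = 0"
    from bspec[OF this R[of 1 0]] bspec[OF this R[of 0 1]] have "a 0 = 0" "a (Suc 0) = 0"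
      by (simp_all add: aR)
    moreover assume "i < length [alpha \<epsilon> 1, alpha \<epsilon> 2]"
    then have "i = 0 \<or> i = Suc 0" by auto
    ultimately show "a i = 0" by auto
  qed
  show "pfaff_frobenius (total_tangent G c) [alpha \<epsilon> 1, alpha \<epsilon> 2] y"
    unfolding pfaff_frobenius_def
  proof (intro ballI impI)
    fix v w \<alpha>
    assume v: "v \<in> total_tangent G c y" and w: "w \<in> total_tangent G c y"
      and 0: "\<forall>\<beta>\<in>set [alpha \<epsilon> 1, alpha \<epsilon> 2]. \<beta> y v = 0 \<and> \<beta> y w = 0"
      and \<alpha>: "\<alpha> \<in> set [alpha \<epsilon> 1, alpha \<epsilon> 2]"
    have 1: "alpha \<epsilon> i y v = 0" "alpha \<epsilon> i y w = 0" for i :: 2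
      using 0 exhaust_2[of i] by auto
    have "ext_deriv (alpha \<epsilon> i) y v w = 0" for i
      by (rule alpha_frobenius[OF \<epsilon> _ v w target[OF yM, unfolded target_iff] 1]) (use y in blast)
    then show "ext_deriv \<alpha> y v w = 0" using \<alpha> by auto
  qed
  show "pfaff_span (total_tangent G c) [alpha \<epsilon> 1, alpha \<epsilon> 2] y
      \<subseteq> pfaff_span (total_tangent G c) (singular_system G \<eta>12 K \<epsilon> c) y"
  proof
    fix \<beta> assume "\<beta> \<in> pfaff_span (total_tangent G c) [alpha \<epsilon> 1, alpha \<epsilon> 2] y"
    then obtain a b where "\<forall>w\<in>total_tangent G c y. \<beta> w = a * alpha \<epsilon> 1 y w + b * alpha \<epsilon> 2 y w"
      unfolding span by blast
    then show "\<beta> \<in> pfaff_span (total_tangent G c) (singular_system G \<eta>12 K \<epsilon> c) y"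
      unfolding pfaff_span_singular
      by (intro exI[of _ 0] exI[of _ "- a * (\<epsilon> * n 1 (fst y) / k (fst y)) - b * (\<epsilon> * n 2 (fst y) / k (fst y))"]
          exI[of _ a] exI[of _ b]) (simp add: alpha_def algebra_simps)
  qed
  show "\<beta> w = 0" if \<beta>: "\<beta> \<in> pfaff_span (total_tangent G c) [alpha \<epsilon> 1, alpha \<epsilon> 2] y \<inter>
      pfaff_span (total_tangent G c) (theta G \<eta>12 c) y" and w: "w \<in> total_tangent G c y" for \<beta> w
  proof -
    from \<beta> obtain a b c0 c1 c2 c3 where 1: "\<forall>w\<in>total_tangent G c y. \<beta> w = a * alpha \<epsilon> 1 y w + b * alpha \<epsilon> 2 y w"
      and 2: "\<forall>w\<in>total_tangent G c y. \<beta> w = c0 * th0 y w + c1 * th1 y w + c2 * th2 y w + c3 * th3 y w"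
      unfolding Int_iff span pfaff_span_theta by blast
    have "a = 0" "b = 0"
      using bspec[OF 1 R[of 1 0]] bspec[OF 2 R[of 1 0]] bspec[OF 1 R[of 0 1]] bspec[OF 2 R[of 0 1]]
      by (simp_all add: aR tR)
    then show ?thesis using 1 w by simp
  qed
qed simp

end

section \<open>Necessity\<close>

text \<open>For nonzero \<open>n = (n1, n2)\<close>, equations 2 and 3 make \<open>(a, b)\<close>
  equal to \<open>t\<close> times \<open>n\<close>. Then 1 minus 4, together with 2, shows that the
  symmetric matrix with entries \<open>X\<close>, \<open>H\<close>, \<open>Y\<close> is
  \<open>L\<close> times the identity minus \<open>t / (2 * k)\<close> times the tensor square of
  \<open>n\<close>. Contracting 7 and 8 with \<open>n\<close> gives
  \<open>2 * k = t * (k - L)\<close>, contracting 5 and 6 gives \<open>L * (t - 2) = 0\<close>;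
  hence \<open>L = 0\<close> and \<open>t = 2\<close>. For \<open>n = 0\<close>, equations 1, 2 and
  4 force \<open>X\<close>, \<open>Y\<close>, \<open>H\<close> to vanish.\<close>

lemma obstruction_algebra:
  fixes k n1 n2 X Y H a b :: real
  assumes k: "k > 0"
    and 1: "n1\<^sup>2 + n2\<^sup>2 + k * Y + H\<^sup>2 - k * X - X * Y = a * n1"
    and 2: "- 2 * k * H = a * n2"
    and 3: "- 2 * k * H = b * n1"
    and 4: "n1\<^sup>2 + n2\<^sup>2 + k * X + H\<^sup>2 - k * Y - X * Y = b * n2"
    and 5: "- 4 * k * (n2 * H + n1 * X) = a * (X * Y - H\<^sup>2 - k * (X + Y) + n1\<^sup>2 + n2\<^sup>2)"
    and 6: "- 4 * k * (n1 * H + n2 * Y) = b * (X * Y - H\<^sup>2 - k * (X + Y) + n1\<^sup>2 + n2\<^sup>2)"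
    and 7: "2 * k * n1 = a * (k - Y) + b * H"
    and 8: "2 * k * n2 = b * (k - X) + a * H"
  shows "k * X = - n1\<^sup>2" and "k * Y = - n2\<^sup>2" and "k * H = - n1 * n2"
proof -
  have "k * X = - n1\<^sup>2 \<and> k * Y = - n2\<^sup>2 \<and> k * H = - n1 * n2"
  proof (cases "n1 = 0 \<and> n2 = 0")
    case True
    then have "H = 0" using 2 k by simp
    moreover have "k * (X - Y) = 0" using 1 4 True by algebra
    then have "X = Y" using k by simp
    ultimately show ?thesis using 1 True by simp
  next
    case False
    define r where "r = n1\<^sup>2 + n2\<^sup>2"
    have r: "r > 0" unfolding r_def using False by (simp add: sum_power2_gt_zero_iff)
    define t where "t = (a * n1 + b * n2) / r"
    have "r * a = (a * n1 + b * n2) * n1" "r * b = (a * n1 + b * n2) * n2"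
      using 2 3 unfolding r_def by algebra+
    then have ab: "a = t * n1" "b = t * n2" unfolding t_def using r by (simp_all add: field_simps)
    define L where "L = X + t * n1\<^sup>2 / (2 * k)"
    have X: "2 * k * X = 2 * k * L - t * n1\<^sup>2" unfolding L_def using k by (simp add: field_simps)
    have Y: "2 * k * Y = 2 * k * L - t * n2\<^sup>2" using 1 4 X unfolding ab by algebra
    have H: "2 * k * H = - t * n1 * n2" using 2 unfolding ab by algebra
    have "2 * k * r * (2 * k) = 2 * k * r * (t * (k - L))"
      using 7 8 X Y H unfolding ab r_def by algebra
    then have tL: "2 * k = t * (k - L)" using k r by simp
    \<comment> \<open>The sum of 1 and 4 determines \<open>X * Y - H\<^sup>2\<close>, which removes
      the quadratic terms from 5 and 6.\<close>
    have "2 * (r + H\<^sup>2 - X * Y) = t * r" using 1 4 unfolding ab r_def by algebra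
    then have D: "X * Y - H\<^sup>2 - k * (X + Y) + n1\<^sup>2 + n2\<^sup>2 = 2 * r - 2 * k * L"
      using X Y unfolding r_def by algebra
    have "2 * k * (2 * n1 * n2 * H + n1\<^sup>2 * X + n2\<^sup>2 * Y) = 2 * k * L * r - t * r\<^sup>2"
    proof -
      have "2 * k * (2 * n1 * n2 * H + n1\<^sup>2 * X + n2\<^sup>2 * Y) =
          2 * n1 * n2 * (2 * k * H) + n1\<^sup>2 * (2 * k * X) + n2\<^sup>2 * (2 * k * Y)"
        by (simp add: algebra_simps)
      then show ?thesis unfolding X Y H r_def by (simp add: algebra_simps power2_eq_square)
    qed
    moreover have "n1 * (- 4 * k * (n2 * H + n1 * X)) + n2 * (- 4 * k * (n1 * H + n2 * Y)) =
        t * r * (2 * r - 2 * k * L)"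
      unfolding 5 6 D unfolding ab r_def by (simp add: algebra_simps power2_eq_square)
    moreover have "n1 * (- 4 * k * (n2 * H + n1 * X)) + n2 * (- 4 * k * (n1 * H + n2 * Y)) =
        - 2 * (2 * k * (2 * n1 * n2 * H + n1\<^sup>2 * X + n2\<^sup>2 * Y))"
      by (simp add: algebra_simps power2_eq_square)
    ultimately have "r * (2 * k * L * (t - 2)) = 0"
      by (simp add: algebra_simps power2_eq_square)
    then have "L = 0 \<or> t = 2" using r k by auto
    then have "L = 0" "t = 2" using tL k by auto
    with X Y H have "2 * k * X = - 2 * n1\<^sup>2" "2 * k * Y = - 2 * n2\<^sup>2" "2 * k * H = - 2 * n1 * n2"
      by (simp_all only: mult_zero_right diff_0 mult_minus_left)
    then show ?thesis by (intro conjI) linarith+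
  qed
  then show "k * X = - n1\<^sup>2" "k * Y = - n2\<^sup>2" "k * H = - n1 * n2" by auto
qed

section \<open>Vector fields annihilated by a transverse Frobenius subbundle\<close>

locale frobenius_patch = surface_patch +
  fixes \<epsilon> :: real and N :: "pt set" and fs :: "pt form list"
  assumes \<epsilon>: "\<epsilon> = 1 \<or> \<epsilon> = -1" and open_N: "open N"
    and len: "2 \<le> length fs"
    and smooth_fs: "\<And>\<gamma>. \<gamma> \<in> set fs \<Longrightarrow> smooth_form_on N \<gamma>"
    and independent: "\<And>z. z \<in> total_space G c \<inter> N \<Longrightarrow> pfaff_independent (total_tangent G c) fs z"
    and frobenius: "\<And>z. z \<in> total_space G c \<inter> N \<Longrightarrow> pfaff_frobenius (total_tangent G c) fs z"
    and span: "\<And>z. z \<in> total_space G c \<inter> N \<Longrightarrow>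
      pfaff_span (total_tangent G c) fs z \<subseteq> pfaff_span (total_tangent G c) (singular_system G \<eta>12 K \<epsilon> c) z"
    and transverse: "\<And>z \<beta> w. z \<in> total_space G c \<inter> N \<Longrightarrow> \<beta> \<in> pfaff_span (total_tangent G c) fs z \<Longrightarrow>
      \<beta> \<in> pfaff_span (total_tangent G c) (theta G \<eta>12 c) z \<Longrightarrow> w \<in> total_tangent G c z \<Longrightarrow> \<beta> w = 0"
begin

text \<open>The motion depends on the point of the surface bundle but not on the Euclidean frame.
  This shape is preserved by brackets.\<close>

definition field :: "(2 frame \<Rightarrow> 2 frame) \<Rightarrow> (2 frame \<Rightarrow> motion) \<Rightarrow> pt \<Rightarrow> pt" where
  "field V m z = (V (fst z), rigid (m (fst z)) (snd z))"

definition kills :: "(2 frame \<Rightarrow> 2 frame) \<Rightarrow> (2 frame \<Rightarrow> motion) \<Rightarrow> bool" where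
  "kills V m \<longleftrightarrow> (\<forall>\<gamma>\<in>set fs. \<forall>z\<in>total_space G c \<inter> N. \<gamma> z (field V m z) = 0)"

lemma field_has_derivative:
  assumes "(V has_derivative V') (at (fst z))" "(m has_derivative m') (at (fst z))"
  shows "(field V m has_derivative (\<lambda>w. (V' (fst w), rigid (m (fst z)) (snd w) + rigid (m' (fst w)) (snd z)))) (at z)"
proof -
  have f: "((\<lambda>z. f (fst z)) has_derivative (\<lambda>w. f' (fst w))) (at z)"
    if "(f has_derivative f') (at (fst z))" for f :: "2 frame \<Rightarrow> 'b::real_normed_vector" and f'
    by (rule has_derivative_compose[OF bounded_linear_imp_has_derivative[OF bounded_linear_fst] that])
  show ?thesis unfolding field_def[abs_def]
    by (intro has_derivative_Pair f assms bounded_bilinear.FDERIV[OF rigid_bilinear]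
        bounded_linear_imp_has_derivative[OF bounded_linear_snd])
qed

lemma field_tangent:
  assumes "z \<in> total_space G c" "B \<in> frame_tangent (G c) (fst z)"
  shows "(B, rigid m (snd z)) \<in> total_tangent G c z"
  using assms rigid_tangent[of "snd z" m] unfolding total_tangent_def total_space_def
  by (simp add: mem_Times_iff)

lemma field_tangential:
  assumes "z \<in> total_space G c" "B \<in> frame_tangent (G c) (fst z)"
  shows "tangential (total_space G c) z (B, rigid m (snd z))"
  using assms tangential_Pair[OF FM_tangential[of "fst z" B] rigid_tangential[of "snd z" m]]
  unfolding total_space_def by (simp add: mem_Times_iff)

text \<open>By the Frobenius condition \<open>ext_deriv \<gamma>\<close> vanishes on two annihilated
  fields, so \<open>form_bracket\<close> with both constants 0 annihilates their bracket. Its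
  Euclidean component consists of the derivatives of the coefficients along \<open>V\<close> and
  \<open>W\<close> and the commutator of the motions.\<close>

lemma bracket:
  assumes z: "z \<in> total_space G c \<inter> N" and \<gamma>: "\<gamma> \<in> set fs"
    and V: "(V has_derivative V') (at (fst z))" "V (fst z) \<in> frame_tangent (G c) (fst z)"
    and W: "(W has_derivative W') (at (fst z))" "W (fst z) \<in> frame_tangent (G c) (fst z)"
    and m: "(m has_derivative m') (at (fst z))" and l: "(l has_derivative l') (at (fst z))"
    and kV: "kills V m" and kW: "kills W l"
  shows "\<gamma> z (W' (V (fst z)) - V' (W (fst z)),
    rigid (l' (V (fst z)) - m' (W (fst z)) + comm (m (fst z)) (l (fst z))) (snd z)) = 0"
proof -
  let ?S = "total_space G c"
  have zS: "z \<in> ?S" and zN: "z \<in> N" using z by auto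
  have vanish: "\<forall>\<^sub>F y in nhds z. y \<in> ?S \<longrightarrow> \<gamma> y (field X r y) = 0" if "kills X r" for X r
    using eventually_nhds_in_open[OF open_N zN] that \<gamma> unfolding kills_def by (auto elim: eventually_mono)
  have tV: "field V m z \<in> total_tangent G c z" and tW: "field W l z \<in> total_tangent G c z"
    unfolding field_def by (rule field_tangent[OF zS V(2)], rule field_tangent[OF zS W(2)])
  have "\<forall>\<beta>\<in>set fs. \<beta> z (field V m z) = 0 \<and> \<beta> z (field W l z) = 0"
    using kV kW z unfolding kills_def by blast
  then have "ext_deriv \<gamma> z (field V m z) (field W l z) = 0"
    using frobenius[OF z] tV tW \<gamma> unfolding pfaff_frobenius_def by blast
  moreover have "tangential ?S z (field V m z)" "tangential ?S z (field W l z)"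
    unfolding field_def by (rule field_tangential[OF zS V(2)], rule field_tangential[OF zS W(2)])
  ultimately have "\<gamma> z ((\<lambda>w. (W' (fst w), rigid (l (fst z)) (snd w) + rigid (l' (fst w)) (snd z))) (field V m z)
      - (\<lambda>w. (V' (fst w), rigid (m (fst z)) (snd w) + rigid (m' (fst w)) (snd z))) (field W l z)) = 0"
    using form_bracket[OF smooth_form_eventually_linear[OF smooth_fs[OF \<gamma>] open_N zN]
        smooth_form_differentiable[OF smooth_fs[OF \<gamma>] zN] field_has_derivative[OF V(1) m] _
        field_has_derivative[OF W(1) l] _ vanish[OF kV] vanish[OF kW]] by simp
  moreover have "(\<lambda>w. (W' (fst w), rigid (l (fst z)) (snd w) + rigid (l' (fst w)) (snd z))) (field V m z)
      - (\<lambda>w. (V' (fst w), rigid (m (fst z)) (snd w) + rigid (m' (fst w)) (snd z))) (field W l z)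
    = (W' (V (fst z)) - V' (W (fst z)),
       rigid (l' (V (fst z)) - m' (W (fst z)) + comm (m (fst z)) (l (fst z))) (snd z))"
    using rigid_commutator[of "l (fst z)" "m (fst z)" "snd z"]
    by (simp add: field_def bounded_bilinear.add_left[OF rigid_bilinear]
        bounded_bilinear.diff_left[OF rigid_bilinear] algebra_simps)
  ultimately show ?thesis by simp
qed

text \<open>The second field has no surface component, so the derivative of the horizontal field
  drops out and the bracket is again purely Euclidean.\<close>

lemma bracket_horiz_vertical:
  assumes z: "z \<in> total_space G c \<inter> N"
    and m: "(m has_derivative m') (at (fst z))" and l: "(l has_derivative l') (at (fst z))"
    and kV: "kills (horiz i) m" and kW: "kills (\<lambda>_. 0) l"
  shows "\<forall>\<gamma>\<in>set fs. \<gamma> z (0, rigid (l' (horiz i (fst z)) + comm (m (fst z)) (l (fst z))) (snd z)) = 0"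
proof -
  have zM: "fst z \<in> FM G c" using z by (auto simp: total_space_def)
  obtain V' where V': "(horiz i has_derivative V') (at (fst z))"
    using horiz_differentiable[OF FM_frame_dom[OF zM]] unfolding differentiable_def by blast
  have "V' 0 = 0" "m' 0 = 0" using V' m by (simp_all add: linear_0 has_derivative_linear)
  then show ?thesis
    using bracket[OF z _ V' horiz_tangent[OF zM] has_derivative_const zero_tangent[OF zM] m l kV kW] by simp
qed

lemma bracket_vertical:
  assumes z: "z \<in> total_space G c \<inter> N"
    and m: "(m has_derivative m') (at (fst z))" and l: "(l has_derivative l') (at (fst z))"
    and kV: "kills (\<lambda>_. 0) m" and kW: "kills (\<lambda>_. 0) l"
  shows "\<forall>\<gamma>\<in>set fs. \<gamma> z (0, rigid (comm (m (fst z)) (l (fst z))) (snd z)) = 0"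
proof -
  have zM: "fst z \<in> FM G c" using z by (auto simp: total_space_def)
  have "l' 0 = 0" "m' 0 = 0" using l m by (simp_all add: linear_0 has_derivative_linear)
  then show ?thesis
    using bracket[OF z _ has_derivative_const zero_tangent[OF zM] has_derivative_const zero_tangent[OF zM] m l kV kW]
    by simp
qed

section \<open>Normal form of the subbundle\<close>

lemma lincomb_in_span:
  assumes "i < length fs" "j < length fs" "i \<noteq> j"
  shows "(\<lambda>w. a * (fs ! i) z w + b * (fs ! j) z w) \<in> pfaff_span T fs z"
  unfolding pfaff_span_def mem_Collect_eq
proof (intro exI ballI)
  fix w
  have "(\<Sum>l<length fs. (if l = i then a else if l = j then b else 0) * (fs ! l) z w)
      = (\<Sum>l<length fs. (if l = i then a * (fs ! l) z w else 0) + (if l = j then b * (fs ! l) z w else 0))"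
    using assms(3) by (intro sum.cong) auto
  then show "a * (fs ! i) z w + b * (fs ! j) z w
      = (\<Sum>l<length fs. (if l = i then a else if l = j then b else 0) * (fs ! l) z w)"
    using assms by (simp add: sum.distrib)
qed

lemma in_span:
  assumes "\<gamma> \<in> set fs" shows "\<gamma> z \<in> pfaff_span T fs z"
proof -
  obtain i where i: "i < length fs" "\<gamma> = fs ! i" using assms by (metis in_set_conv_nth)
  \<comment> \<open>A second index with coefficient 0 brings a single form under
    \<open>lincomb_in_span\<close>; it exists because the list has at least two entries.\<close>
  define j where "j = (if i = 0 then 1 else 0 :: nat)"
  have "j < length fs" "j \<noteq> i" using len by (auto simp: j_def)
  with lincomb_in_span[of i j 1 z 0] i show ?thesis by simp
qed

text \<open>The same coefficients are recorded twice: as an expansion in forms, for comparison with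
  the span of \<theta>, and as values on left-invariant motions, for the bracket
  computations.\<close>

lemma coefficients:
  assumes z: "z \<in> total_space G c \<inter> N" and \<gamma>: "\<gamma> \<in> pfaff_span (total_tangent G c) fs z"
  shows "\<exists>c0 c1 c2 c3 m1 m2.
    (\<forall>w\<in>total_tangent G c z. \<gamma> w = c0 * th0 z w + c1 * th1 z w + c2 * th2 z w + c3 * th3 z w
      + m1 * pi1 \<epsilon> z w + m2 * pi2 \<epsilon> z w) \<and>
    (\<forall>B\<in>frame_tangent (G c) (fst z). \<forall>t1 t2 t3 p r s. \<gamma> (B, rigid (t1, t2, t3, p, r, s) (snd z)) =
      c0 * t3 + c1 * (t1 - eta G c 1 (fst z) B) + c2 * (t2 - eta G c 2 (fst z) B) + c3 * (p - \<eta>12 c (fst z) B)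
      + m1 * (r - \<epsilon> * k (fst z) * eta G c 2 (fst z) B) + m2 * (s + \<epsilon> * k (fst z) * eta G c 1 (fst z) B))"
proof -
  obtain c0 c1 c2 c3 m1 m2 where
    1: "\<forall>w\<in>total_tangent G c z. \<gamma> w = c0 * th0 z w + c1 * th1 z w + c2 * th2 z w + c3 * th3 z w
      + m1 * pi1 \<epsilon> z w + m2 * pi2 \<epsilon> z w"
    using subsetD[OF span[OF z] \<gamma>] unfolding pfaff_span_singular by blast
  have zS: "z \<in> total_space G c" and zE: "snd z \<in> FE" using z by (auto simp: total_space_def)
  show ?thesis
    by (intro exI conjI, rule 1)
      (simp add: bspec[OF 1 field_tangent[OF zS]] form_defs om_rigid[OF zE] om_conn_rigid[OF zE])
qed

lemma vertical_value:
  assumes z: "z \<in> total_space G c \<inter> N" and \<gamma>: "\<gamma> \<in> set fs"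
  shows "\<exists>c0 c1 c2 c3 m1 m2.
    (\<forall>w\<in>total_tangent G c z. \<gamma> z w = c0 * th0 z w + c1 * th1 z w + c2 * th2 z w + c3 * th3 z w
      + m1 * pi1 \<epsilon> z w + m2 * pi2 \<epsilon> z w) \<and>
    (\<forall>t1 t2 t3 p r s. \<gamma> z (0, rigid (t1, t2, t3, p, r, s) (snd z)) =
      c0 * t3 + c1 * t1 + c2 * t2 + c3 * p + m1 * r + m2 * s)"
proof -
  have x: "fst z \<in> FM G c" using z by (auto simp: total_space_def)
  note l = linear_0[OF linear_eta] linear_0[OF linear_\<eta>12[OF FM_frame_dom[OF x]]]
  obtain c0 c1 c2 c3 m1 m2 where
    1: "\<forall>w\<in>total_tangent G c z. \<gamma> z w = c0 * th0 z w + c1 * th1 z w + c2 * th2 z w + c3 * th3 z w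
      + m1 * pi1 \<epsilon> z w + m2 * pi2 \<epsilon> z w" and
    2: "(\<forall>B\<in>frame_tangent (G c) (fst z). \<forall>t1 t2 t3 p r s. \<gamma> z (B, rigid (t1, t2, t3, p, r, s) (snd z)) =
      c0 * t3 + c1 * (t1 - eta G c 1 (fst z) B) + c2 * (t2 - eta G c 2 (fst z) B) + c3 * (p - \<eta>12 c (fst z) B)
      + m1 * (r - \<epsilon> * k (fst z) * eta G c 2 (fst z) B) + m2 * (s + \<epsilon> * k (fst z) * eta G c 1 (fst z) B))"
    using coefficients[OF z in_span[OF \<gamma>]] by blast
  show ?thesis
    by (intro exI conjI, rule 1) (simp add: bspec[OF 2 zero_tangent[OF x]] l)
qed

text \<open>A combination of two frame forms without \<pi> part lies in the span of \<theta>, so it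
  vanishes by transversality and is trivial by independence. Hence the \<pi> parts have nonzero
  determinant, and Cramer's rule normalises the two forms to \<open>\<pi>\<^sub>1\<close> and
  \<open>\<pi>\<^sub>2\<close> plus combinations of \<theta>.\<close>

lemma vertical_coefficients:
  assumes z: "z \<in> total_space G c \<inter> N"
  shows "\<exists>a0 a1 a2 a3 b0 b1 b2 b3. \<forall>t1 t2 t3 p r s.
    (\<forall>\<gamma>\<in>set fs. \<gamma> z (0, rigid (t1, t2, t3, p, r, s) (snd z)) = 0) \<longrightarrow>
    a0 * t3 + a1 * t1 + a2 * t2 + a3 * p + r = 0 \<and> b0 * t3 + b1 * t1 + b2 * t2 + b3 * p + s = 0"
proof -
  have i: "0 < length fs" "1 < length fs" using len by auto
  obtain c0 c1 c2 c3 m1 m2 where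
    c: "\<forall>w\<in>total_tangent G c z. (fs ! 0) z w = c0 * th0 z w + c1 * th1 z w + c2 * th2 z w + c3 * th3 z w
      + m1 * pi1 \<epsilon> z w + m2 * pi2 \<epsilon> z w" and
    cr: "\<forall>t1 t2 t3 p r s. (fs ! 0) z (0, rigid (t1, t2, t3, p, r, s) (snd z)) =
      c0 * t3 + c1 * t1 + c2 * t2 + c3 * p + m1 * r + m2 * s"
    using vertical_value[OF z nth_mem[OF i(1)]] by blast
  obtain d0 d1 d2 d3 l1 l2 where
    d: "\<forall>w\<in>total_tangent G c z. (fs ! 1) z w = d0 * th0 z w + d1 * th1 z w + d2 * th2 z w + d3 * th3 z w
      + l1 * pi1 \<epsilon> z w + l2 * pi2 \<epsilon> z w" and
    dr: "\<forall>t1 t2 t3 p r s. (fs ! 1) z (0, rigid (t1, t2, t3, p, r, s) (snd z)) =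
      d0 * t3 + d1 * t1 + d2 * t2 + d3 * p + l1 * r + l2 * s"
    using vertical_value[OF z nth_mem[OF i(2)]] by blast
  have degenerate: "a = 0 \<and> b = 0" if "a * m1 + b * l1 = 0" "a * m2 + b * l2 = 0" for a b
  proof -
    let ?\<beta> = "\<lambda>w. a * (fs ! 0) z w + b * (fs ! 1) z w"
    have "?\<beta> w = (a * c0 + b * d0) * th0 z w + (a * c1 + b * d1) * th1 z w
        + (a * c2 + b * d2) * th2 z w + (a * c3 + b * d3) * th3 z w" if w: "w \<in> total_tangent G c z" for w
    proof -
      have "?\<beta> w = (a * c0 + b * d0) * th0 z w + (a * c1 + b * d1) * th1 z w
        + (a * c2 + b * d2) * th2 z w + (a * c3 + b * d3) * th3 z w
        + (a * m1 + b * l1) * pi1 \<epsilon> z w + (a * m2 + b * l2) * pi2 \<epsilon> z w"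
        unfolding bspec[OF c w] bspec[OF d w] by (simp add: algebra_simps)
      then show ?thesis using \<open>a * m1 + b * l1 = 0\<close> \<open>a * m2 + b * l2 = 0\<close> by simp
    qed
    then have "?\<beta> \<in> pfaff_span (total_tangent G c) (theta G \<eta>12 c) z"
      unfolding pfaff_span_theta by blast
    then have zero: "?\<beta> w = 0" if "w \<in> total_tangent G c z" for w
      using transverse[OF z lincomb_in_span[OF i]] that by simp
    let ?a = "\<lambda>l::nat. if l = 0 then a else if l = 1 then b else 0"
    have "(\<Sum>l<length fs. ?a l * (fs ! l) z w) = ?\<beta> w" for w
    proof -
      have "(\<Sum>l<length fs. ?a l * (fs ! l) z w)
        = (\<Sum>l<length fs. (if l = 0 then a * (fs ! l) z w else 0) + (if l = 1 then b * (fs ! l) z w else 0))"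
        by (intro sum.cong) auto
      then show ?thesis using i by (simp add: sum.distrib)
    qed
    then have "\<forall>l<length fs. ?a l = 0"
      using independent[OF z, unfolded pfaff_independent_def, rule_format, of ?a] zero by simp
    then show ?thesis using i by (metis zero_neq_one)
  qed
  define D where "D = m1 * l2 - m2 * l1"
  have D: "D \<noteq> 0"
  proof
    assume "D = 0"
    then have "m1 * l2 = m2 * l1" unfolding D_def by simp
    \<comment> \<open>With zero determinant, the pairs \<open>(l1, - m1)\<close> and
      \<open>(l2, - m2)\<close> are relations between the \<pi> parts, so \<open>degenerate\<close>
      makes their entries zero; the pair \<open>(1, 0)\<close> then becomes a forbidden
      relation.\<close>
    then have "m1 = 0" "m2 = 0"
      using degenerate[of l1 "- m1"] degenerate[of l2 "- m2"] by (simp_all add: mult.commute)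
    then show False using degenerate[of 1 0] by simp
  qed
  show ?thesis
  proof (rule exI[of _ "(l2 * c0 - m2 * d0) / D"], rule exI[of _ "(l2 * c1 - m2 * d1) / D"],
      rule exI[of _ "(l2 * c2 - m2 * d2) / D"], rule exI[of _ "(l2 * c3 - m2 * d3) / D"],
      rule exI[of _ "(m1 * d0 - l1 * c0) / D"], rule exI[of _ "(m1 * d1 - l1 * c1) / D"],
      rule exI[of _ "(m1 * d2 - l1 * c2) / D"], rule exI[of _ "(m1 * d3 - l1 * c3) / D"], intro allI impI)
    fix t1 t2 t3 p r s :: real
    assume "\<forall>\<gamma>\<in>set fs. \<gamma> z (0, rigid (t1, t2, t3, p, r, s) (snd z)) = 0"
    then have *: "c0 * t3 + c1 * t1 + c2 * t2 + c3 * p + m1 * r + m2 * s = 0"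
      "d0 * t3 + d1 * t1 + d2 * t2 + d3 * p + l1 * r + l2 * s = 0"
      using nth_mem[OF i(1)] nth_mem[OF i(2)] cr dr by auto
    have "(l2 * c0 - m2 * d0) * t3 + (l2 * c1 - m2 * d1) * t1 + (l2 * c2 - m2 * d2) * t2 + (l2 * c3 - m2 * d3) * p + D * r = 0"
      "(m1 * d0 - l1 * c0) * t3 + (m1 * d1 - l1 * c1) * t1 + (m1 * d2 - l1 * c2) * t2 + (m1 * d3 - l1 * c3) * p + D * s = 0"
      using * unfolding D_def by algebra+
    moreover have "A / D * t3 + B / D * t1 + C / D * t2 + E / D * p + x = 0"
      if "A * t3 + B * t1 + C * t2 + E * p + D * x = 0" for A B C E x
    proof -
      have "A / D * t3 + B / D * t1 + C / D * t2 + E / D * p + x = (A * t3 + B * t1 + C * t2 + E * p + D * x) / D"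
        using D by (simp add: add_divide_distrib)
      then show ?thesis using that by simp
    qed
    ultimately show "(l2 * c0 - m2 * d0) / D * t3 + (l2 * c1 - m2 * d1) / D * t1 + (l2 * c2 - m2 * d2) / D * t2 + (l2 * c3 - m2 * d3) / D * p + r = 0 \<and>
      (m1 * d0 - l1 * c0) / D * t3 + (m1 * d1 - l1 * c1) / D * t1 + (m1 * d2 - l1 * c2) / D * t2 + (m1 * d3 - l1 * c3) / D * p + s = 0"
      by blast
  qed
qed


text \<open>The vertical fields \<open>mU\<close>, \<open>mA1\<close> and \<open>mA2\<close> are, modulo the annihilator of \<open>V\<^sub>\<epsilon>\<close> and up to factors, the
  brackets \<open>[Z1, Z2]\<close>, \<open>[Z2, U]\<close> and \<open>[Z1, U]\<close>.\<close>

definition fH :: "2 frame \<Rightarrow> real" where "fH x = \<epsilon> * h 1 2 x * (1 / k x) / 2"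
definition fX :: "2 frame \<Rightarrow> real" where "fX x = \<epsilon> * (k x * k x + h 1 1 x) * (1 / k x) / 2"
definition fY :: "2 frame \<Rightarrow> real" where "fY x = \<epsilon> * (k x * k x + h 2 2 x) * (1 / k x) / 2"

definition mZ1 :: "2 frame \<Rightarrow> motion" where "mZ1 x = (1, 0, 0, 0, 0, - \<epsilon> * k x)"
definition mZ2 :: "2 frame \<Rightarrow> motion" where "mZ2 x = (0, 1, 0, 0, \<epsilon> * k x, 0)"
definition mU :: "2 frame \<Rightarrow> motion" where "mU x = (0, 0, 1, \<epsilon> * k x, n 1 x, n 2 x)"
definition mA1 :: "2 frame \<Rightarrow> motion" where "mA1 x = (1, 0, 0, n 2 x, - fH x, - fY x)"
definition mA2 :: "2 frame \<Rightarrow> motion" where "mA2 x = (0, 1, 0, - n 1 x, fX x, fH x)"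

lemma smooth_f: "smooth_on (frame_dom c) fH" "smooth_on (frame_dom c) fX" "smooth_on (frame_dom c) fY"
proof -
  have half: "smooth_on (frame_dom c) (\<lambda>x. f x / 2)" if "smooth_on (frame_dom c) f" for f :: "2 frame \<Rightarrow> real"
    using smooth_on_mult[OF open_frame_dom that smooth_on_const[OF open_frame_dom, of "1/2"]] by simp
  show "smooth_on (frame_dom c) fH" "smooth_on (frame_dom c) fX" "smooth_on (frame_dom c) fY"
    unfolding fH_def[abs_def] fX_def[abs_def] fY_def[abs_def]
    by (intro half smooth_on_mult smooth_on_add smooth_inverse_k smooth_h smooth_k smooth_on_const open_frame_dom)+
qed

lemma field_derivatives:
  assumes "x \<in> FM G c"
  shows "(mZ1 has_derivative (\<lambda>w. (0, 0, 0, 0, 0, - \<epsilon> * frechet_derivative k (at x) w))) (at x)"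
    and "(mZ2 has_derivative (\<lambda>w. (0, 0, 0, 0, \<epsilon> * frechet_derivative k (at x) w, 0))) (at x)"
    and "(mU has_derivative (\<lambda>w. (0, 0, 0, \<epsilon> * frechet_derivative k (at x) w,
      frechet_derivative (n 1) (at x) w, frechet_derivative (n 2) (at x) w))) (at x)"
    and "(mA1 has_derivative (\<lambda>w. (0, 0, 0, frechet_derivative (n 2) (at x) w,
      - frechet_derivative fH (at x) w, - frechet_derivative fY (at x) w))) (at x)"
    and "(mA2 has_derivative (\<lambda>w. (0, 0, 0, - frechet_derivative (n 1) (at x) w,
      frechet_derivative fX (at x) w, frechet_derivative fH (at x) w))) (at x)"
  unfolding mZ1_def[abs_def] mZ2_def[abs_def] mU_def[abs_def] mA1_def[abs_def] mA2_def[abs_def]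
  by (intro has_derivative_Pair has_derivative_const has_derivative_mult_right has_derivative_minus
      smooth_on_has_derivative[OF smooth_k] smooth_on_has_derivative[OF smooth_n]
      smooth_on_has_derivative[OF smooth_f(1)] smooth_on_has_derivative[OF smooth_f(2)]
      smooth_on_has_derivative[OF smooth_f(3)] FM_frame_dom assms)+

text \<open>Over a horizontal field the equations \<theta> = 0 and \<pi> = 0 determine the motion
  uniquely; \<open>mZ1\<close> and \<open>mZ2\<close> are these solutions.\<close>

lemma kills_Z: "kills (horiz 1) mZ1" "kills (horiz 2) mZ2"
proof -
  have "\<gamma> z (field (horiz 1) mZ1 z) = 0 \<and> \<gamma> z (field (horiz 2) mZ2 z) = 0"
    if z: "z \<in> total_space G c \<inter> N" and \<gamma>: "\<gamma> \<in> set fs" for \<gamma> z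
  proof -
    have x: "fst z \<in> FM G c" using z by (auto simp: total_space_def)
    obtain c0 c1 c2 c3 m1 m2 where 1: "\<forall>B\<in>frame_tangent (G c) (fst z). \<forall>t1 t2 t3 p r s. \<gamma> z (B, rigid (t1, t2, t3, p, r, s) (snd z)) =
      c0 * t3 + c1 * (t1 - eta G c 1 (fst z) B) + c2 * (t2 - eta G c 2 (fst z) B) + c3 * (p - \<eta>12 c (fst z) B)
      + m1 * (r - \<epsilon> * k (fst z) * eta G c 2 (fst z) B) + m2 * (s + \<epsilon> * k (fst z) * eta G c 1 (fst z) B)"
      using coefficients[OF z in_span[OF \<gamma>]] by blast
    from bspec[OF 1 horiz_tangent[OF x]] show ?thesis
      by (simp add: field_def mZ1_def mZ2_def eta_horiz[OF x] \<eta>12_horiz[OF x])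
  qed
  then show "kills (horiz 1) mZ1" "kills (horiz 2) mZ2" unfolding kills_def by blast+
qed

lemma \<epsilon>2: "\<epsilon> * \<epsilon> = 1" using \<epsilon> by auto

lemma kills_U: "kills (\<lambda>_. 0) mU"
  unfolding kills_def
proof (intro ballI)
  fix \<gamma> z assume \<gamma>: "\<gamma> \<in> set fs" and z: "z \<in> total_space G c \<inter> N"
  have x: "fst z \<in> FM G c" using z by (auto simp: total_space_def)
  obtain V' W' where V': "(horiz 1 has_derivative V') (at (fst z))" and W': "(horiz 2 has_derivative W') (at (fst z))"
    using horiz_differentiable[OF FM_frame_dom[OF x]] unfolding differentiable_def by blast
  obtain c0 c1 c2 c3 m1 m2 where c: "\<forall>B\<in>frame_tangent (G c) (fst z). \<forall>t1 t2 t3 p r s. \<gamma> z (B, rigid (t1, t2, t3, p, r, s) (snd z)) =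
      c0 * t3 + c1 * (t1 - eta G c 1 (fst z) B) + c2 * (t2 - eta G c 2 (fst z) B) + c3 * (p - \<eta>12 c (fst z) B)
      + m1 * (r - \<epsilon> * k (fst z) * eta G c 2 (fst z) B) + m2 * (s + \<epsilon> * k (fst z) * eta G c 1 (fst z) B)"
    using coefficients[OF z in_span[OF \<gamma>]] by blast
  note B = horiz_bracket[OF x V' W']
  \<comment> \<open>The commutator and the curvature of the surface bundle each contribute
    \<open>- k\<^sup>2\<close> to \<open>\<theta>\<^sub>3\<close>, the coefficients of
    \<open>m1\<close> and \<open>m2\<close> come from \<open>dk\<close>, and
    \<open>- 2 * \<epsilon> * k\<close> is the common factor that leaves \<open>mU\<close>.\<close>
  have "- 2 * \<epsilon> * k (fst z) * (c0 + c3 * (\<epsilon> * k (fst z)) + m1 * n 1 (fst z) + m2 * n 2 (fst z)) = 0"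
    using bracket[OF z \<gamma> V' horiz_tangent[OF x] W' horiz_tangent[OF x] field_derivatives(1)[OF x]
        field_derivatives(2)[OF x] kills_Z] \<epsilon>
    by (auto simp: mZ1_def mZ2_def comm_def bspec[OF c B(1)] B(2,3) dk_horiz[OF x] K_eq algebra_simps power2_eq_square)
  then show "\<gamma> z (field (\<lambda>_. 0) mU z) = 0"
    using k_pos[of "fst z"] \<epsilon> bspec[OF c zero_tangent[OF x]] linear_0[OF linear_eta]
      linear_0[OF linear_\<eta>12[OF FM_frame_dom[OF x]]]
    by (auto simp: field_def mU_def)
qed

lemma kills_A: "kills (\<lambda>_. 0) mA1" "kills (\<lambda>_. 0) mA2"
proof -
  have "\<gamma> z (field (\<lambda>_. 0) mA1 z) = 0 \<and> \<gamma> z (field (\<lambda>_. 0) mA2 z) = 0"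
    if z: "z \<in> total_space G c \<inter> N" and \<gamma>: "\<gamma> \<in> set fs" for \<gamma> z
  proof -
    have x: "fst z \<in> FM G c" using z by (auto simp: total_space_def)
    obtain c0 c1 c2 c3 m1 m2 where c: "\<forall>t1 t2 t3 p r s. \<gamma> z (0, rigid (t1, t2, t3, p, r, s) (snd z)) =
        c0 * t3 + c1 * t1 + c2 * t2 + c3 * p + m1 * r + m2 * s"
      using vertical_value[OF z \<gamma>] by blast
    let ?k = "k (fst z)" and ?n = "\<lambda>i. n i (fst z)" and ?h = "\<lambda>i j. h i j (fst z)"
    have U: "c0 + c3 * (\<epsilon> * ?k) + m1 * ?n 1 + m2 * ?n 2 = 0"
      using kills_U z \<gamma> unfolding kills_def by (force simp: field_def mU_def c)
    have "2 * \<epsilon> * ?k * c2 - ?n 1 * c0 - 3 * \<epsilon> * ?k * ?n 1 * c3 + m1 * (?k\<^sup>2 + ?h 1 1 - (?n 1)\<^sup>2)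
        + m2 * (?h 2 1 - ?n 1 * ?n 2) = 0"
      using bspec[OF bracket_horiz_vertical[OF z field_derivatives(1)[OF x] field_derivatives(3)[OF x] kills_Z(1) kills_U] \<gamma>] \<epsilon>
      by (auto simp: mZ1_def mU_def comm_def c dk_horiz[OF x] dn_horiz[OF x] algebra_simps power2_eq_square)
    \<comment> \<open>Adding \<open>n 1\<close> times \<open>U\<close> to the relation from the
      bracket of \<open>mZ1\<close> and \<open>mU\<close> removes \<open>c0\<close> and the products
      of the \<open>n i\<close>, which is why \<open>h\<close> absorbs such a product.\<close>
    then have 2: "2 * ?k * c2 - 2 * ?k * ?n 1 * c3 + \<epsilon> * m1 * (?k\<^sup>2 + ?h 1 1) + \<epsilon> * m2 * ?h 1 2 = 0"
      using U \<epsilon>2 unfolding h_sym[OF x] by algebra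
    have "- 2 * \<epsilon> * ?k * c1 - ?n 2 * c0 - 3 * \<epsilon> * ?k * ?n 2 * c3 + m1 * (?h 1 2 - ?n 1 * ?n 2)
        + m2 * (?k\<^sup>2 + ?h 2 2 - (?n 2)\<^sup>2) = 0"
      using bspec[OF bracket_horiz_vertical[OF z field_derivatives(2)[OF x] field_derivatives(3)[OF x] kills_Z(2) kills_U] \<gamma>] \<epsilon>
      by (auto simp: mZ2_def mU_def comm_def c dk_horiz[OF x] dn_horiz[OF x] algebra_simps power2_eq_square)
    then have 1: "- 2 * ?k * c1 - 2 * ?k * ?n 2 * c3 + \<epsilon> * m1 * ?h 1 2 + \<epsilon> * m2 * (?k\<^sup>2 + ?h 2 2) = 0"
      using U \<epsilon>2 by algebra
    have "2 * ?k * (c1 + c3 * ?n 2 - m1 * fH (fst z) - m2 * fY (fst z)) = 0"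
      "2 * ?k * (c2 - c3 * ?n 1 + m1 * fX (fst z) + m2 * fH (fst z)) = 0"
    proof -
      have "2 * ?k * fH (fst z) = \<epsilon> * ?h 1 2" "2 * ?k * fX (fst z) = \<epsilon> * (?k\<^sup>2 + ?h 1 1)"
        "2 * ?k * fY (fst z) = \<epsilon> * (?k\<^sup>2 + ?h 2 2)"
        using k_pos[of "fst z"] by (simp_all add: fH_def fX_def fY_def power2_eq_square)
      then show "2 * ?k * (c1 + c3 * ?n 2 - m1 * fH (fst z) - m2 * fY (fst z)) = 0"
        "2 * ?k * (c2 - c3 * ?n 1 + m1 * fX (fst z) + m2 * fH (fst z)) = 0"
        using 1 2 by algebra+
    qed
    then show ?thesis using k_pos[of "fst z"] by (simp add: field_def mA1_def mA2_def c)
  qed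
  then show "kills (\<lambda>_. 0) mA1" "kills (\<lambda>_. 0) mA2" unfolding kills_def by blast+
qed

text \<open>The slopes are \<open>a3\<close> and \<open>b3\<close>, the coefficients of
  \<open>\<theta>\<^sub>3\<close> in the two normalised forms. Vanishing on \<open>mU\<close>,
  \<open>mA1\<close> and \<open>mA2\<close> expresses the other coefficients through them, and the
  third round of brackets supplies the constraints.\<close>

lemma necessity:
  assumes z: "z \<in> total_space G c \<inter> N"
  shows "h i j (fst z) = (if i = j then - (k (fst z))\<^sup>2 else 0) - 2 * n i (fst z) * n j (fst z)"
proof -
  have x: "fst z \<in> FM G c" using z by (auto simp: total_space_def)
  define \<kappa> where "\<kappa> = k (fst z)"
  define n1 where "n1 = n 1 (fst z)"
  define n2 where "n2 = n 2 (fst z)"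
  \<comment> \<open>These are \<open>fX\<close>, \<open>fY\<close>, \<open>fH\<close> without the
    sign \<epsilon>; in these variables the claim reads \<open>\<kappa> * X = - n1\<^sup>2\<close>,
    \<open>\<kappa> * Y = - n2\<^sup>2\<close>, \<open>\<kappa> * H = - n1 * n2\<close>.\<close>
  define X where "X = (\<kappa> * \<kappa> + h 1 1 (fst z)) / (2 * \<kappa>)"
  define Y where "Y = (\<kappa> * \<kappa> + h 2 2 (fst z)) / (2 * \<kappa>)"
  define H where "H = h 1 2 (fst z) / (2 * \<kappa>)"
  note vars = \<kappa>_def[symmetric] n1_def[symmetric] n2_def[symmetric]
  have \<kappa>: "\<kappa> > 0" unfolding \<kappa>_def by (rule k_pos)
  have h: "h 1 1 (fst z) = 2 * \<kappa> * X - \<kappa> * \<kappa>" "h 2 2 (fst z) = 2 * \<kappa> * Y - \<kappa> * \<kappa>" "h 1 2 (fst z) = 2 * \<kappa> * H"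
    unfolding X_def Y_def H_def using \<kappa> by simp_all
  have f: "fX (fst z) = \<epsilon> * X" "fY (fst z) = \<epsilon> * Y" "fH (fst z) = \<epsilon> * H"
    unfolding fX_def fY_def fH_def X_def Y_def H_def vars by simp_all
  obtain a0 a1 a2 a3 b0 b1 b2 b3 where
    ab0: "\<forall>t1 t2 t3 p r s. (\<forall>\<gamma>\<in>set fs. \<gamma> z (0, rigid (t1, t2, t3, p, r, s) (snd z)) = 0) \<longrightarrow>
      a0 * t3 + a1 * t1 + a2 * t2 + a3 * p + r = 0 \<and> b0 * t3 + b1 * t1 + b2 * t2 + b3 * p + s = 0"
    using vertical_coefficients[OF z] by blast
  note ab = ab0[THEN spec, THEN spec, THEN spec, THEN spec, THEN spec, THEN spec, THEN mp]
  have kill: "\<forall>\<gamma>\<in>set fs. \<gamma> z (0, rigid (m (fst z)) (snd z)) = 0" if "kills (\<lambda>_. 0) m" for m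
    using that z unfolding kills_def field_def by blast
  have U: "a0 = - n1 - a3 * \<epsilon> * \<kappa>" "b0 = - n2 - b3 * \<epsilon> * \<kappa>"
    using ab[OF kill[OF kills_U, unfolded mU_def vars]] by (simp_all add: algebra_simps)
  have A1: "a1 = \<epsilon> * H - a3 * n2" "b1 = \<epsilon> * Y - b3 * n2"
    using ab[OF kill[OF kills_A(1), unfolded mA1_def vars f]] by (simp_all add: algebra_simps)
  have A2: "a2 = a3 * n1 - \<epsilon> * X" "b2 = b3 * n1 - \<epsilon> * H"
    using ab[OF kill[OF kills_A(2), unfolded mA2_def vars f]] by (simp_all add: algebra_simps)
  note d = field_derivatives[OF x]
  \<comment> \<open>Brackets between purely Euclidean fields are commutators of motions, so they
    yield algebraic relations; derivatives of \<open>fH\<close>, \<open>fX\<close>,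
    \<open>fY\<close> appear only in the brackets with \<open>mZ1\<close> and
    \<open>mZ2\<close>.\<close>
  note UA1 = ab[OF bracket_vertical[OF z d(3) d(4) kills_U kills_A(1), unfolded mU_def mA1_def comm_def vars f prod.case]]
  note UA2 = ab[OF bracket_vertical[OF z d(3) d(5) kills_U kills_A(2), unfolded mU_def mA2_def comm_def vars f prod.case]]
  note AA = ab[OF bracket_vertical[OF z d(4) d(5) kills_A(1) kills_A(2), unfolded mA1_def mA2_def comm_def vars f prod.case]]
  note Z1A1 = ab[OF bracket_horiz_vertical[OF z d(1) d(4) kills_Z(1) kills_A(1),
      unfolded mZ1_def mA1_def comm_def vars f prod.case dn_horiz[OF x] h_sym[OF x] h add_Pair]]
  note Z1A2 = ab[OF bracket_horiz_vertical[OF z d(1) d(5) kills_Z(1) kills_A(2),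
      unfolded mZ1_def mA2_def comm_def vars f prod.case dn_horiz[OF x] h_sym[OF x] h add_Pair]]
  note Z2A1 = ab[OF bracket_horiz_vertical[OF z d(2) d(4) kills_Z(2) kills_A(1),
      unfolded mZ2_def mA1_def comm_def vars f prod.case dn_horiz[OF x] h_sym[OF x] h add_Pair]]
  note Z2A2 = ab[OF bracket_horiz_vertical[OF z d(2) d(5) kills_Z(2) kills_A(2),
      unfolded mZ2_def mA2_def comm_def vars f prod.case dn_horiz[OF x] h_sym[OF x] h add_Pair]]
  \<comment> \<open>This scaling absorbs \<epsilon>, so the eight equations look the same for both
    singular systems.\<close>
  define a where "a = - 2 * \<epsilon> * \<kappa> * a3"
  define b where "b = - 2 * \<epsilon> * \<kappa> * b3"
  have 1: "n1\<^sup>2 + n2\<^sup>2 + \<kappa> * Y + H\<^sup>2 - \<kappa> * X - X * Y = a * n1"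
    using conjunct1[OF UA1] \<epsilon>2 unfolding U A1 A2 a_def by algebra
  have 2: "- 2 * \<kappa> * H = a * n2"
    using conjunct1[OF UA2] \<epsilon>2 unfolding U A1 A2 a_def by algebra
  have 3: "- 2 * \<kappa> * H = b * n1"
    using conjunct2[OF UA1] \<epsilon>2 unfolding U A1 A2 b_def by algebra
  have 4: "n1\<^sup>2 + n2\<^sup>2 + \<kappa> * X + H\<^sup>2 - \<kappa> * Y - X * Y = b * n2"
    using conjunct2[OF UA2] \<epsilon>2 unfolding U A1 A2 b_def by algebra
  have 5: "- 4 * \<kappa> * (n2 * H + n1 * X) = a * (X * Y - H\<^sup>2 - \<kappa> * (X + Y) + n1\<^sup>2 + n2\<^sup>2)"
    using conjunct1[OF AA] \<epsilon>2 unfolding U A1 A2 a_def by algebra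
  have 6: "- 4 * \<kappa> * (n1 * H + n2 * Y) = b * (X * Y - H\<^sup>2 - \<kappa> * (X + Y) + n1\<^sup>2 + n2\<^sup>2)"
    using conjunct2[OF AA] \<epsilon>2 unfolding U A1 A2 b_def by algebra
  \<comment> \<open>The derivative of \<open>fH\<close> along \<open>horiz 2\<close> enters the
    first equation of \<open>Z2A1\<close> and the second of \<open>Z2A2\<close> with opposite signs
    and cancels in their sum; along \<open>horiz 1\<close> the same happens for \<open>Z1A1\<close>
    and \<open>Z1A2\<close>.\<close>
  have "2 * \<kappa> * (2 * \<kappa> * n1) = 2 * \<kappa> * (a * (\<kappa> - Y) + b * H)"
    using conjunct1[OF Z2A1] conjunct2[OF Z2A2] \<epsilon>2 unfolding U A1 A2 a_def b_def by algebra
  then have 7: "2 * \<kappa> * n1 = a * (\<kappa> - Y) + b * H" using \<kappa> by simp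
  have "2 * \<kappa> * (2 * \<kappa> * n2) = 2 * \<kappa> * (b * (\<kappa> - X) + a * H)"
    using conjunct1[OF Z1A1] conjunct2[OF Z1A2] \<epsilon>2 unfolding U A1 A2 a_def b_def by algebra
  then have 8: "2 * \<kappa> * n2 = b * (\<kappa> - X) + a * H" using \<kappa> by simp
  note sol = obstruction_algebra[OF \<kappa> 1 2 3 4 5 6 7 8]
  have "h 1 1 (fst z) = - \<kappa>\<^sup>2 - 2 * n1 * n1" "h 2 2 (fst z) = - \<kappa>\<^sup>2 - 2 * n2 * n2" "h 1 2 (fst z) = - 2 * n1 * n2"
    unfolding h using sol by (simp_all add: power2_eq_square mult.assoc)
  then show ?thesis
    using exhaust_2[of i] exhaust_2[of j] h_sym[OF x] unfolding \<kappa>_def n1_def n2_def by auto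
qed

end

section \<open>From the charts to the whole surface\<close>

theorem theorem4:
  fixes A :: "'p::{t2_space, second_countable_topology} chart set"
    and G :: "'p chart \<Rightarrow> real^2 \<Rightarrow> real^2^2"
    and \<eta>12 :: "'p chart \<Rightarrow> 2 frame form"
    and K k q :: "'p \<Rightarrow> real"
    and Q1 :: "2 \<Rightarrow> 'p chart \<Rightarrow> 2 frame \<Rightarrow> real"
    and Q2 :: "2 \<Rightarrow> 2 \<Rightarrow> 'p chart \<Rightarrow> 2 frame \<Rightarrow> real"
  assumes "connected (UNIV :: 'p set)"
    and "oriented_surface A"
    and "riemannian_metric A G"
    and "connection_form A G \<eta>12"
    and "gauss_curvature A G \<eta>12 K"
    and "\<And>p. K p < 0"
    and "\<And>p. k p = sqrt (- K p)"
    and "\<And>p. q p = k p powr (- 3 / 2)"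
    and "first_frame_derivs A G q Q1"
    and "second_frame_derivs A G \<eta>12 Q1 Q2"
  shows "darboux_integrable A G \<eta>12 K \<longleftrightarrow>
    (\<forall>c\<in>A. \<forall>z\<in>FM G c.
       Q2 1 1 c z = - 3 * frame_pullback q c z powr (- 1 / 3) \<and>
       Q2 2 2 c z = - 3 * frame_pullback q c z powr (- 1 / 3) \<and>
       Q2 1 2 c z = 0 \<and> Q2 2 1 c z = 0)"
proof -
  have patch: "surface_patch G \<eta>12 K q Q1 Q2 c" if c: "c \<in> A" for c
  proof
    show "open (chart_im c)" using assms(2) c unfolding oriented_surface_def by blast
    show "smooth_on (chart_im c) (G c)" "\<And>x. x \<in> chart_im c \<Longrightarrow> transpose (G c x) = G c x"
      using assms(3) c unfolding riemannian_metric_def by blast+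
    show "smooth_form_on (frame_dom c) (\<eta>12 c)"
      using assms(4) c unfolding connection_form_def smooth_frame_form_def by blast
    show "smooth_on (chart_im c) (K \<circ> chart_inv c)"
      using assms(5) c unfolding gauss_curvature_def smooth_function_on_surface_def by blast
    show "K p < 0" "q p = sqrt (- K p) powr (- 3 / 2)" for p
      using assms(6)[of p] assms(7,8)[of p] by simp_all
    show "smooth_on (frame_dom c) (Q1 i c)" for i
      using assms(9) c unfolding first_frame_derivs_def smooth_frame_function_def by blast
    show "smooth_on (frame_dom c) (Q2 i j c)" for i j
      using assms(10) c unfolding second_frame_derivs_def smooth_frame_function_def by blast
    fix z v w assume z: "z \<in> FM G c" and w: "w \<in> frame_tangent (G c) z"
    show "frechet_derivative (frame_pullback q c) (at z) w = (\<Sum>i\<in>UNIV. Q1 i c z * eta G c i z w)"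
      using assms(9) c z w unfolding first_frame_derivs_def by blast
    show "frechet_derivative (Q1 i c) (at z) w =
        (\<Sum>j\<in>UNIV. Q1 j c z * conn (\<eta>12 c) j i z w) + (\<Sum>j\<in>UNIV. Q2 i j c z * eta G c j z w)" for i
      using assms(10) c z w unfolding second_frame_derivs_def by blast
    assume v: "v \<in> frame_tangent (G c) z"
    show "ext_deriv (eta G c i) z w v = - (\<Sum>j\<in>UNIV. wedge (conn (\<eta>12 c) i j) (eta G c j) z w v)" for i
      using assms(4) c z v w unfolding connection_form_def by blast
    show "ext_deriv (\<eta>12 c) z w v = frame_pullback K c z * wedge (eta G c 1) (eta G c 2) z w v"
      using assms(5) c z v w unfolding gauss_curvature_def by blast
  qed
  have target: "(Q2 1 1 c z = - 3 * frame_pullback q c z powr (- 1 / 3) \<and>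
       Q2 2 2 c z = - 3 * frame_pullback q c z powr (- 1 / 3) \<and> Q2 1 2 c z = 0 \<and> Q2 2 1 c z = 0) \<longleftrightarrow>
     (\<forall>i j. Q2 i j c z = (if i = j then - 3 * frame_pullback q c z powr (- 1 / 3) else 0))" for c z
    by (auto simp: forall_2)
  show ?thesis
    unfolding target
  proof (intro iffI ballI allI)
    fix c z i j assume D: "darboux_integrable A G \<eta>12 K" and c: "c \<in> A" and z: "z \<in> FM G c"
    interpret surface_patch G \<eta>12 K q Q1 Q2 c by (rule patch[OF c])
    \<comment> \<open>A point of the total space over \<open>z\<close>, with the standard frame at
      the origin as Euclidean part; the equations to be proved depend on \<open>z\<close>
      alone.\<close>
    have zS: "(z, (0, mat 1)) \<in> total_space G c"
      using z by (simp add: total_space_def FE_def gram_def)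
    have "has_transverse_frobenius_subbundle (total_space G c) (total_tangent G c)
        (singular_system G \<eta>12 K 1 c) (theta G \<eta>12 c)"
      using D c unfolding darboux_integrable_def by simp
    from bspec[OF this[unfolded has_transverse_frobenius_subbundle_def] zS]
    obtain N fs where N: "open N" "(z, (0, mat 1)) \<in> N" "2 \<le> length fs" "\<forall>\<alpha>\<in>set fs. smooth_form_on N \<alpha>"
      and fs: "\<forall>y\<in>total_space G c \<inter> N. pfaff_independent (total_tangent G c) fs y \<and>
        pfaff_frobenius (total_tangent G c) fs y \<and>
        pfaff_span (total_tangent G c) fs y \<subseteq> pfaff_span (total_tangent G c) (singular_system G \<eta>12 K 1 c) y \<and>
        (\<forall>\<beta>\<in>pfaff_span (total_tangent G c) fs y \<inter> pfaff_span (total_tangent G c) (theta G \<eta>12 c) y.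
           \<forall>w\<in>total_tangent G c y. \<beta> w = 0)"
      by (elim exE conjE)
    interpret frobenius_patch G \<eta>12 K q Q1 Q2 c 1 N fs
    proof
      show "(1::real) = 1 \<or> (1::real) = -1" by simp
      show "open N" "2 \<le> length fs" by fact+
      show "smooth_form_on N \<gamma>" if "\<gamma> \<in> set fs" for \<gamma> using N(4) that by (rule bspec)
      fix y assume y: "y \<in> total_space G c \<inter> N"
      show "pfaff_independent (total_tangent G c) fs y" "pfaff_frobenius (total_tangent G c) fs y"
        "pfaff_span (total_tangent G c) fs y \<subseteq> pfaff_span (total_tangent G c) (singular_system G \<eta>12 K 1 c) y"
        using bspec[OF fs y] by simp_all
      show "\<beta> w = 0" if "\<beta> \<in> pfaff_span (total_tangent G c) fs y"
        "\<beta> \<in> pfaff_span (total_tangent G c) (theta G \<eta>12 c) y" "w \<in> total_tangent G c y" for \<beta> w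
        using bspec[OF fs y] that by simp
    qed
    show "Q2 i j c z = (if i = j then - 3 * frame_pullback q c z powr (- 1 / 3) else 0)"
      using necessity[of "(z, (0, mat 1))" i j] zS N(2) target_iff by simp
  next
    assume target: "\<forall>c\<in>A. \<forall>z\<in>FM G c. \<forall>i j.
      Q2 i j c z = (if i = j then - 3 * frame_pullback q c z powr (- 1 / 3) else 0)"
    show "darboux_integrable A G \<eta>12 K"
      unfolding darboux_integrable_def
    proof (intro ballI)
      fix c and \<epsilon> :: real assume c: "c \<in> A" and \<epsilon>: "\<epsilon> \<in> {1, -1}"
      interpret surface_patch G \<eta>12 K q Q1 Q2 c by (rule patch[OF c])
      show "has_transverse_frobenius_subbundle (total_space G c) (total_tangent G c)
          (singular_system G \<eta>12 K \<epsilon> c) (theta G \<eta>12 c)"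
      proof (rule sufficiency)
        show "\<epsilon> = 1 \<or> \<epsilon> = -1" using \<epsilon> by simp
        show "Q2 i j c z = (if i = j then - 3 * frame_pullback q c z powr (- 1 / 3) else 0)"
          if "z \<in> FM G c" for z i j
          using target c that by blast
      qed
    qed
  qed
qed

end
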